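(* Let $\mathcal C$ be a semisimple $k$-linear pivotal monoidal category and $n\ge1$ an integer. For every object $V$ in $\mathcal C$ we have $$\nu_n(V)=\underline{\mathrm{ptr}}^{\ell}\left(\underline{\mathrm{FS}}^{(n)}_V\right).$$ In addition, if $\mathcal C$ is spherical, then $\nu_n(V)=\nu_n(V^\vee)$.
   Context: Conventions. $k$ is a field. In a monoidal category the associativity isomorphism is $\Phi\colon (U\otimes V)\otimes W\to U\otimes (V\otimes W)$ and the unit object $I$ is strict: $V\otimes I=V=I\otimes V$. An object also denotes its identity morphism; $\mathcal C(X,Y)$ is the set of morphisms. A semisimple $k$-linear monoidal category is an abelian $k$-linear category with finite-dimensional morphism spaces, bilinear tensor product, every object a finite direct sum of simple objects (simple: endomorphism ring equal to $k$), and simple unit object, so $\mathcal C(I,I)=k$. A (left) dual of $V$ is $(V^\vee,\mathrm{ev}_V\colon V^\vee\otimes V\to I,\mathrm{db}_V\colon I\to V\otimes V^\vee)$ with $(V\otimes \mathrm{ev}_V)\Phi(\mathrm{db}_V\otimes V)=\mathrm{id}_V$ and $(\mathrm{ev}_V\otimes V^\vee)\Phi^{-1}(V^\vee\otimes\mathrm{db}_V)=\mathrm{id}_{V^\vee}$; a right dual $X$ of $V$ comes with $\mathrm{ev}\colon V\otimes X\to I$, $\mathrm{db}\colon I\to X\otimes V$ satisfying the mirror-image identities. Rigid means left duals exist (a semisimple rigid category then also has right duals); a choice of left duals is fixed with $I^\vee=I$. $(-)^\vee$ is a contravariant functor, with $f^\vee$ for $f\colon V\to W$ determined by $\mathrm{ev}_V(f^\vee\otimes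 V)=\mathrm{ev}_W(W^\vee\otimes f)$, and $(-)^{\vee\vee}$ is canonically monoidal. A pivotal monoidal category is a rigid one with a monoidal natural isomorphism $j_V\colon V\to V^{\vee\vee}$. Pivotal traces of $f\colon V\to V$: $\underline{\mathrm{ptr}}^r(f)=\mathrm{ev}_{V^\vee}(j_Vf\otimes V^\vee)\mathrm{db}_V$ and $\underline{\mathrm{ptr}}^\ell(f)=\mathrm{ev}_V(V^\vee\otimes fj_V^{-1})\mathrm{db}_{V^\vee}$, elements of $\mathcal C(I,I)=k$. $\mathcal C$ is spherical if $\underline{\mathrm{ptr}}^\ell(f)=\underline{\mathrm{ptr}}^r(f)$ for all endomorphisms $f$. Indicators. Put $V^{\otimes 0}=I$, $V^{\otimes(n+1)}=V\otimes V^{\otimes n}$, and let $\Phi^{(n)}\colon V^{\otimes(n-1)}\otimes V\to V^{\otimes n}$ be the canonical associativity isomorphism. Let $A_{V,W}\colon\mathcal C(I,V\otimes W)\to\mathcal C(V^\vee,W)$ be the bijection $A_{V,W}(f)=(\mathrm{ev}_V\otimes W)\Phi^{-1}(V^\vee\otimes f)$. Let $T_{VW}\colon\mathcal C(V^\vee,W)\to\mathcal C(W^\vee,V)$, $T_{VW}(f)=j_V^{-1}f^\vee$. Put $E_{VW}=A_{W,V}^{-1}T_{VW}A_{V,W}$ and $E_V^{(n)}(f)=\Phi^{(n)}E_{V,V^{\otimes(n-1)}}(f)$ for $f\in\mathcal C(I,V^{\otimes n})$. Then $\nu_n(V)=\mathrm{Tr}(E_V^{(n)})\in k$. Frobenius-Schur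 endomorphisms. A trivial object is one isomorphic to a finite direct sum of copies of $I$. A trivial component of $V$ is a triple $(V^{\mathrm{triv}},\iota,\pi)$ with $V^{\mathrm{triv}}$ trivial, $\iota\colon V^{\mathrm{triv}}\to V$, $\pi\colon V\to V^{\mathrm{triv}}$, $\pi\iota=\mathrm{id}$, such that $\iota$ and $\pi$ are the injection and projection of the $I$-isotypical component in the decomposition of $V$ into isotypical components (sums of copies of one simple). There is a unique isomorphism $\tau_{VT}\colon V\otimes T\to T\otimes V$, natural in $V\in\mathcal C$ and in trivial objects $T$, with $\tau_{VI}=\mathrm{id}_V$. Choose a right dual $X$ of $V^{\otimes(n-1)}$ and a trivial component $((V^{\otimes n})^{\mathrm{triv}},\iota,\pi)$. Then $\underline{\mathrm{FS}}^{(n)}_V\colon V\to V$ is the composite $$V\xrightarrow{U}X\otimes(V^{\otimes(n-1)}\otimes V)\xrightarrow{X\otimes\Phi^{(n)}}X\otimes V^{\otimes n}\xrightarrow{X\otimes\pi}X\otimes(V^{\otimes n})^{\mathrm{triv}}\xrightarrow{\tau}(V^{\otimes n})^{\mathrm{triv}}\otimes X\xrightarrow{\iota\otimes X}V^{\otimes n}\otimes X\xrightarrow{C}V,$$ where $U=\Phi(\mathrm{db}\otimes V)$ with $\mathrm{db}\colon I\to X\otimes V^{\otimes(n-1)}$, and $C=(V\otimes\mathrm{ev})\Phi$ with $\mathrm{ev}\colon V^{\otimes(n-1)}\otimes X\to I$. It is independent of the choices. *)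

theory Defs
  imports Complex_Main
begin

section \<open>Linear categories\<close>

text \<open>
  Every element of the type \<open>'o\<close> is an object. The morphism spaces are subspaces of one ambient
  \<open>'k\<close>-vector space \<open>'m\<close>, for instance of the direct sum of all of them, so that the zero morphisms
  are all represented by \<open>0\<close>. Every \<open>'k\<close>-linear category can be presented in this way, and nothing
  is assumed about how different morphism spaces meet. Since a morphism therefore need not determine
  its source and target, notions that depend on them take the objects as arguments.
  The composite \<open>g \<cdot> f\<close> means \<open>f\<close> first, and operations are constrained only on morphisms of
  the appropriate types.
\<close>

record ('o, 'm, 'k) lincat =
  hom :: "'o \<Rightarrow> 'o \<Rightarrow> 'm set"
  cmp :: "'m \<Rightarrow> 'm \<Rightarrow> 'm"  (infixl \<open>\<cdot>\<index>\<close> 67)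
  idm :: "'o \<Rightarrow> 'm"
  scl :: "'k \<Rightarrow> 'm \<Rightarrow> 'm"

locale linear_category = vector_space "scl C"
  for C :: "('o, 'm::ab_group_add, 'k::field, 'x) lincat_scheme" (structure) +
  assumes hom_subspace: "subspace (hom C X Y)"
    and idm_hom: "idm C X \<in> hom C X X"
    and cmp_hom: "\<lbrakk>g \<in> hom C Y Z; f \<in> hom C X Y\<rbrakk> \<Longrightarrow> g \<cdot> f \<in> hom C X Z"
    and idm_left: "f \<in> hom C X Y \<Longrightarrow> idm C Y \<cdot> f = f"
    and idm_right: "f \<in> hom C X Y \<Longrightarrow> f \<cdot> idm C X = f"
    and cmp_assoc: "\<lbrakk>h \<in> hom C Y Z; g \<in> hom C X Y; f \<in> hom C W X\<rbrakk> \<Longrightarrow>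
      (h \<cdot> g) \<cdot> f = h \<cdot> (g \<cdot> f)"
    and cmp_add_left: "\<lbrakk>g \<in> hom C Y Z; g' \<in> hom C Y Z; f \<in> hom C X Y\<rbrakk> \<Longrightarrow>
      (g + g') \<cdot> f = g \<cdot> f + g' \<cdot> f"
    and cmp_add_right: "\<lbrakk>g \<in> hom C Y Z; f \<in> hom C X Y; f' \<in> hom C X Y\<rbrakk> \<Longrightarrow>
      g \<cdot> (f + f') = g \<cdot> f + g \<cdot> f'"
    and cmp_scl_left: "\<lbrakk>g \<in> hom C Y Z; f \<in> hom C X Y\<rbrakk> \<Longrightarrow> scl C c g \<cdot> f = scl C c (g \<cdot> f)"
    and cmp_scl_right: "\<lbrakk>g \<in> hom C Y Z; f \<in> hom C X Y\<rbrakk> \<Longrightarrow> g \<cdot> scl C c f = scl C c (g \<cdot> f)"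

context
  fixes C :: "('o, 'm::ab_group_add, 'k::field, 'x) lincat_scheme" (structure)
begin

definition is_inverse :: "'o \<Rightarrow> 'o \<Rightarrow> 'm \<Rightarrow> 'm \<Rightarrow> bool" where
  "is_inverse X Y f g \<longleftrightarrow> g \<in> hom C Y X \<and> g \<cdot> f = idm C X \<and> f \<cdot> g = idm C Y"

definition is_iso :: "'o \<Rightarrow> 'o \<Rightarrow> 'm \<Rightarrow> bool" where
  "is_iso X Y f \<longleftrightarrow> f \<in> hom C X Y \<and> (\<exists>g. is_inverse X Y f g)"

definition inv_mor :: "'o \<Rightarrow> 'o \<Rightarrow> 'm \<Rightarrow> 'm" where
  "inv_mor X Y f = (THE g. is_inverse X Y f g)"

definition isomorphic :: "'o \<Rightarrow> 'o \<Rightarrow> bool" where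
  "isomorphic X Y \<longleftrightarrow> (\<exists>f. is_iso X Y f)"

definition is_mono :: "'o \<Rightarrow> 'o \<Rightarrow> 'm \<Rightarrow> bool" where
  "is_mono X Y f \<longleftrightarrow> f \<in> hom C X Y \<and>
     (\<forall>W. \<forall>g \<in> hom C W X. \<forall>h \<in> hom C W X. f \<cdot> g = f \<cdot> h \<longrightarrow> g = h)"

definition is_epi :: "'o \<Rightarrow> 'o \<Rightarrow> 'm \<Rightarrow> bool" where
  "is_epi X Y f \<longleftrightarrow> f \<in> hom C X Y \<and>
     (\<forall>W. \<forall>g \<in> hom C Y W. \<forall>h \<in> hom C Y W. g \<cdot> f = h \<cdot> f \<longrightarrow> g = h)"

definition is_kernel :: "'o \<Rightarrow> 'o \<Rightarrow> 'm \<Rightarrow> 'o \<Rightarrow> 'm \<Rightarrow> bool" where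
  "is_kernel X Y f K m \<longleftrightarrow> m \<in> hom C K X \<and> f \<cdot> m = 0 \<and>
     (\<forall>W. \<forall>g \<in> hom C W X. f \<cdot> g = 0 \<longrightarrow> (\<exists>!h. h \<in> hom C W K \<and> m \<cdot> h = g))"

definition is_cokernel :: "'o \<Rightarrow> 'o \<Rightarrow> 'm \<Rightarrow> 'o \<Rightarrow> 'm \<Rightarrow> bool" where
  "is_cokernel X Y f Q q \<longleftrightarrow> q \<in> hom C Y Q \<and> q \<cdot> f = 0 \<and>
     (\<forall>W. \<forall>g \<in> hom C Y W. g \<cdot> f = 0 \<longrightarrow> (\<exists>!h. h \<in> hom C Q W \<and> h \<cdot> q = g))"

text \<open>
  \<open>S\<close> is a direct sum of \<open>X 0, \<dots>, X (n - 1)\<close> with injections \<open>i j\<close> and projections \<open>p j\<close>.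
  For \<open>n = 0\<close> this says that \<open>S\<close> is a zero object. The notion is invariant under isomorphisms
  of \<open>S\<close>.
\<close>
definition is_direct_sum ::
  "nat \<Rightarrow> (nat \<Rightarrow> 'o) \<Rightarrow> 'o \<Rightarrow> (nat \<Rightarrow> 'm) \<Rightarrow> (nat \<Rightarrow> 'm) \<Rightarrow> bool" where
  "is_direct_sum n X S i p \<longleftrightarrow>
     (\<forall>j<n. i j \<in> hom C (X j) S \<and> p j \<in> hom C S (X j)) \<and>
     (\<forall>j<n. \<forall>l<n. p l \<cdot> i j = (if j = l then idm C (X j) else 0)) \<and>
     (\<Sum>j<n. i j \<cdot> p j) = idm C S"

text \<open>
  Besides being simple in the abelian category, a simple object is required to have endomorphism
  ring \<open>k\<close>. The latter condition alone would not be enough: all indecomposable modules over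
  Sweedler's four-dimensional Hopf algebra satisfy it.
\<close>
definition is_simple :: "'o \<Rightarrow> bool" where
  "is_simple S \<longleftrightarrow> idm C S \<noteq> 0 \<and>
     (\<forall>X m. is_mono X S m \<longrightarrow> m = 0 \<or> is_iso X S m) \<and>
     hom C S S = range (\<lambda>c. scl C c (idm C S))"

text \<open>\<open>W\<close> is (isomorphic to) a finite direct sum of copies of \<open>S\<close>.\<close>
definition is_multiple_of :: "'o \<Rightarrow> 'o \<Rightarrow> bool" where
  "is_multiple_of S W \<longleftrightarrow> (\<exists>n i p. is_direct_sum n (\<lambda>_. S) W i p)"

end

text \<open>
  The trace of a linear endomorphism \<open>\<phi>\<close> of a finite-dimensional subspace \<open>S\<close>: the sum of the diagonal
  coefficients of \<open>\<phi>\<close> with respect to a basis of \<open>S\<close>.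
\<close>
definition trace_on :: "('k::field \<Rightarrow> 'm::ab_group_add \<Rightarrow> 'm) \<Rightarrow> 'm set \<Rightarrow> ('m \<Rightarrow> 'm) \<Rightarrow> 'k" where
  "trace_on s S \<phi> =
     (let B = (SOME B. B \<subseteq> S \<and> \<not> module.dependent s B \<and> module.span s B = S)
      in \<Sum>b\<in>B. module.representation s B (\<phi> b) b)"

locale abelian_linear_category = linear_category +
  assumes direct_sums: "\<exists>S i p. is_direct_sum C n Xs S i p"
    and kernels: "f \<in> hom C X Y \<Longrightarrow> \<exists>K m. is_kernel C X Y f K m"
    and cokernels: "f \<in> hom C X Y \<Longrightarrow> \<exists>Q q. is_cokernel C X Y f Q q"
    and mono_normal: "is_mono C K X m \<Longrightarrow> \<exists>Y f. f \<in> hom C X Y \<and> is_kernel C X Y f K m"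
    and epi_normal: "is_epi C Y Q q \<Longrightarrow> \<exists>X f. f \<in> hom C X Y \<and> is_cokernel C X Y f Q q"


section \<open>Monoidal categories\<close>

record ('o, 'm, 'k) moncat = "('o, 'm, 'k) lincat" +
  unit_ob :: 'o  (\<open>\<one>\<index>\<close>)
  tns_ob :: "'o \<Rightarrow> 'o \<Rightarrow> 'o"  (infixr \<open>\<odot>\<index>\<close> 75)
  tns_mor :: "'m \<Rightarrow> 'm \<Rightarrow> 'm"  (infixr \<open>\<otimes>\<index>\<close> 70)
  assoc :: "'o \<Rightarrow> 'o \<Rightarrow> 'o \<Rightarrow> 'm"  (\<open>\<Phi>\<index>\<close>)

locale semisimple_monoidal_category = abelian_linear_category C
  for C :: "('o, 'm::ab_group_add, 'k::field, 'x) moncat_scheme" (structure) +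
  assumes tns_hom: "\<lbrakk>f \<in> hom C X Y; g \<in> hom C X' Y'\<rbrakk> \<Longrightarrow> f \<otimes> g \<in> hom C (X \<odot> X') (Y \<odot> Y')"
    and tns_idm: "idm C X \<otimes> idm C Y = idm C (X \<odot> Y)"
    and tns_cmp: "\<lbrakk>g \<in> hom C Y Z; f \<in> hom C X Y; g' \<in> hom C Y' Z'; f' \<in> hom C X' Y'\<rbrakk> \<Longrightarrow>
      (g \<cdot> f) \<otimes> (g' \<cdot> f') = (g \<otimes> g') \<cdot> (f \<otimes> f')"
    and tns_add_left: "\<lbrakk>f \<in> hom C X Y; f' \<in> hom C X Y; g \<in> hom C X' Y'\<rbrakk> \<Longrightarrow>
      (f + f') \<otimes> g = (f \<otimes> g) + (f' \<otimes> g)"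
    and tns_add_right: "\<lbrakk>f \<in> hom C X Y; g \<in> hom C X' Y'; g' \<in> hom C X' Y'\<rbrakk> \<Longrightarrow>
      f \<otimes> (g + g') = (f \<otimes> g) + (f \<otimes> g')"
    and tns_scl_left: "\<lbrakk>f \<in> hom C X Y; g \<in> hom C X' Y'\<rbrakk> \<Longrightarrow> scl C c f \<otimes> g = scl C c (f \<otimes> g)"
    and tns_scl_right: "\<lbrakk>f \<in> hom C X Y; g \<in> hom C X' Y'\<rbrakk> \<Longrightarrow> f \<otimes> scl C c g = scl C c (f \<otimes> g)"
    and unit_left_ob: "\<one> \<odot> X = X"
    and unit_right_ob: "X \<odot> \<one> = X"
    and unit_left_mor: "f \<in> hom C X Y \<Longrightarrow> idm C \<one> \<otimes> f = f"
    and unit_right_mor: "f \<in> hom C X Y \<Longrightarrow> f \<otimes> idm C \<one> = f"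
    and assoc_iso: "is_iso C ((U \<odot> V) \<odot> W) (U \<odot> (V \<odot> W)) (\<Phi> U V W)"
    and assoc_natural: "\<lbrakk>f \<in> hom C U U'; g \<in> hom C V V'; h \<in> hom C W W'\<rbrakk> \<Longrightarrow>
      \<Phi> U' V' W' \<cdot> ((f \<otimes> g) \<otimes> h) = (f \<otimes> (g \<otimes> h)) \<cdot> \<Phi> U V W"
    and pentagon: "\<Phi> U V (W \<odot> X) \<cdot> \<Phi> (U \<odot> V) W X =
      (idm C U \<otimes> \<Phi> V W X) \<cdot> \<Phi> U (V \<odot> W) X \<cdot> (\<Phi> U V W \<otimes> idm C X)"
    and triangle: "\<Phi> U \<one> W = idm C (U \<odot> W)"
    and hom_finite_dimensional: "\<exists>B. finite B \<and> span B = hom C X Y"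
    and semisimple: "\<exists>n S i p. (\<forall>j<n. is_simple C (S j)) \<and> is_direct_sum C n S V i p"
    and unit_simple: "is_simple C \<one>"

context
  fixes C :: "('o, 'm::ab_group_add, 'k::field, 'x) moncat_scheme" (structure)
begin

definition assoc_inv :: "'o \<Rightarrow> 'o \<Rightarrow> 'o \<Rightarrow> 'm" where
  "assoc_inv U V W = inv_mor C ((U \<odot> V) \<odot> W) (U \<odot> (V \<odot> W)) (\<Phi> U V W)"

primrec tpow :: "'o \<Rightarrow> nat \<Rightarrow> 'o" where
  "tpow V 0 = \<one>"
| "tpow V (Suc n) = V \<odot> tpow V n"

text \<open>
  \<open>assoc_pow V m\<close> is the canonical isomorphism from \<open>tpow V m \<odot> V\<close> to \<open>tpow V (m + 1)\<close>,
  usually written \<open>\<Phi>\<^bsup>(n)\<^esup>\<close> with \<open>n = m + 1\<close>; for \<open>m = 0\<close> both objects are equal to \<open>V\<close>.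
\<close>
primrec assoc_pow :: "'o \<Rightarrow> nat \<Rightarrow> 'm" where
  "assoc_pow V 0 = idm C V"
| "assoc_pow V (Suc m) = (idm C V \<otimes> assoc_pow V m) \<cdot> \<Phi> V (tpow V m) V"

definition is_left_dual :: "'o \<Rightarrow> 'o \<Rightarrow> 'm \<Rightarrow> 'm \<Rightarrow> bool" where
  "is_left_dual V D e d \<longleftrightarrow> e \<in> hom C (D \<odot> V) \<one> \<and> d \<in> hom C \<one> (V \<odot> D) \<and>
     (idm C V \<otimes> e) \<cdot> \<Phi> V D V \<cdot> (d \<otimes> idm C V) = idm C V \<and>
     (e \<otimes> idm C D) \<cdot> assoc_inv D V D \<cdot> (idm C D \<otimes> d) = idm C D"

definition is_right_dual :: "'o \<Rightarrow> 'o \<Rightarrow> 'm \<Rightarrow> 'm \<Rightarrow> bool" where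
  "is_right_dual V X e d \<longleftrightarrow> e \<in> hom C (V \<odot> X) \<one> \<and> d \<in> hom C \<one> (X \<odot> V) \<and>
     (e \<otimes> idm C V) \<cdot> assoc_inv V X V \<cdot> (idm C V \<otimes> d) = idm C V \<and>
     (idm C X \<otimes> e) \<cdot> \<Phi> X V X \<cdot> (d \<otimes> idm C X) = idm C X"

definition is_trivial :: "'o \<Rightarrow> bool" where
  "is_trivial T \<longleftrightarrow> is_multiple_of C \<one> T"

text \<open>
  \<open>W 0, \<dots>, W (m - 1)\<close> are the isotypical components of \<open>V\<close>, belonging to the pairwise non-isomorphic
  simple objects \<open>S 0, \<dots>, S (m - 1)\<close>, of which \<open>S 0\<close> is the unit object. Components may be zero, so
  the unit object may be listed even if it does not occur in \<open>V\<close>.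
\<close>
definition is_trivial_component :: "'o \<Rightarrow> 'o \<Rightarrow> 'm \<Rightarrow> 'm \<Rightarrow> bool" where
  "is_trivial_component V T \<iota> \<pi> \<longleftrightarrow>
     (\<exists>m S W i p. 0 < m \<and> S 0 = \<one> \<and>
        (\<forall>j<m. is_simple C (S j) \<and> is_multiple_of C (S j) (W j)) \<and>
        (\<forall>j<m. \<forall>l<m. j \<noteq> l \<longrightarrow> \<not> isomorphic C (S j) (S l)) \<and>
        is_direct_sum C m W V i p \<and>
        W 0 = T \<and> i 0 = \<iota> \<and> p 0 = \<pi>)"

definition is_trivial_swap :: "('o \<Rightarrow> 'o \<Rightarrow> 'm) \<Rightarrow> bool" where
  "is_trivial_swap t \<longleftrightarrow>
     (\<forall>V T. is_trivial T \<longrightarrow> is_iso C (V \<odot> T) (T \<odot> V) (t V T)) \<and>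
     (\<forall>V W T U f g. is_trivial T \<and> is_trivial U \<and> f \<in> hom C V W \<and> g \<in> hom C T U \<longrightarrow>
        (g \<otimes> f) \<cdot> t V T = t W U \<cdot> (f \<otimes> g)) \<and>
     (\<forall>V. t V \<one> = idm C V)"

text \<open>The family \<open>\<tau>\<close> is unique only on trivial objects \<open>T\<close>, so uniqueness is used componentwise.\<close>
definition trivial_swap :: "'o \<Rightarrow> 'o \<Rightarrow> 'm" where
  "trivial_swap V T = (THE s. \<exists>t. is_trivial_swap t \<and> s = t V T)"

text \<open>
  The composite defining the \<open>n\<close>-th Frobenius-Schur endomorphism of \<open>V\<close> for \<open>n \<ge> 1\<close>, from a right dual
  \<open>(X, e, d)\<close> of \<open>tpow V (n - 1)\<close> and a trivial component \<open>(T, \<iota>, \<pi>)\<close> of \<open>tpow V n\<close>.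
\<close>
definition fs_composite :: "nat \<Rightarrow> 'o \<Rightarrow> 'o \<Rightarrow> 'm \<Rightarrow> 'm \<Rightarrow> 'o \<Rightarrow> 'm \<Rightarrow> 'm \<Rightarrow> 'm" where
  "fs_composite n V X e d T \<iota> \<pi> =
     ((idm C V \<otimes> e) \<cdot> \<Phi> V (tpow V (n - 1)) X) \<cdot>
     (\<iota> \<otimes> idm C X) \<cdot>
     trivial_swap X T \<cdot>
     (idm C X \<otimes> \<pi>) \<cdot>
     (idm C X \<otimes> assoc_pow V (n - 1)) \<cdot>
     (\<Phi> X (tpow V (n - 1)) V \<cdot> (d \<otimes> idm C V))"

definition fs_endo :: "nat \<Rightarrow> 'o \<Rightarrow> 'm" where
  "fs_endo n V = (THE F. \<exists>X e d T \<iota> \<pi>. is_right_dual (tpow V (n - 1)) X e d \<and>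
     is_trivial_component (tpow V n) T \<iota> \<pi> \<and> F = fs_composite n V X e d T \<iota> \<pi>)"

end


section \<open>Pivotal categories\<close>

record ('o, 'm, 'k) pivcat = "('o, 'm, 'k) moncat" +
  dual :: "'o \<Rightarrow> 'o"  (\<open>(_\<^sup>\<or>\<index>)\<close> [1000] 1000)
  ev :: "'o \<Rightarrow> 'm"
  db :: "'o \<Rightarrow> 'm"
  piv :: "'o \<Rightarrow> 'm"

context
  fixes C :: "('o, 'm::ab_group_add, 'k::field, 'x) pivcat_scheme" (structure)
begin

definition dual_mor :: "'o \<Rightarrow> 'o \<Rightarrow> 'm \<Rightarrow> 'm" where
  "dual_mor V W f = (THE g. g \<in> hom C (W\<^sup>\<or>) (V\<^sup>\<or>) \<and>
     ev C V \<cdot> (g \<otimes> idm C V) = ev C W \<cdot> (idm C (W\<^sup>\<or>) \<otimes> f))"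

definition ddual_mor :: "'o \<Rightarrow> 'o \<Rightarrow> 'm \<Rightarrow> 'm" where
  "ddual_mor V W f = dual_mor (W\<^sup>\<or>) (V\<^sup>\<or>) (dual_mor V W f)"

text \<open>
  The canonical isomorphism from \<open>W\<^sup>\<or> \<odot> V\<^sup>\<or>\<close> to \<open>(V \<odot> W)\<^sup>\<or>\<close>, given by the evaluation of \<open>W\<^sup>\<or> \<odot> V\<^sup>\<or>\<close>
  against \<open>V \<odot> W\<close> obtained by nesting the evaluations of \<open>V\<close> and \<open>W\<close>.
\<close>
definition ev_nested :: "'o \<Rightarrow> 'o \<Rightarrow> 'm" where
  "ev_nested V W =
     ev C W \<cdot> (idm C (W\<^sup>\<or>) \<otimes> ((ev C V \<otimes> idm C W) \<cdot> assoc_inv C (V\<^sup>\<or>) V W)) \<cdot>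
     \<Phi> (W\<^sup>\<or>) (V\<^sup>\<or>) (V \<odot> W)"

definition dual_tensor :: "'o \<Rightarrow> 'o \<Rightarrow> 'm" where
  "dual_tensor V W = (THE g. g \<in> hom C (W\<^sup>\<or> \<odot> V\<^sup>\<or>) ((V \<odot> W)\<^sup>\<or>) \<and>
     ev C (V \<odot> W) \<cdot> (g \<otimes> idm C (V \<odot> W)) = ev_nested V W)"

text \<open>
  The monoidal structure of the double dual functor: \<open>ddual_tensor V W\<close> goes from
  \<open>V\<^sup>\<or>\<^sup>\<or> \<odot> W\<^sup>\<or>\<^sup>\<or>\<close> to \<open>(V \<odot> W)\<^sup>\<or>\<^sup>\<or>\<close> and \<open>ddual_unit\<close> from \<open>\<one>\<close> to \<open>\<one>\<^sup>\<or>\<^sup>\<or>\<close>. Here \<open>db C \<one>\<close> is, because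
  \<open>\<one> \<odot> \<one>\<^sup>\<or> = \<one>\<^sup>\<or>\<close>, the canonical isomorphism from \<open>\<one>\<close> to \<open>\<one>\<^sup>\<or>\<close>; it is not assumed to be the identity.
\<close>
definition ddual_tensor :: "'o \<Rightarrow> 'o \<Rightarrow> 'm" where
  "ddual_tensor V W =
     inv_mor C ((V \<odot> W)\<^sup>\<or>\<^sup>\<or>) ((W\<^sup>\<or> \<odot> V\<^sup>\<or>)\<^sup>\<or>)
       (dual_mor (W\<^sup>\<or> \<odot> V\<^sup>\<or>) ((V \<odot> W)\<^sup>\<or>) (dual_tensor V W)) \<cdot>
     dual_tensor (W\<^sup>\<or>) (V\<^sup>\<or>)"

definition ddual_unit :: 'm where
  "ddual_unit = inv_mor C (\<one>\<^sup>\<or>\<^sup>\<or>) (\<one>\<^sup>\<or>) (dual_mor \<one> (\<one>\<^sup>\<or>) (db C \<one>)) \<cdot> db C \<one>"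

definition piv_inv :: "'o \<Rightarrow> 'm" where
  "piv_inv V = inv_mor C V (V\<^sup>\<or>\<^sup>\<or>) (piv C V)"

definition ptr_right :: "'o \<Rightarrow> 'm \<Rightarrow> 'm" where
  "ptr_right V f = ev C (V\<^sup>\<or>) \<cdot> ((piv C V \<cdot> f) \<otimes> idm C (V\<^sup>\<or>)) \<cdot> db C V"

definition ptr_left :: "'o \<Rightarrow> 'm \<Rightarrow> 'm" where
  "ptr_left V f = ev C V \<cdot> (idm C (V\<^sup>\<or>) \<otimes> (f \<cdot> piv_inv V)) \<cdot> db C (V\<^sup>\<or>)"

definition spherical :: bool where
  "spherical \<longleftrightarrow> (\<forall>V. \<forall>f \<in> hom C V V. ptr_left V f = ptr_right V f)"

definition A_map :: "'o \<Rightarrow> 'o \<Rightarrow> 'm \<Rightarrow> 'm" where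
  "A_map V W f = (ev C V \<otimes> idm C W) \<cdot> assoc_inv C (V\<^sup>\<or>) V W \<cdot> (idm C (V\<^sup>\<or>) \<otimes> f)"

definition T_map :: "'o \<Rightarrow> 'o \<Rightarrow> 'm \<Rightarrow> 'm" where
  "T_map V W f = piv_inv V \<cdot> dual_mor (V\<^sup>\<or>) W f"

definition E_map :: "'o \<Rightarrow> 'o \<Rightarrow> 'm \<Rightarrow> 'm" where
  "E_map V W f = the_inv_into (hom C \<one> (W \<odot> V)) (A_map W V) (T_map V W (A_map V W f))"

text \<open>Both notions are meant for \<open>n \<ge> 1\<close>.\<close>
definition E_pow :: "nat \<Rightarrow> 'o \<Rightarrow> 'm \<Rightarrow> 'm" where
  "E_pow n V f = assoc_pow C V (n - 1) \<cdot> E_map V (tpow C V (n - 1)) f"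

definition fs_indicator :: "nat \<Rightarrow> 'o \<Rightarrow> 'k" where
  "fs_indicator n V = trace_on (scl C) (hom C \<one> (tpow C V n)) (E_pow n V)"

end

locale semisimple_pivotal_category = semisimple_monoidal_category C
  for C :: "('o, 'm::ab_group_add, 'k::field, 'x) pivcat_scheme" (structure) +
  assumes left_duals: "is_left_dual C V (V\<^sup>\<or>) (ev C V) (db C V)"
    and dual_unit_ob: "\<one>\<^sup>\<or> = \<one>"
    and piv_iso: "is_iso C V (V\<^sup>\<or>\<^sup>\<or>) (piv C V)"
    and piv_natural: "f \<in> hom C V W \<Longrightarrow> piv C W \<cdot> f = ddual_mor C V W f \<cdot> piv C V"
    and piv_tensor: "piv C (V \<odot> W) = ddual_tensor C V W \<cdot> (piv C V \<otimes> piv C W)"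
    and piv_unit: "piv C \<one> = ddual_unit C"

end

theory Submission
  imports Defs
begin

text \<open>
  Write \<open>V\<^sup>n\<close> for \<open>V \<odot> (V \<odot> \<dots> (V \<odot> \<one>))\<close>. Splitting the trivial component of \<open>V\<^sup>n\<close> into
  copies of \<open>\<one>\<close> gives morphisms \<open>f\<^sub>j : \<one> \<rightarrow> V\<^sup>n\<close> and \<open>g\<^sub>j : V\<^sup>n \<rightarrow> \<one>\<close>. By Schur's lemma no other isotypical
  component receives a morphism from \<open>\<one>\<close>, so \<open>x = \<Sum> f\<^sub>j \<cdot> (g\<^sub>j \<cdot> x)\<close> for all \<open>x : \<one> \<rightarrow> V\<^sup>n\<close>: the family is
  \<open>reproducing\<close>. Hence a linear endomorphism \<open>E\<close> of \<open>hom C \<one> V\<^sup>n\<close> has trace \<open>\<Sum> g\<^sub>j \<cdot> E f\<^sub>j\<close>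
  (\<open>trace_on_reproducing\<close>).

  On a sum of copies of \<open>\<one>\<close> the exchange \<open>\<tau>\<close> is the sum of the
  exchanges with the single copies, which are identities. So \<open>fs_composite\<close> is a sum over \<open>j\<close>, and in
  each summand the right dual \<open>X\<close> is straightened out by a zigzag identity. What remains is
  \<open>fs_summand f g = (V \<otimes> g) \<cdot> f\<^sub>V\<close> for \<open>f = f\<^sub>j\<close> and \<open>g = g\<^sub>j\<close>, where \<open>f\<^sub>V : V \<rightarrow> V\<^sup>n \<odot> V \<cong> V \<odot> V\<^sup>n\<close> inserts \<open>f\<close> to the
  left of \<open>V\<close> (\<open>fs_composite_eq\<close>). The sum is the same for all reproducing families
  (\<open>fs_summand_sum_independent\<close>), which makes \<open>fs_endo\<close> well defined.

  Naturality of duality morphisms turns \<open>E_map\<close> into \<open>f \<mapsto> (A f \<otimes> j\<^sup>-\<^sup>1) \<cdot> db\<close>, which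
  bends the first strand of \<open>f\<close> down, around the left of \<open>f\<close>, and up again on the right. Closing this
  picture with \<open>g\<close> gives the left pivotal trace of \<open>fs_summand f g\<close> (\<open>comp_E_arr\<close>).

  For the second claim, nested evaluations pair \<open>(V\<^sup>\<or>)\<^sup>n\<close> with \<open>V\<^sup>n\<close>. A reproducing family \<open>f'\<^sub>j, g'\<^sub>j\<close> of \<open>(V\<^sup>\<or>)\<^sup>n\<close> is
  carried by this pairing to a reproducing family \<open>f\<^sub>j, g\<^sub>j\<close> of \<open>V\<^sup>n\<close>, with \<open>f\<^sub>j\<close> coming from \<open>g'\<^sub>j\<close> and \<open>g\<^sub>j\<close>
  from \<open>f'\<^sub>j\<close> (\<open>reproducing_transfer\<close>), and \<open>fs_summand f'\<^sub>j g'\<^sub>j\<close> is the dual morphism of \<open>fs_summand f\<^sub>j g\<^sub>j\<close>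
  (\<open>fs_summand_dual\<close>). The left pivotal trace of \<open>F\<^sup>\<or>\<close> is the right pivotal trace of \<open>F\<close> (\<open>ptr_left_dual\<close>);
  this needs that \<open>j\<close> on \<open>V\<^sup>\<or>\<close> is inverse to the dual of \<open>j\<close> on \<open>V\<close>, and that follows from \<open>j\<close> being
  monoidal (\<open>ev_arr_piv_arr_piv_arr\<close>). Sphericity exchanges the two traces, so both indicators are
  the same sum.

  Objects \<open>V\<^sup>n \<odot> Z\<close> are replaced by the values at \<open>Z\<close> of the \<open>n\<close>-fold iterate of \<open>V \<odot> -\<close>. Iterates
  compose strictly; associators enter through the natural maps \<open>ev_at\<close> and \<open>db_at\<close> and the comparison
  maps \<open>strength\<close>, whose properties follow from the pentagon.
\<close>

section \<open>Arrows with source and target\<close>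

text \<open>
  An ambient morphism does not determine its source and target. Carrying them along lets the
  simplifier discharge all typing conditions of an equation between composites.
\<close>

datatype ('o, 'm) arrow = Arrow (src: 'o) (mor: 'm) (tgt: 'o)

context linear_category
begin

lemma is_inverse_unique:
  assumes f: "f \<in> hom C X Y" and g: "is_inverse C X Y f g" and h: "is_inverse C X Y f h"
  shows "g = h"
proof -
  have 1: "g \<in> hom C Y X" "h \<in> hom C Y X" using g h by (auto simp: is_inverse_def)
  have "g = (h \<cdot> f) \<cdot> g" using h 1 by (simp add: is_inverse_def idm_left)
  also have "\<dots> = h \<cdot> (f \<cdot> g)" using 1 f by (simp add: cmp_assoc)
  also have "\<dots> = h" using g 1 by (simp add: is_inverse_def idm_right)
  finally show ?thesis .
qed

lemma is_inverse_inv_mor: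
  assumes "is_iso C X Y f" shows "is_inverse C X Y f (inv_mor C X Y f)"
proof -
  obtain g where g: "is_inverse C X Y f g" and f: "f \<in> hom C X Y"
    using assms by (auto simp: is_iso_def)
  show ?thesis unfolding inv_mor_def
    by (rule theI[where P = "is_inverse C X Y f"], rule g) (rule is_inverse_unique[OF f _ g])
qed

lemma inv_mor_eqI: "f \<in> hom C X Y \<Longrightarrow> is_inverse C X Y f g \<Longrightarrow> inv_mor C X Y f = g"
  by (metis is_inverse_inv_mor is_inverse_unique is_iso_def)

end

context semisimple_monoidal_category
begin

definition arr :: "('o, 'm) arrow \<Rightarrow> bool" where
  "arr a \<longleftrightarrow> mor a \<in> hom C (src a) (tgt a)"

abbreviation typed :: "('o, 'm) arrow \<Rightarrow> 'o \<Rightarrow> 'o \<Rightarrow> bool"  (\<open>_ \<^bold>: _ \<rightarrow> _\<close> [51, 51, 51] 50) where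
  "a \<^bold>: X \<rightarrow> Y \<equiv> arr a \<and> src a = X \<and> tgt a = Y"

definition compose :: "('o, 'm) arrow \<Rightarrow> ('o, 'm) arrow \<Rightarrow> ('o, 'm) arrow"  (infixr \<open>\<bullet>\<close> 67) where
  "g \<bullet> f = Arrow (src f) (mor g \<cdot> mor f) (tgt g)"

definition ide :: "'o \<Rightarrow> ('o, 'm) arrow" where
  "ide X = Arrow X (idm C X) X"

definition ten :: "('o, 'm) arrow \<Rightarrow> ('o, 'm) arrow \<Rightarrow> ('o, 'm) arrow"  (infixr \<open>\<boxtimes>\<close> 70) where
  "a \<boxtimes> b = Arrow (src a \<odot> src b) (mor a \<otimes> mor b) (tgt a \<odot> tgt b)"

abbreviation whisker_left :: "'o \<Rightarrow> ('o, 'm) arrow \<Rightarrow> ('o, 'm) arrow"  (infixr \<open>\<rhd>\<close> 70) where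
  "X \<rhd> a \<equiv> ide X \<boxtimes> a"

abbreviation whisker_right :: "('o, 'm) arrow \<Rightarrow> 'o \<Rightarrow> ('o, 'm) arrow"  (infixl \<open>\<lhd>\<close> 70) where
  "a \<lhd> X \<equiv> a \<boxtimes> ide X"

definition asc :: "'o \<Rightarrow> 'o \<Rightarrow> 'o \<Rightarrow> ('o, 'm) arrow" where
  "asc U V W = Arrow ((U \<odot> V) \<odot> W) (\<Phi> U V W) (U \<odot> (V \<odot> W))"

definition asc_inv :: "'o \<Rightarrow> 'o \<Rightarrow> 'o \<Rightarrow> ('o, 'm) arrow" where
  "asc_inv U V W = Arrow (U \<odot> (V \<odot> W)) (assoc_inv C U V W) ((U \<odot> V) \<odot> W)"

lemma arrow_eqI: "src a = src b \<Longrightarrow> tgt a = tgt b \<Longrightarrow> mor a = mor b \<Longrightarrow> a = b"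
  by (rule arrow.expand) simp

lemma src_tgt_simps [simp]:
  "src (g \<bullet> f) = src f" "tgt (g \<bullet> f) = tgt g"
  "src (ide X) = X" "tgt (ide X) = X"
  "src (a \<boxtimes> b) = src a \<odot> src b" "tgt (a \<boxtimes> b) = tgt a \<odot> tgt b"
  "src (asc U V W) = (U \<odot> V) \<odot> W" "tgt (asc U V W) = U \<odot> (V \<odot> W)"
  "src (asc_inv U V W) = U \<odot> (V \<odot> W)" "tgt (asc_inv U V W) = (U \<odot> V) \<odot> W"
  by (simp_all add: compose_def ide_def ten_def asc_def asc_inv_def)

lemma mor_simps [simp]:
  "mor (g \<bullet> f) = mor g \<cdot> mor f" "mor (ide X) = idm C X" "mor (a \<boxtimes> b) = mor a \<otimes> mor b"
  "mor (asc U V W) = \<Phi> U V W" "mor (asc_inv U V W) = assoc_inv C U V W"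
  by (simp_all add: compose_def ide_def ten_def asc_def asc_inv_def)

lemma unit_ob_simps [simp]: "\<one> \<odot> X = X" "X \<odot> \<one> = X"
  by (rule unit_left_ob unit_right_ob)+

lemma assoc_hom: "\<Phi> U V W \<in> hom C ((U \<odot> V) \<odot> W) (U \<odot> (V \<odot> W))"
  using assoc_iso by (simp add: is_iso_def)

lemma is_inverse_assoc_inv:
  "is_inverse C ((U \<odot> V) \<odot> W) (U \<odot> (V \<odot> W)) (\<Phi> U V W) (assoc_inv C U V W)"
  unfolding assoc_inv_def by (rule is_inverse_inv_mor[OF assoc_iso])

lemma arr_comp [simp]: "arr g \<Longrightarrow> arr f \<Longrightarrow> src g = tgt f \<Longrightarrow> arr (g \<bullet> f)"
  by (auto simp: arr_def intro: cmp_hom)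

lemma arr_ide [simp]: "arr (ide X)"
  by (simp add: arr_def idm_hom)

lemma arr_ten [simp]: "arr a \<Longrightarrow> arr b \<Longrightarrow> arr (a \<boxtimes> b)"
  by (simp add: arr_def tns_hom)

lemma arr_asc [simp]: "arr (asc U V W)"
  by (simp add: arr_def assoc_hom)

lemma arr_asc_inv [simp]: "arr (asc_inv U V W)"
  using is_inverse_assoc_inv by (simp add: arr_def is_inverse_def)

lemma comp_assoc [simp]:
  "arr h \<Longrightarrow> arr g \<Longrightarrow> arr f \<Longrightarrow> src h = tgt g \<Longrightarrow> src g = tgt f \<Longrightarrow> (h \<bullet> g) \<bullet> f = h \<bullet> (g \<bullet> f)"
  by (rule arrow_eqI) (auto simp: arr_def intro: cmp_assoc)

lemma ide_comp [simp]: "arr f \<Longrightarrow> tgt f = X \<Longrightarrow> ide X \<bullet> f = f"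
  by (rule arrow_eqI) (auto simp: arr_def intro: idm_left)

lemma comp_ide [simp]: "arr f \<Longrightarrow> src f = X \<Longrightarrow> f \<bullet> ide X = f"
  by (rule arrow_eqI) (auto simp: arr_def intro: idm_right)

lemma comp_prefix:
  "g \<bullet> f = k \<Longrightarrow> arr g \<Longrightarrow> arr f \<Longrightarrow> arr h \<Longrightarrow> src g = tgt f \<Longrightarrow> src f = tgt h \<Longrightarrow>
    g \<bullet> (f \<bullet> h) = k \<bullet> h"
  by (metis comp_assoc)

lemma ide_ten_ide [simp]: "X \<rhd> ide Y = ide (X \<odot> Y)"
  by (rule arrow_eqI) (auto simp: tns_idm)

lemma unit_ten [simp]: "arr f \<Longrightarrow> \<one> \<rhd> f = f" "arr f \<Longrightarrow> f \<lhd> \<one> = f"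
  by (rule arrow_eqI; auto simp: arr_def intro: unit_left_mor unit_right_mor)+

lemma ten_comp_ten:
  "\<lbrakk>arr g; arr f; arr g'; arr f'; src g = tgt f; src g' = tgt f'\<rbrakk> \<Longrightarrow>
    (g \<boxtimes> g') \<bullet> (f \<boxtimes> f') = (g \<bullet> f) \<boxtimes> (g' \<bullet> f')"
  by (rule arrow_eqI) (auto simp: arr_def intro: tns_cmp[symmetric])

lemma asc_natural:
  "arr f \<Longrightarrow> arr g \<Longrightarrow> arr h \<Longrightarrow>
    asc (tgt f) (tgt g) (tgt h) \<bullet> ((f \<boxtimes> g) \<boxtimes> h) = (f \<boxtimes> (g \<boxtimes> h)) \<bullet> asc (src f) (src g) (src h)"
  by (rule arrow_eqI) (auto simp: arr_def intro: assoc_natural)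

lemma asc_asc_inv [simp]: "asc U V W \<bullet> asc_inv U V W = ide (U \<odot> (V \<odot> W))"
  and asc_inv_asc [simp]: "asc_inv U V W \<bullet> asc U V W = ide ((U \<odot> V) \<odot> W)"
  using is_inverse_assoc_inv[of U V W] by (auto intro!: arrow_eqI simp: is_inverse_def)

lemma asc_asc_inv_prefix [simp]:
  "arr f \<Longrightarrow> tgt f = U \<odot> (V \<odot> W) \<Longrightarrow> asc U V W \<bullet> asc_inv U V W \<bullet> f = f"
  "arr f \<Longrightarrow> tgt f = (U \<odot> V) \<odot> W \<Longrightarrow> asc_inv U V W \<bullet> asc U V W \<bullet> f = f"
  by (simp_all add: comp_prefix[OF asc_asc_inv] comp_prefix[OF asc_inv_asc])

lemma asc_unit_mid [simp]: "asc U \<one> W = ide (U \<odot> W)"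
  by (rule arrow_eqI) (simp_all add: triangle)

lemma asc_pentagon:
  "asc U V (W \<odot> X) \<bullet> asc (U \<odot> V) W X =
    (U \<rhd> asc V W X) \<bullet> asc U (V \<odot> W) X \<bullet> (asc U V W \<lhd> X)"
proof -
  have "asc U V (W \<odot> X) \<bullet> asc (U \<odot> V) W X =
    ((U \<rhd> asc V W X) \<bullet> asc U (V \<odot> W) X) \<bullet> (asc U V W \<lhd> X)"
    by (rule arrow_eqI) (simp_all add: pentagon del: comp_assoc)
  then show ?thesis by simp
qed

lemma asc_idempotent_imp_ide:
  assumes "asc U V W \<bullet> asc U V W = asc U V W" "(U \<odot> V) \<odot> W = U \<odot> (V \<odot> W)"
  shows "asc U V W = ide (U \<odot> (V \<odot> W))"
proof -
  have "asc U V W = asc_inv U V W \<bullet> (asc U V W \<bullet> asc U V W)"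
    using assms(2) by (simp del: asc_asc_inv)
  then show ?thesis using assms by simp
qed

text \<open>
  Kelly's argument: the pentagon with two adjacent units says that the associator is idempotent,
  and an invertible idempotent is an identity. The same holds for \<open>\<Phi> U V \<one>\<close>.
\<close>
lemma asc_unit_left [simp]: "asc \<one> V W = ide (V \<odot> W)"
  using asc_idempotent_imp_ide[of \<one> V W] asc_pentagon[of \<one> \<one> V W] by simp

lemma asc_unit_right [simp]: "asc U V \<one> = ide (U \<odot> V)"
  using asc_idempotent_imp_ide[of U V \<one>] asc_pentagon[of U V \<one> \<one>] by simp

section \<open>Dual pairs\<close>

text \<open>
  The naturality of the associator is stated with the sources or targets of the inner arrows
  computed, so that it rewrites in either direction without unknown objects.
\<close>
lemma asc_nat:
  "\<lbrakk>arr f; arr g; arr h; tgt f = U; tgt g = V; tgt h = W\<rbrakk> \<Longrightarrow>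
    asc U V W \<bullet> ((f \<boxtimes> g) \<boxtimes> h) = (f \<boxtimes> (g \<boxtimes> h)) \<bullet> asc (src f) (src g) (src h)"
  using asc_natural[of f g h] by simp

lemma asc_nat':
  "\<lbrakk>arr f; arr g; arr h; src f = U; src g = V; src h = W\<rbrakk> \<Longrightarrow>
    (f \<boxtimes> (g \<boxtimes> h)) \<bullet> asc U V W = asc (tgt f) (tgt g) (tgt h) \<bullet> ((f \<boxtimes> g) \<boxtimes> h)"
  using asc_natural[of f g h] by simp

lemma asc_inv_nat:
  "\<lbrakk>arr f; arr g; arr h; tgt f = U; tgt g = V; tgt h = W\<rbrakk> \<Longrightarrow>
    asc_inv U V W \<bullet> (f \<boxtimes> (g \<boxtimes> h)) = ((f \<boxtimes> g) \<boxtimes> h) \<bullet> asc_inv (src f) (src g) (src h)"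
proof -
  assume *: "arr f" "arr g" "arr h" "tgt f = U" "tgt g = V" "tgt h = W"
  have "asc_inv U V W \<bullet> (f \<boxtimes> (g \<boxtimes> h)) =
      asc_inv U V W \<bullet> ((f \<boxtimes> (g \<boxtimes> h)) \<bullet> asc (src f) (src g) (src h)) \<bullet> asc_inv (src f) (src g) (src h)"
    using * by simp
  also have "(f \<boxtimes> (g \<boxtimes> h)) \<bullet> asc (src f) (src g) (src h) = asc U V W \<bullet> ((f \<boxtimes> g) \<boxtimes> h)"
    using asc_natural[of f g h] * by simp
  finally show ?thesis using * by simp
qed

lemma asc_inv_nat':
  "\<lbrakk>arr f; arr g; arr h; src f = U; src g = V; src h = W\<rbrakk> \<Longrightarrow>
    ((f \<boxtimes> g) \<boxtimes> h) \<bullet> asc_inv U V W = asc_inv (tgt f) (tgt g) (tgt h) \<bullet> (f \<boxtimes> (g \<boxtimes> h))"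
  using asc_inv_nat[of f g h] by simp

lemma asc_inv_unit [simp]:
  "asc_inv \<one> V W = ide (V \<odot> W)" "asc_inv V \<one> W = ide (V \<odot> W)" "asc_inv V W \<one> = ide (V \<odot> W)"
  using asc_inv_asc[of \<one> V W] asc_inv_asc[of V \<one> W] asc_inv_asc[of V W \<one>]
  by (simp_all del: asc_inv_asc)

lemma ide_ten_comp:
  "arr g \<Longrightarrow> arr f \<Longrightarrow> src g = tgt f \<Longrightarrow> V \<rhd> (g \<bullet> f) = (V \<rhd> g) \<bullet> (V \<rhd> f)"
  by (simp add: ten_comp_ten)

lemma comp_ten_ide:
  "arr g \<Longrightarrow> arr f \<Longrightarrow> src g = tgt f \<Longrightarrow> (g \<bullet> f) \<lhd> V = (g \<lhd> V) \<bullet> (f \<lhd> V)"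
  by (simp add: ten_comp_ten)

lemma ten_split:
  "f \<^bold>: X \<rightarrow> Y \<Longrightarrow> g \<^bold>: X' \<rightarrow> Y' \<Longrightarrow> f \<boxtimes> g = (f \<lhd> Y') \<bullet> (X \<rhd> g)"
  "f \<^bold>: X \<rightarrow> Y \<Longrightarrow> g \<^bold>: X' \<rightarrow> Y' \<Longrightarrow> f \<boxtimes> g = (Y \<rhd> g) \<bullet> (f \<lhd> X')"
  by (simp_all add: ten_comp_ten)

lemma ten_swap:
  "f \<^bold>: X \<rightarrow> Y \<Longrightarrow> g \<^bold>: X' \<rightarrow> Y' \<Longrightarrow>
    (f \<lhd> Y') \<bullet> (X \<rhd> g) = (Y \<rhd> g) \<bullet> (f \<lhd> X')"
  by (simp add: ten_comp_ten)

lemma pentagon_asc_asc_inv: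
  "(U \<rhd> asc_inv V W X) \<bullet> asc U V (W \<odot> X) =
    asc U (V \<odot> W) X \<bullet> (asc U V W \<lhd> X) \<bullet> asc_inv (U \<odot> V) W X"
proof -
  have "(U \<rhd> asc_inv V W X) \<bullet> asc U V (W \<odot> X) =
      (U \<rhd> asc_inv V W X) \<bullet> (asc U V (W \<odot> X) \<bullet> asc (U \<odot> V) W X) \<bullet> asc_inv (U \<odot> V) W X"
    by simp
  also have "\<dots> = ((U \<rhd> asc_inv V W X) \<bullet> (U \<rhd> asc V W X)) \<bullet> asc U (V \<odot> W) X \<bullet>
      (asc U V W \<lhd> X) \<bullet> asc_inv (U \<odot> V) W X"
    unfolding asc_pentagon by simp
  also have "(U \<rhd> asc_inv V W X) \<bullet> (U \<rhd> asc V W X) = ide (U \<odot> ((V \<odot> W) \<odot> X))"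
    by (simp add: ten_comp_ten)
  finally show ?thesis by simp
qed

lemma pentagon_asc_inv_asc:
  "asc_inv U V (W \<odot> X) \<bullet> (U \<rhd> asc V W X) =
    asc (U \<odot> V) W X \<bullet> (asc_inv U V W \<lhd> X) \<bullet> asc_inv U (V \<odot> W) X"
proof -
  have R: "(asc U V W \<lhd> X) \<bullet> (asc_inv U V W \<lhd> X) = ide ((U \<odot> (V \<odot> W)) \<odot> X)"
    by (simp add: ten_comp_ten)
  have "asc_inv U V (W \<odot> X) \<bullet> (U \<rhd> asc V W X) =
      asc_inv U V (W \<odot> X) \<bullet> ((U \<rhd> asc V W X) \<bullet> asc U (V \<odot> W) X \<bullet> (asc U V W \<lhd> X)) \<bullet>
      (asc_inv U V W \<lhd> X) \<bullet> asc_inv U (V \<odot> W) X"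
    by (simp add: comp_prefix[OF R])
  also have "\<dots> = asc (U \<odot> V) W X \<bullet> (asc_inv U V W \<lhd> X) \<bullet> asc_inv U (V \<odot> W) X"
    unfolding asc_pentagon[symmetric] by simp
  finally show ?thesis .
qed

end

text \<open>
  \<open>D\<close> is a left dual of \<open>V\<close>, and \<open>V\<close> a right dual of \<open>D\<close>. Both roles are used: the chosen duals \<open>V\<^sup>\<or>\<close> are
  left duals, whereas \<open>fs_composite\<close> starts from a right dual.
\<close>
locale dual_pair = semisimple_monoidal_category C
  for C :: "('o, 'm::ab_group_add, 'k::field, 'x) moncat_scheme" (structure) +
  fixes V D :: 'o and e d :: "('o, 'm) arrow"
  assumes e_typed: "e \<^bold>: D \<odot> V \<rightarrow> \<one>" and d_typed: "d \<^bold>: \<one> \<rightarrow> V \<odot> D"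
    and zigzag_V: "(V \<rhd> e) \<bullet> asc V D V \<bullet> (d \<lhd> V) = ide V"
    and zigzag_D: "(e \<lhd> D) \<bullet> asc_inv D V D \<bullet> (D \<rhd> d) = ide D"
begin

lemma ed_simps [simp]: "arr e" "src e = D \<odot> V" "tgt e = \<one>" "arr d" "src d = \<one>" "tgt d = V \<odot> D"
  using e_typed d_typed by auto

text \<open>
  The counit and the unit of the adjunction between \<open>D \<odot> -\<close> and \<open>V \<odot> -\<close>; below, naturality and the
  triangle identities of this adjunction.
\<close>
definition ev_at :: "'o \<Rightarrow> ('o, 'm) arrow" where "ev_at Z = (e \<lhd> Z) \<bullet> asc_inv D V Z"
definition db_at :: "'o \<Rightarrow> ('o, 'm) arrow" where "db_at Z = asc V D Z \<bullet> (d \<lhd> Z)"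

lemma ev_at_db_at_typed [simp]:
  "arr (ev_at Z)" "src (ev_at Z) = D \<odot> (V \<odot> Z)" "tgt (ev_at Z) = Z"
  "arr (db_at Z)" "src (db_at Z) = Z" "tgt (db_at Z) = V \<odot> (D \<odot> Z)"
  by (simp_all add: ev_at_def db_at_def)

lemma ev_at_unit: "ev_at \<one> = e" and db_at_unit: "db_at \<one> = d"
  by (simp_all add: ev_at_def db_at_def)

lemma ev_at_natural:
  assumes "f \<^bold>: X \<rightarrow> Y" shows "ev_at Y \<bullet> (D \<rhd> (V \<rhd> f)) = f \<bullet> ev_at X"
proof -
  have "ev_at Y \<bullet> (D \<rhd> (V \<rhd> f)) = (e \<lhd> Y) \<bullet> asc_inv D V Y \<bullet> (D \<rhd> (V \<rhd> f))"
    using assms by (simp add: ev_at_def)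
  also have "\<dots> = ((e \<lhd> Y) \<bullet> ((D \<odot> V) \<rhd> f)) \<bullet> asc_inv D V X"
    using assms by (simp add: asc_inv_nat)
  also have "(e \<lhd> Y) \<bullet> ((D \<odot> V) \<rhd> f) = f \<bullet> (e \<lhd> X)"
    using assms ten_swap[of e "D \<odot> V" \<one> f X Y] by simp
  finally show ?thesis using assms by (simp add: ev_at_def)
qed

lemma db_at_natural:
  assumes "f \<^bold>: X \<rightarrow> Y" shows "db_at Y \<bullet> f = (V \<rhd> (D \<rhd> f)) \<bullet> db_at X"
proof -
  have "db_at Y \<bullet> f = asc V D Y \<bullet> ((d \<lhd> Y) \<bullet> f)"
    using assms by (simp add: db_at_def)
  also have "(d \<lhd> Y) \<bullet> f = ((V \<odot> D) \<rhd> f) \<bullet> (d \<lhd> X)"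
    using assms ten_swap[of d \<one> "V \<odot> D" f X Y] by simp
  also have "asc V D Y \<bullet> \<dots> = (asc V D Y \<bullet> ((V \<rhd> ide D) \<boxtimes> f)) \<bullet> (d \<lhd> X)"
    using assms by simp
  also have "\<dots> = ((V \<rhd> (D \<rhd> f)) \<bullet> asc V D X) \<bullet> (d \<lhd> X)"
    using assms by (subst asc_nat) simp_all
  finally show ?thesis using assms by (simp add: db_at_def)
qed

text \<open>
  The counit commutes with tensoring on the right, up to the associators which rebracket its source.
\<close>
lemma ev_at_ten:
  "ev_at Y \<lhd> Z = ev_at (Y \<odot> Z) \<bullet> (D \<rhd> asc V Y Z) \<bullet> asc D (V \<odot> Y) Z"
proof -
  have "ev_at (Y \<odot> Z) \<bullet> (D \<rhd> asc V Y Z) \<bullet> asc D (V \<odot> Y) Z =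
    (e \<lhd> (Y \<odot> Z)) \<bullet> (asc_inv D V (Y \<odot> Z) \<bullet> (D \<rhd> asc V Y Z)) \<bullet> asc D (V \<odot> Y) Z"
    by (simp add: ev_at_def)
  also have "\<dots> = ((e \<boxtimes> (Y \<rhd> ide Z)) \<bullet> asc (D \<odot> V) Y Z) \<bullet> (asc_inv D V Y \<lhd> Z)"
    by (simp add: pentagon_asc_inv_asc)
  also have "(e \<boxtimes> (Y \<rhd> ide Z)) \<bullet> asc (D \<odot> V) Y Z = asc \<one> Y Z \<bullet> ((e \<lhd> Y) \<lhd> Z)"
    by (subst asc_nat') simp_all
  finally show ?thesis by (simp add: ev_at_def comp_ten_ide)
qed

text \<open>
  The pentagon moves the factor \<open>Z\<close> out to the right, where the zigzag identity of \<open>V\<close> applies.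
\<close>
lemma ev_at_db_at: "(V \<rhd> ev_at Z) \<bullet> db_at (V \<odot> Z) = ide (V \<odot> Z)"
proof -
  have "(V \<rhd> ev_at Z) \<bullet> db_at (V \<odot> Z) =
    (V \<rhd> (e \<lhd> Z)) \<bullet> ((V \<rhd> asc_inv D V Z) \<bullet> asc V D (V \<odot> Z)) \<bullet> (d \<lhd> (V \<odot> Z))"
    by (simp add: ev_at_def db_at_def ide_ten_comp)
  also have "\<dots> = ((V \<rhd> (e \<lhd> Z)) \<bullet> asc V (D \<odot> V) Z) \<bullet> (asc V D V \<lhd> Z) \<bullet>
      (asc_inv (V \<odot> D) V Z \<bullet> (d \<boxtimes> (V \<rhd> ide Z)))"
    by (simp add: pentagon_asc_asc_inv)
  also have "(V \<rhd> (e \<lhd> Z)) \<bullet> asc V (D \<odot> V) Z = (V \<rhd> e) \<lhd> Z"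
    using asc_nat[of "ide V" e "ide Z" V \<one> Z] by simp
  also have "asc_inv (V \<odot> D) V Z \<bullet> (d \<boxtimes> (V \<rhd> ide Z)) = (d \<lhd> V) \<lhd> Z"
    by (subst asc_inv_nat) simp_all
  also have "((V \<rhd> e) \<lhd> Z) \<bullet> (asc V D V \<lhd> Z) \<bullet> ((d \<lhd> V) \<lhd> Z) =
      ((V \<rhd> e) \<bullet> asc V D V \<bullet> (d \<lhd> V)) \<lhd> Z"
    by (simp add: comp_ten_ide)
  finally show ?thesis by (simp add: zigzag_V)
qed

lemma ev_at_ten_db_at: "ev_at (D \<odot> Z) \<bullet> (D \<rhd> db_at Z) = ide (D \<odot> Z)"
proof -
  have "ev_at (D \<odot> Z) \<bullet> (D \<rhd> db_at Z) =
    (e \<lhd> (D \<odot> Z)) \<bullet> (asc_inv D V (D \<odot> Z) \<bullet> (D \<rhd> asc V D Z)) \<bullet> (D \<rhd> (d \<lhd> Z))"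
    by (simp add: ev_at_def db_at_def ide_ten_comp)
  also have "\<dots> = ((e \<boxtimes> (D \<rhd> ide Z)) \<bullet> asc (D \<odot> V) D Z) \<bullet> (asc_inv D V D \<lhd> Z) \<bullet>
      (asc_inv D (V \<odot> D) Z \<bullet> (D \<rhd> (d \<lhd> Z)))"
    by (simp add: pentagon_asc_inv_asc)
  also have "(e \<boxtimes> (D \<rhd> ide Z)) \<bullet> asc (D \<odot> V) D Z = (e \<lhd> D) \<lhd> Z"
    by (subst asc_nat') simp_all
  also have "asc_inv D (V \<odot> D) Z \<bullet> (D \<rhd> (d \<lhd> Z)) = (D \<rhd> d) \<lhd> Z"
    by (subst asc_inv_nat) simp_all
  also have "((e \<lhd> D) \<lhd> Z) \<bullet> (asc_inv D V D \<lhd> Z) \<bullet> ((D \<rhd> d) \<lhd> Z) =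
      ((e \<lhd> D) \<bullet> asc_inv D V D \<bullet> (D \<rhd> d)) \<lhd> Z"
    by (simp add: comp_ten_ide)
  finally show ?thesis by (simp add: zigzag_D)
qed

text \<open>
  The second adjunction given by a dual pair, between \<open>- \<odot> V\<close> and \<open>- \<odot> D\<close>. It determines morphisms
  into \<open>D\<close> by their pairing with \<open>V\<close>.
\<close>
definition rtranspose :: "'o \<Rightarrow> ('o, 'm) arrow \<Rightarrow> ('o, 'm) arrow" where
  "rtranspose Y h = (h \<lhd> D) \<bullet> asc_inv Y V D \<bullet> (Y \<rhd> d)"

definition runtranspose :: "'o \<Rightarrow> ('o, 'm) arrow \<Rightarrow> ('o, 'm) arrow" where
  "runtranspose Z g = (Z \<rhd> e) \<bullet> asc Z D V \<bullet> (g \<lhd> V)"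

lemma rtranspose_typed: "h \<^bold>: Y \<odot> V \<rightarrow> Z \<Longrightarrow> rtranspose Y h \<^bold>: Y \<rightarrow> Z \<odot> D"
  and runtranspose_typed: "g \<^bold>: Y \<rightarrow> Z \<odot> D \<Longrightarrow> runtranspose Z g \<^bold>: Y \<odot> V \<rightarrow> Z"
  by (simp_all add: rtranspose_def runtranspose_def)

text \<open>
  After \<open>h\<close> is moved to the outside, the pentagon leaves the zigzag identity of \<open>V\<close>, tensored with \<open>Y\<close>
  from the left.
\<close>
lemma runtranspose_rtranspose:
  assumes h: "h \<^bold>: Y \<odot> V \<rightarrow> Z" shows "runtranspose Z (rtranspose Y h) = h"
proof -
  have "runtranspose Z (rtranspose Y h) = (Z \<rhd> e) \<bullet> (asc Z D V \<bullet> ((h \<lhd> D) \<lhd> V)) \<bullet>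
      (asc_inv Y V D \<lhd> V) \<bullet> ((Y \<rhd> d) \<lhd> V)"
    using h by (simp add: rtranspose_def runtranspose_def comp_ten_ide)
  also have "asc Z D V \<bullet> ((h \<lhd> D) \<lhd> V) = (h \<boxtimes> (D \<rhd> ide V)) \<bullet> asc (Y \<odot> V) D V"
    using h by (subst asc_nat) simp_all
  also have "(Y \<rhd> d) \<lhd> V = asc_inv Y (V \<odot> D) V \<bullet> (Y \<rhd> (d \<lhd> V))"
    by (subst asc_inv_nat) simp_all
  also have "(Z \<rhd> e) \<bullet> ((h \<boxtimes> (D \<rhd> ide V)) \<bullet> asc (Y \<odot> V) D V) \<bullet>
      (asc_inv Y V D \<lhd> V) \<bullet> asc_inv Y (V \<odot> D) V \<bullet> (Y \<rhd> (d \<lhd> V)) =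
      ((Z \<rhd> e) \<bullet> (h \<lhd> (D \<odot> V))) \<bullet>
      (asc (Y \<odot> V) D V \<bullet> (asc_inv Y V D \<lhd> V) \<bullet> asc_inv Y (V \<odot> D) V) \<bullet> (Y \<rhd> (d \<lhd> V))"
    using h by simp
  also have "asc (Y \<odot> V) D V \<bullet> (asc_inv Y V D \<lhd> V) \<bullet> asc_inv Y (V \<odot> D) V =
      asc_inv Y V (D \<odot> V) \<bullet> (Y \<rhd> asc V D V)"
    by (rule pentagon_asc_inv_asc[symmetric])
  also have "(Z \<rhd> e) \<bullet> (h \<lhd> (D \<odot> V)) = h \<bullet> ((Y \<rhd> ide V) \<boxtimes> e)"
    using h ten_swap[of h "Y \<odot> V" Z e "D \<odot> V" \<one>] by simp
  also have "(h \<bullet> ((Y \<rhd> ide V) \<boxtimes> e)) \<bullet> (asc_inv Y V (D \<odot> V) \<bullet> (Y \<rhd> asc V D V)) \<bullet> (Y \<rhd> (d \<lhd> V)) =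
      h \<bullet> (((Y \<rhd> ide V) \<boxtimes> e) \<bullet> asc_inv Y V (D \<odot> V)) \<bullet> (Y \<rhd> asc V D V) \<bullet> (Y \<rhd> (d \<lhd> V))"
    using h by simp
  also have "((Y \<rhd> ide V) \<boxtimes> e) \<bullet> asc_inv Y V (D \<odot> V) = Y \<rhd> (V \<rhd> e)"
    by (subst asc_inv_nat') simp_all
  also have "h \<bullet> (Y \<rhd> (V \<rhd> e)) \<bullet> (Y \<rhd> asc V D V) \<bullet> (Y \<rhd> (d \<lhd> V)) =
      h \<bullet> (Y \<rhd> ((V \<rhd> e) \<bullet> asc V D V \<bullet> (d \<lhd> V)))"
    by (simp add: ide_ten_comp)
  finally show ?thesis using h by (simp add: zigzag_V)
qed

lemma rtranspose_runtranspose: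
  assumes g: "g \<^bold>: Y \<rightarrow> Z \<odot> D" shows "rtranspose Y (runtranspose Z g) = g"
proof -
  have "rtranspose Y (runtranspose Z g) = ((Z \<rhd> e) \<lhd> D) \<bullet> (asc Z D V \<lhd> D) \<bullet>
      (((g \<lhd> V) \<lhd> D) \<bullet> asc_inv Y V D) \<bullet> (Y \<rhd> d)"
    using g by (simp add: rtranspose_def runtranspose_def comp_ten_ide)
  also have "((g \<lhd> V) \<lhd> D) \<bullet> asc_inv Y V D = asc_inv (Z \<odot> D) V D \<bullet> (g \<boxtimes> (V \<rhd> ide D))"
    using g by (subst asc_inv_nat') simp_all
  also have "((Z \<rhd> e) \<lhd> D) = (Z \<rhd> (e \<lhd> D)) \<bullet> asc Z (D \<odot> V) D"
    by (subst asc_nat') simp_all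
  also have "((Z \<rhd> (e \<lhd> D)) \<bullet> asc Z (D \<odot> V) D) \<bullet> (asc Z D V \<lhd> D) \<bullet>
      (asc_inv (Z \<odot> D) V D \<bullet> (g \<boxtimes> (V \<rhd> ide D))) \<bullet> (Y \<rhd> d) =
      (Z \<rhd> (e \<lhd> D)) \<bullet> (asc Z (D \<odot> V) D \<bullet> (asc Z D V \<lhd> D) \<bullet> asc_inv (Z \<odot> D) V D) \<bullet>
      ((g \<lhd> (V \<odot> D)) \<bullet> (Y \<rhd> d))"
    using g by simp
  also have "asc Z (D \<odot> V) D \<bullet> (asc Z D V \<lhd> D) \<bullet> asc_inv (Z \<odot> D) V D =
      (Z \<rhd> asc_inv D V D) \<bullet> asc Z D (V \<odot> D)"
    by (rule pentagon_asc_asc_inv[symmetric])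
  also have "(g \<lhd> (V \<odot> D)) \<bullet> (Y \<rhd> d) = ((Z \<rhd> ide D) \<boxtimes> d) \<bullet> g"
    using g ten_swap[of g Y "Z \<odot> D" d \<one> "V \<odot> D"] by simp
  also have "(Z \<rhd> (e \<lhd> D)) \<bullet> ((Z \<rhd> asc_inv D V D) \<bullet> asc Z D (V \<odot> D)) \<bullet> (((Z \<rhd> ide D) \<boxtimes> d) \<bullet> g) =
      (Z \<rhd> (e \<lhd> D)) \<bullet> (Z \<rhd> asc_inv D V D) \<bullet> (asc Z D (V \<odot> D) \<bullet> ((Z \<rhd> ide D) \<boxtimes> d)) \<bullet> g"
    using g by simp
  also have "asc Z D (V \<odot> D) \<bullet> ((Z \<rhd> ide D) \<boxtimes> d) = Z \<rhd> (D \<rhd> d)"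
    by (subst asc_nat) simp_all
  also have "(Z \<rhd> (e \<lhd> D)) \<bullet> (Z \<rhd> asc_inv D V D) \<bullet> (Z \<rhd> (D \<rhd> d)) \<bullet> g =
      (Z \<rhd> ((e \<lhd> D) \<bullet> asc_inv D V D \<bullet> (D \<rhd> d))) \<bullet> g"
    using g by (simp add: ide_ten_comp)
  finally show ?thesis using g by (simp add: zigzag_D)
qed

text \<open>
  The case \<open>Z = \<one>\<close> of the adjunction: the universal property by which dual morphisms are defined.
\<close>
lemma ev_mate_unique:
  assumes "g \<^bold>: Y \<rightarrow> D" "g' \<^bold>: Y \<rightarrow> D" "e \<bullet> (g \<lhd> V) = e \<bullet> (g' \<lhd> V)"
  shows "g = g'"
proof -
  have "runtranspose \<one> g = runtranspose \<one> g'"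
    using assms by (simp add: runtranspose_def)
  then show ?thesis
    using rtranspose_runtranspose[of g Y \<one>] rtranspose_runtranspose[of g' Y \<one>] assms(1,2)
    by (metis unit_ob_simps(1))
qed

lemma ev_mate_exists:
  assumes "p \<^bold>: Y \<odot> V \<rightarrow> \<one>"
  shows "\<exists>g. g \<^bold>: Y \<rightarrow> D \<and> e \<bullet> (g \<lhd> V) = p"
proof (intro exI conjI)
  let ?g = "rtranspose Y p"
  show g: "arr ?g" "src ?g = Y" "tgt ?g = D" using rtranspose_typed[OF assms] by simp_all
  have "e \<bullet> (?g \<lhd> V) = runtranspose \<one> ?g"
    using g unfolding runtranspose_def by simp
  then show "e \<bullet> (?g \<lhd> V) = p"
    using runtranspose_rtranspose[OF assms] by simp
qed

end

section \<open>Isotypical decompositions\<close>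

context linear_category
begin

lemma zero_hom [simp]: "0 \<in> hom C X Y"
  by (rule subspace_0[OF hom_subspace])

lemma sum_hom: "(\<And>j. j \<in> A \<Longrightarrow> f j \<in> hom C X Y) \<Longrightarrow> (\<Sum>j\<in>A. f j) \<in> hom C X Y"
  by (rule subspace_sum[OF hom_subspace])

lemma cmp_zero_right: "g \<in> hom C Y Z \<Longrightarrow> g \<cdot> 0 = 0"
  using cmp_add_right[of g Y Z 0 Y 0] by simp

lemma cmp_zero_left: "f \<in> hom C X Y \<Longrightarrow> 0 \<cdot> f = 0"
  using cmp_add_left[of 0 Y Y 0 f X] by simp

lemma cmp_sum_right:
  assumes "g \<in> hom C Y Z" "\<And>j. j \<in> A \<Longrightarrow> f j \<in> hom C X Y"
  shows "g \<cdot> (\<Sum>j\<in>A. f j) = (\<Sum>j\<in>A. g \<cdot> f j)"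
  using assms(2)
proof (induction A rule: infinite_finite_induct)
  case (insert a A)
  have "g \<cdot> (f a + sum f A) = g \<cdot> f a + g \<cdot> sum f A"
    using insert.prems by (intro cmp_add_right[OF assms(1)]) (auto intro!: sum_hom)
  then show ?case using insert by simp
qed (simp_all add: cmp_zero_right[OF assms(1)])

lemma cmp_sum_left:
  assumes "f \<in> hom C X Y" "\<And>j. j \<in> A \<Longrightarrow> g j \<in> hom C Y Z"
  shows "(\<Sum>j\<in>A. g j) \<cdot> f = (\<Sum>j\<in>A. g j \<cdot> f)"
  using assms(2)
proof (induction A rule: infinite_finite_induct)
  case (insert a A)
  have "(g a + sum g A) \<cdot> f = g a \<cdot> f + sum g A \<cdot> f"
    using insert.prems by (intro cmp_add_left[OF _ _ assms(1)]) (auto intro!: sum_hom)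
  then show ?case using insert by simp
qed (simp_all add: cmp_zero_left[OF assms(1)])

lemma scl_hom: "f \<in> hom C X Y \<Longrightarrow> scl C c f \<in> hom C X Y"
  by (rule subspace_scale[OF hom_subspace])

lemma add_hom: "f \<in> hom C X Y \<Longrightarrow> g \<in> hom C X Y \<Longrightarrow> f + g \<in> hom C X Y"
  by (rule subspace_add[OF hom_subspace])

lemma diff_hom: "f \<in> hom C X Y \<Longrightarrow> g \<in> hom C X Y \<Longrightarrow> f - g \<in> hom C X Y"
  by (rule subspace_diff[OF hom_subspace])

lemma cmp_inner:
  assumes a: "a \<in> hom C Y Z" and b: "b \<in> hom C X Y" and c: "c \<in> hom C W X" and d: "d \<in> hom C U W"
  shows "(a \<cdot> b) \<cdot> (c \<cdot> d) = a \<cdot> ((b \<cdot> c) \<cdot> d)"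
  using cmp_assoc[OF a b cmp_hom[OF c d]] cmp_assoc[OF b c d] by simp

lemma isomorphic_sym: "isomorphic C X Y \<Longrightarrow> isomorphic C Y X"
  by (auto simp: isomorphic_def is_iso_def is_inverse_def)

lemma isomorphic_refl: "isomorphic C X X"
  using idm_hom idm_left[OF idm_hom] by (auto simp: isomorphic_def is_iso_def is_inverse_def)

end

context abelian_linear_category
begin

text \<open>
  Schur's lemma. The kernel of \<open>f\<close> is a monomorphism into \<open>S\<close>. If it is an isomorphism, then \<open>f = 0\<close>;
  if it is zero, then \<open>f\<close> is a monomorphism into the simple object \<open>T\<close>.
\<close>
lemma simple_hom_zero_or_iso:
  assumes S: "is_simple C S" and T: "is_simple C T" and f: "f \<in> hom C S T"
  shows "f = 0 \<or> is_iso C S T f"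
proof -
  obtain K m where K: "is_kernel C S T f K m" using kernels[OF f] by blast
  have m: "m \<in> hom C K S" and fm: "f \<cdot> m = 0"
    and univ: "\<And>W g. g \<in> hom C W S \<Longrightarrow> f \<cdot> g = 0 \<Longrightarrow> \<exists>!h. h \<in> hom C W K \<and> m \<cdot> h = g"
    using K by (auto simp: is_kernel_def)
  have "is_mono C K S m"
    unfolding is_mono_def
  proof (intro conjI allI ballI impI)
    fix W g h assume gh: "g \<in> hom C W K" "h \<in> hom C W K" "m \<cdot> g = m \<cdot> h"
    have "f \<cdot> (m \<cdot> g) = 0"
      using cmp_assoc[OF f m gh(1)] fm cmp_zero_left[OF gh(1)] by simp
    from univ[OF cmp_hom[OF m gh(1)] this] gh show "g = h" by auto
  qed (rule m)
  then consider "m = 0" | "is_iso C K S m" using S by (auto simp: is_simple_def)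
  then show ?thesis
  proof cases
    case 1
    have "is_mono C S T f"
      unfolding is_mono_def
    proof (intro conjI allI ballI impI)
      fix W g h assume gh: "g \<in> hom C W S" "h \<in> hom C W S" "f \<cdot> g = f \<cdot> h"
      have gh': "g - h \<in> hom C W S" using gh by (simp add: diff_hom)
      have "f \<cdot> (g - h) + f \<cdot> h = f \<cdot> g"
        using cmp_add_right[OF f gh' gh(2)] by simp
      then have "f \<cdot> (g - h) = 0" using gh by simp
      from univ[OF gh' this] obtain k where "k \<in> hom C W K" "m \<cdot> k = g - h" by blast
      then show "g = h" using 1 cmp_zero_left by fastforce
    qed (rule f)
    then show ?thesis using T by (auto simp: is_simple_def)
  next
    case 2
    then obtain h where h: "h \<in> hom C S K" "m \<cdot> h = idm C S"
      by (auto simp: is_iso_def is_inverse_def)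
    have "f = f \<cdot> (m \<cdot> h)" using h f idm_right by simp
    also have "\<dots> = 0" using cmp_assoc[OF f m h(1)] fm cmp_zero_left[OF h(1)] by simp
    finally show ?thesis by simp
  qed
qed

end

context linear_category
begin

lemma is_direct_sumD:
  assumes "is_direct_sum C n X S i p"
  shows "j < n \<Longrightarrow> i j \<in> hom C (X j) S" "j < n \<Longrightarrow> p j \<in> hom C S (X j)"
    "j < n \<Longrightarrow> l < n \<Longrightarrow> p l \<cdot> i j = (if j = l then idm C (X j) else 0)"
    "(\<Sum>j<n. i j \<cdot> p j) = idm C S"
  using assms by (auto simp: is_direct_sum_def)

lemma direct_sum_hom_into:
  assumes S: "is_direct_sum C n X S i p" and f: "f \<in> hom C Y S"
  shows "f = (\<Sum>j<n. i j \<cdot> (p j \<cdot> f))"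
proof -
  note D = is_direct_sumD[OF S]
  have "f = (\<Sum>j<n. i j \<cdot> p j) \<cdot> f" using D(4) idm_left[OF f] by simp
  also have "\<dots> = (\<Sum>j<n. (i j \<cdot> p j) \<cdot> f)"
    by (rule cmp_sum_left[OF f]) (auto intro: cmp_hom D)
  also have "\<dots> = (\<Sum>j<n. i j \<cdot> (p j \<cdot> f))"
    by (rule sum.cong) (auto intro: cmp_assoc D f)
  finally show ?thesis .
qed

lemma direct_sum_hom_from:
  assumes S: "is_direct_sum C n X S i p" and f: "f \<in> hom C S Y"
  shows "f = (\<Sum>j<n. (f \<cdot> i j) \<cdot> p j)"
proof -
  note D = is_direct_sumD[OF S]
  have "f = f \<cdot> (\<Sum>j<n. i j \<cdot> p j)" using D(4) idm_right[OF f] by simp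
  also have "\<dots> = (\<Sum>j<n. f \<cdot> (i j \<cdot> p j))"
    by (rule cmp_sum_right[OF f]) (auto intro: cmp_hom D)
  also have "\<dots> = (\<Sum>j<n. (f \<cdot> i j) \<cdot> p j)"
    by (rule sum.cong) (auto intro: cmp_assoc[symmetric] D f)
  finally show ?thesis .
qed

lemma direct_sum_hom_zero:
  assumes S: "is_direct_sum C n X S i p"
  shows "f \<in> hom C Y S \<Longrightarrow> (\<And>j g. j < n \<Longrightarrow> g \<in> hom C Y (X j) \<Longrightarrow> g = 0) \<Longrightarrow> f = 0"
    and "f \<in> hom C S Y \<Longrightarrow> (\<And>j g. j < n \<Longrightarrow> g \<in> hom C (X j) Y \<Longrightarrow> g = 0) \<Longrightarrow> f = 0"
proof -
  note D = is_direct_sumD[OF S]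
  assume f: "f \<in> hom C Y S" and z: "\<And>j g. j < n \<Longrightarrow> g \<in> hom C Y (X j) \<Longrightarrow> g = 0"
  have "i j \<cdot> (p j \<cdot> f) = 0" if "j < n" for j
    using z[OF that cmp_hom[OF D(2)[OF that] f]] cmp_zero_right[OF D(1)[OF that]] by simp
  then show "f = 0" by (subst direct_sum_hom_into[OF S f]) simp
next
  note D = is_direct_sumD[OF S]
  assume f: "f \<in> hom C S Y" and z: "\<And>j g. j < n \<Longrightarrow> g \<in> hom C (X j) Y \<Longrightarrow> g = 0"
  have "(f \<cdot> i j) \<cdot> p j = 0" if "j < n" for j
    using z[OF that cmp_hom[OF f D(1)[OF that]]] cmp_zero_left[OF D(2)[OF that]] by simp
  then show "f = 0" by (subst direct_sum_hom_from[OF S f]) simp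
qed

text \<open>
  A list of pairwise non-isomorphic simple objects that starts with a given one (later the unit
  object) and represents every \<open>X l\<close>.
\<close>
lemma simple_representatives:
  assumes "is_simple C S0" and "\<forall>l<(n::nat). is_simple C (X l)"
  shows "\<exists>m S k. 0 < m \<and> S 0 = S0 \<and> (\<forall>j<m. is_simple C (S j)) \<and>
    (\<forall>j<m. \<forall>l<m. j \<noteq> l \<longrightarrow> \<not> isomorphic C (S j) (S l)) \<and>
    (\<forall>l<n. k l < (m::nat) \<and> isomorphic C (X l) (S (k l)))"
  using assms(2)
proof (induction n)
  case 0
  show ?case by (rule exI[of _ 1], rule exI[of _ "\<lambda>_. S0"]) (auto simp: assms(1))
next
  case (Suc n)
  then obtain m S k where *: "0 < m" "S 0 = S0" "\<forall>j<m. is_simple C (S j)"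
    "\<forall>j<m. \<forall>l<m. j \<noteq> l \<longrightarrow> \<not> isomorphic C (S j) (S l)"
    "\<forall>l<n. k l < (m::nat) \<and> isomorphic C (X l) (S (k l))" by auto
  show ?case
  proof (cases "\<exists>j<m. isomorphic C (X n) (S j)")
    case True
    then obtain j where "j < m" "isomorphic C (X n) (S j)" by blast
    then show ?thesis using *
      by (intro exI[of _ m] exI[of _ S] exI[of _ "k(n := j)"]) (auto simp: less_Suc_eq)
  next
    case False
    then show ?thesis using * Suc.prems isomorphic_refl[of "X n"]
      by (intro exI[of _ "Suc m"] exI[of _ "S(m := X n)"] exI[of _ "k(n := m)"])
        (auto simp: less_Suc_eq dest: isomorphic_sym)
  qed
qed

end

context abelian_linear_category
begin

text \<open>
  The summands \<open>X l\<close> isomorphic to \<open>S j\<close> are collected: \<open>W j\<close> is the direct sum of as many copies of \<open>S j\<close>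
  itself, so that it is visibly a multiple of \<open>S j\<close>, and the isomorphisms \<open>X l \<rightarrow> S j\<close> are absorbed into
  the injections and projections.
\<close>
lemma isotypical_decomposition_exists:
  assumes S0: "is_simple C S0" and X: "\<forall>l<n. is_simple C (X l)" and V: "is_direct_sum C n X V x y"
  shows "\<exists>m S W i p. 0 < m \<and> S 0 = S0 \<and>
    (\<forall>j<m. is_simple C (S j) \<and> is_multiple_of C (S j) (W j)) \<and>
    (\<forall>j<m. \<forall>l<m. j \<noteq> l \<longrightarrow> \<not> isomorphic C (S j) (S l)) \<and> is_direct_sum C m W V i p"
proof -
  note D = is_direct_sumD[OF V]
  obtain m S k where m: "0 < m" "S 0 = S0" "\<forall>j<m. is_simple C (S j)"
    "\<forall>j<m. \<forall>l<m. j \<noteq> l \<longrightarrow> \<not> isomorphic C (S j) (S l)"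
    and k: "\<And>l. l < n \<Longrightarrow> k l < (m::nat) \<and> isomorphic C (X l) (S (k l))"
    using simple_representatives[OF S0 X] by blast
  have "\<exists>u v. l < n \<longrightarrow> u \<in> hom C (X l) (S (k l)) \<and> v \<in> hom C (S (k l)) (X l) \<and>
      v \<cdot> u = idm C (X l) \<and> u \<cdot> v = idm C (S (k l))" for l
    using k[of l] by (auto simp: isomorphic_def is_iso_def is_inverse_def)
  then obtain u v where uv: "\<And>l. l < n \<Longrightarrow> u l \<in> hom C (X l) (S (k l))"
      "\<And>l. l < n \<Longrightarrow> v l \<in> hom C (S (k l)) (X l)"
      "\<And>l. l < n \<Longrightarrow> v l \<cdot> u l = idm C (X l)" "\<And>l. l < n \<Longrightarrow> u l \<cdot> v l = idm C (S (k l))"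
    by metis
  \<comment> \<open>the summands of type \<open>j\<close>, to be enumerated by \<open>h j\<close>\<close>
  define A where "A j = {l. l < n \<and> k l = j}" for j
  have finA: "finite (A j)" for j by (simp add: A_def)
  have "\<exists>h. bij_betw h {..<card (A j)} (A j)" for j
    using ex_bij_betw_nat_finite[OF finA] by (simp add: atLeast0LessThan)
  then obtain h where h: "\<And>j. bij_betw (h j) {..<card (A j)} (A j)" by metis
  have hA: "h j r < n" "k (h j r) = j" if "r < card (A j)" for j r
    using bij_betwE[OF h[of j]] that by (auto simp: A_def)
  have "\<exists>W a b. is_direct_sum C (card (A j)) (\<lambda>_. S j) W a b" for j by (rule direct_sums)
  then obtain W a b where W: "\<And>j. is_direct_sum C (card (A j)) (\<lambda>_. S j) (W j) (a j) (b j)"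
    by metis
  note E = is_direct_sumD[OF W]
  define x' where "x' j r = x (h j r) \<cdot> v (h j r)" for j r
  define y' where "y' j r = u (h j r) \<cdot> y (h j r)" for j r
  have x': "x' j r \<in> hom C (S j) V" if "r < card (A j)" for j r
    using D(1) uv(2) hA[OF that] unfolding x'_def by (metis cmp_hom)
  have y': "y' j r \<in> hom C V (S j)" if "r < card (A j)" for j r
    using D(2) uv(1) hA[OF that] unfolding y'_def by (metis cmp_hom)
  have yx: "y' l s \<cdot> x' j r = (if j = l \<and> r = s then idm C (S j) else 0)"
    if r: "r < card (A j)" and s: "s < card (A l)" for j l r s
  proof -
    let ?p = "h j r" and ?q = "h l s"
    have p: "?p < n" "k ?p = j" and q: "?q < n" "k ?q = l" using hA r s by auto
    have "y' l s \<cdot> x' j r = u ?q \<cdot> ((y ?q \<cdot> x ?p) \<cdot> v ?p)"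
      unfolding x'_def y'_def
      by (rule cmp_inner[OF uv(1)[OF q(1)] D(2)[OF q(1)] D(1)[OF p(1)] uv(2)[OF p(1)]])
    also have "\<dots> = (if j = l \<and> r = s then idm C (S j) else 0)"
    proof (cases "?p = ?q")
      case True
      then have jl: "j = l" using p q by simp
      then have "r = s" using True h[of j] r s
        by (auto simp: bij_betw_def inj_on_def)
      then show ?thesis using True jl p D(3) uv(4)[OF p(1)] idm_left[OF uv(2)[OF p(1)]] by simp
    next
      case False
      then have "\<not> (j = l \<and> r = s)" by auto
      then show ?thesis using False p q D(3) cmp_zero_left[OF uv(2)[OF p(1)]]
          cmp_zero_right[OF uv(1)[OF q(1)]] by auto
    qed
    finally show ?thesis .
  qed
  define i where "i j = (\<Sum>r<card (A j). x' j r \<cdot> b j r)" for j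
  define p where "p j = (\<Sum>r<card (A j). a j r \<cdot> y' j r)" for j
  have i: "i j \<in> hom C (W j) V" for j
    unfolding i_def by (rule sum_hom) (auto intro: cmp_hom x' E)
  have p: "p j \<in> hom C V (W j)" for j
    unfolding p_def by (rule sum_hom) (auto intro: cmp_hom y' E)
  have y'i: "y' l s \<cdot> i j = (if j = l then b l s else 0)" if s: "s < card (A l)" for j l s
  proof -
    have "y' l s \<cdot> i j = (\<Sum>r<card (A j). y' l s \<cdot> (x' j r \<cdot> b j r))"
      unfolding i_def by (rule cmp_sum_right[OF y'[OF s]]) (auto intro: cmp_hom x' E)
    also have "\<dots> = (\<Sum>r<card (A j). (y' l s \<cdot> x' j r) \<cdot> b j r)"
      by (rule sum.cong) (auto intro!: cmp_assoc[symmetric] x' y' s E)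
    also have "\<dots> = (\<Sum>r<card (A j). if r = s then if j = l then b j r else 0 else 0)"
      by (rule sum.cong) (auto simp: s yx idm_left[OF E(2)] cmp_zero_left[OF E(2)])
    also have "\<dots> = (if j = l then b l s else 0)" using s by (auto simp: sum.delta)
    finally show ?thesis .
  qed
  have pi: "p l \<cdot> i j = (if j = l then idm C (W j) else 0)" for j l
  proof -
    have "p l \<cdot> i j = (\<Sum>r<card (A l). (a l r \<cdot> y' l r) \<cdot> i j)"
      unfolding p_def by (rule cmp_sum_left[OF i]) (auto intro: cmp_hom y' E)
    also have "\<dots> = (\<Sum>r<card (A l). a l r \<cdot> (y' l r \<cdot> i j))"
      by (rule sum.cong) (auto intro!: cmp_assoc y' i E)
    also have "\<dots> = (if j = l then \<Sum>r<card (A l). a l r \<cdot> b l r else 0)"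
    proof (cases "j = l")
      case False
      have "a l r \<cdot> 0 = 0" if "r < card (A l)" for r using E(1)[OF that] by (rule cmp_zero_right)
      then show ?thesis using False by (simp add: y'i)
    qed (simp add: y'i)
    also have "\<dots> = (if j = l then idm C (W j) else 0)" using E(4) by simp
    finally show ?thesis .
  qed
  have ip: "i j \<cdot> p j = (\<Sum>l\<in>A j. x l \<cdot> y l)" for j
  proof -
    have bp: "b j r \<cdot> p j = y' j r" if r: "r < card (A j)" for r
    proof -
      have "b j r \<cdot> p j = (\<Sum>s<card (A j). b j r \<cdot> (a j s \<cdot> y' j s))"
        unfolding p_def by (rule cmp_sum_right[OF E(2)[OF r]]) (auto intro: cmp_hom y' E)
      also have "\<dots> = (\<Sum>s<card (A j). (b j r \<cdot> a j s) \<cdot> y' j s)"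
        by (rule sum.cong) (auto intro!: cmp_assoc[symmetric] y' r E)
      also have "\<dots> = (\<Sum>s<card (A j). if s = r then y' j s else 0)"
        by (rule sum.cong) (auto simp: r E(3) idm_left[OF y'] cmp_zero_left[OF y'])
      finally show ?thesis using r by (simp add: sum.delta)
    qed
    have "i j \<cdot> p j = (\<Sum>r<card (A j). (x' j r \<cdot> b j r) \<cdot> p j)"
      unfolding i_def by (rule cmp_sum_left[OF p]) (auto intro: cmp_hom x' E)
    also have "\<dots> = (\<Sum>r<card (A j). x' j r \<cdot> (b j r \<cdot> p j))"
      by (rule sum.cong) (auto intro!: cmp_assoc x' p E)
    also have "\<dots> = (\<Sum>r<card (A j). x (h j r) \<cdot> y (h j r))"
    proof (rule sum.cong[OF refl])
      fix r assume "r \<in> {..<card (A j)}"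
      then have r: "r < card (A j)" by simp
      let ?l = "h j r"
      note l = hA[OF r]
      have "x' j r \<cdot> (b j r \<cdot> p j) = x ?l \<cdot> ((v ?l \<cdot> u ?l) \<cdot> y ?l)"
        unfolding bp[OF r] x'_def y'_def
        by (rule cmp_inner[OF D(1)[OF l(1)] uv(2)[OF l(1)] uv(1)[OF l(1)] D(2)[OF l(1)]])
      also have "\<dots> = x ?l \<cdot> y ?l" using uv(3) l idm_left[OF D(2)] by simp
      finally show "x' j r \<cdot> (b j r \<cdot> p j) = x ?l \<cdot> y ?l" .
    qed
    also have "\<dots> = (\<Sum>l\<in>A j. x l \<cdot> y l)"
      by (rule sum.reindex_bij_betw[OF h])
    finally show ?thesis .
  qed
  have "(\<Sum>j<m. i j \<cdot> p j) = (\<Sum>j<m. \<Sum>l | l \<in> {..<n} \<and> k l = j. x l \<cdot> y l)"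
    unfolding ip A_def by (rule sum.cong) (auto intro: sum.cong)
  also have "\<dots> = (\<Sum>l<n. x l \<cdot> y l)"
    by (rule sum.group) (use k in auto)
  finally have "(\<Sum>j<m. i j \<cdot> p j) = idm C V" using D(4) by simp
  then have "is_direct_sum C m W V i p" using i p pi by (simp add: is_direct_sum_def)
  moreover have "is_multiple_of C (S j) (W j)" for j
    using W[of j] by (auto simp: is_multiple_of_def)
  ultimately show ?thesis using m by blast
qed

end

section \<open>Morphisms from and to the unit object\<close>

context semisimple_monoidal_category
begin

lemma unit_scalar: "x \<in> hom C \<one> \<one> \<Longrightarrow> \<exists>c. x = scl C c (idm C \<one>)"
  using unit_simple by (auto simp: is_simple_def)

lemma unit_idm_nonzero: "idm C \<one> \<noteq> 0"
  using unit_simple by (auto simp: is_simple_def)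

text \<open>
  Endomorphisms of the unit are scalars, and the unit is strict. Hence the
  exchange defined below is natural in trivial objects.
\<close>
lemma unit_endo_central:
  assumes "x \<in> hom C \<one> \<one>" shows "x \<otimes> idm C W = idm C W \<otimes> x"
proof -
  obtain c where x: "x = scl C c (idm C \<one>)" using unit_scalar[OF assms] by blast
  show ?thesis
    unfolding x using tns_scl_left[OF idm_hom[of \<one>] idm_hom[of W], of c]
      tns_scl_right[OF idm_hom[of W] idm_hom[of \<one>], of c]
      unit_left_mor[OF idm_hom[of W]] unit_right_mor[OF idm_hom[of W]] by simp
qed

lemma zero_tns: "g \<in> hom C X' Y' \<Longrightarrow> 0 \<otimes> g = 0"
  using tns_add_left[of 0 X' Y' 0 g X' Y'] by simp

lemma tns_zero: "g \<in> hom C X' Y' \<Longrightarrow> g \<otimes> 0 = 0"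
  using tns_add_right[of g X' Y' 0 X' Y' 0] by simp

lemma tns_cmp_left:
  "\<lbrakk>g \<in> hom C Y Z; f \<in> hom C X Y\<rbrakk> \<Longrightarrow> (g \<cdot> f) \<otimes> idm C W = (g \<otimes> idm C W) \<cdot> (f \<otimes> idm C W)"
  using tns_cmp[of g Y Z f X "idm C W" W W "idm C W" W] idm_left[OF idm_hom, of W] idm_hom by simp

lemma tns_cmp_right:
  "\<lbrakk>g \<in> hom C Y Z; f \<in> hom C X Y\<rbrakk> \<Longrightarrow> idm C W \<otimes> (g \<cdot> f) = (idm C W \<otimes> g) \<cdot> (idm C W \<otimes> f)"
  using tns_cmp[of "idm C W" W W "idm C W" W g Y Z f X] idm_left[OF idm_hom, of W] idm_hom by simp

lemma tns_sum_left:
  assumes "g \<in> hom C X' Y'" "\<And>j. j \<in> A \<Longrightarrow> f j \<in> hom C X Y"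
  shows "(\<Sum>j\<in>A. f j) \<otimes> g = (\<Sum>j\<in>A. f j \<otimes> g)"
  using assms(2)
proof (induction A rule: infinite_finite_induct)
  case (insert a A)
  have "(f a + sum f A) \<otimes> g = (f a \<otimes> g) + (sum f A \<otimes> g)"
    using insert.prems by (intro tns_add_left[OF _ _ assms(1)]) (auto intro!: sum_hom)
  then show ?case using insert by simp
qed (simp_all add: zero_tns[OF assms(1)])

lemma tns_sum_right:
  assumes "g \<in> hom C X' Y'" "\<And>j. j \<in> A \<Longrightarrow> f j \<in> hom C X Y"
  shows "g \<otimes> (\<Sum>j\<in>A. f j) = (\<Sum>j\<in>A. g \<otimes> f j)"
  using assms(2)
proof (induction A rule: infinite_finite_induct)
  case (insert a A)
  have "g \<otimes> (f a + sum f A) = (g \<otimes> f a) + (g \<otimes> sum f A)"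
    using insert.prems by (intro tns_add_right[OF assms(1)]) (auto intro!: sum_hom)
  then show ?case using insert by simp
qed (simp_all add: tns_zero[OF assms(1)])

text \<open>
  The \<open>g j\<close> act as coordinate functions with respect to the generating system \<open>f j\<close> of \<open>hom C \<one> W\<close>; for a
  \<open>coreproducing\<close> family, the \<open>f j\<close> are coordinate functions on \<open>hom C W \<one>\<close>.
\<close>
definition reproducing :: "'o \<Rightarrow> nat \<Rightarrow> (nat \<Rightarrow> 'm) \<Rightarrow> (nat \<Rightarrow> 'm) \<Rightarrow> bool" where
  "reproducing W r f g \<longleftrightarrow> (\<forall>j<r. f j \<in> hom C \<one> W \<and> g j \<in> hom C W \<one>) \<and>
     (\<forall>x \<in> hom C \<one> W. x = (\<Sum>j<r. f j \<cdot> (g j \<cdot> x)))"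

definition coreproducing :: "'o \<Rightarrow> nat \<Rightarrow> (nat \<Rightarrow> 'm) \<Rightarrow> (nat \<Rightarrow> 'm) \<Rightarrow> bool" where
  "coreproducing W r f g \<longleftrightarrow> (\<forall>j<r. f j \<in> hom C \<one> W \<and> g j \<in> hom C W \<one>) \<and>
     (\<forall>y \<in> hom C W \<one>. y = (\<Sum>j<r. (y \<cdot> f j) \<cdot> g j))"

text \<open>
  By Schur's lemma, the isotypical components of the simple objects different from \<open>\<one>\<close> admit no nonzero
  morphisms from or to \<open>\<one>\<close>; so morphisms between \<open>\<one>\<close> and \<open>V\<close> factor through the trivial component.
\<close>
lemma trivial_component_hom:
  assumes "is_trivial_component C V T \<iota> \<pi>"
  shows "\<iota> \<in> hom C T V" "\<pi> \<in> hom C V T"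
    and "\<And>x. x \<in> hom C \<one> V \<Longrightarrow> x = \<iota> \<cdot> (\<pi> \<cdot> x)"
    and "\<And>y. y \<in> hom C V \<one> \<Longrightarrow> y = (y \<cdot> \<iota>) \<cdot> \<pi>"
    and "is_trivial C T"
proof -
  obtain m S W i p where m: "0 < m" "S 0 = \<one>"
    and S: "\<And>j. j < m \<Longrightarrow> is_simple C (S j)" "\<And>j. j < m \<Longrightarrow> is_multiple_of C (S j) (W j)"
    and ni: "\<And>j l. j < m \<Longrightarrow> l < m \<Longrightarrow> j \<noteq> l \<Longrightarrow> \<not> isomorphic C (S j) (S l)"
    and V: "is_direct_sum C m W V i p" and 0: "W 0 = T" "i 0 = \<iota>" "p 0 = \<pi>"
    using assms unfolding is_trivial_component_def by blast
  note D = is_direct_sumD[OF V]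
  show h: "\<iota> \<in> hom C T V" "\<pi> \<in> hom C V T" using D(1,2)[OF m(1)] 0 by auto
  show "is_trivial C T" using S(2)[OF m(1)] 0 m by (simp add: is_trivial_def)
  have z: "f \<in> hom C \<one> (W j) \<Longrightarrow> f = 0" "f \<in> hom C (W j) \<one> \<Longrightarrow> f = 0"
    if j: "j < m" "j \<noteq> 0" for j f
  proof -
    obtain n a b where W: "is_direct_sum C n (\<lambda>_. S j) (W j) a b"
      using S(2)[OF j(1)] by (auto simp: is_multiple_of_def)
    have ni': "\<not> isomorphic C \<one> (S j)" "\<not> isomorphic C (S j) \<one>"
      using ni[OF j(1) m(1) j(2)] ni[OF m(1) j(1)] j(2) m(2) by auto
    show "f \<in> hom C \<one> (W j) \<Longrightarrow> f = 0"
      by (erule direct_sum_hom_zero(1)[OF W])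
        (use simple_hom_zero_or_iso[OF unit_simple S(1)[OF j(1)]] ni' in \<open>auto simp: isomorphic_def\<close>)
    show "f \<in> hom C (W j) \<one> \<Longrightarrow> f = 0"
      by (erule direct_sum_hom_zero(2)[OF W])
        (use simple_hom_zero_or_iso[OF S(1)[OF j(1)] unit_simple] ni' in \<open>auto simp: isomorphic_def\<close>)
  qed
  have split: "{..<m} = insert 0 {1..<m}" using m by auto
  show "x = \<iota> \<cdot> (\<pi> \<cdot> x)" if x: "x \<in> hom C \<one> V" for x
  proof -
    have "i j \<cdot> (p j \<cdot> x) = 0" if "j \<in> {1..<m}" for j
      using z(1)[of j, OF _ _ cmp_hom[OF D(2) x]] that cmp_zero_right[OF D(1)] by simp
    then have "(\<Sum>j<m. i j \<cdot> (p j \<cdot> x)) = \<iota> \<cdot> (\<pi> \<cdot> x)"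
      unfolding split using 0 by simp
    then show ?thesis using direct_sum_hom_into[OF V x] by simp
  qed
  show "y = (y \<cdot> \<iota>) \<cdot> \<pi>" if y: "y \<in> hom C V \<one>" for y
  proof -
    have "(y \<cdot> i j) \<cdot> p j = 0" if "j \<in> {1..<m}" for j
      using z(2)[of j, OF _ _ cmp_hom[OF y D(1)]] that cmp_zero_left[OF D(2)] by simp
    then have "(\<Sum>j<m. (y \<cdot> i j) \<cdot> p j) = (y \<cdot> \<iota>) \<cdot> \<pi>"
      unfolding split using 0 by simp
    then show ?thesis using direct_sum_hom_from[OF V y] by simp
  qed
qed

lemma trivial_component_reproducing:
  assumes T: "is_trivial_component C V T \<iota> \<pi>" and S: "is_direct_sum C r (\<lambda>_. \<one>) T a b"
  shows "reproducing V r (\<lambda>j. \<iota> \<cdot> a j) (\<lambda>j. b j \<cdot> \<pi>)"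
    and "coreproducing V r (\<lambda>j. \<iota> \<cdot> a j) (\<lambda>j. b j \<cdot> \<pi>)"
proof -
  note h = trivial_component_hom[OF T] and D = is_direct_sumD[OF S]
  show "reproducing V r (\<lambda>j. \<iota> \<cdot> a j) (\<lambda>j. b j \<cdot> \<pi>)"
    unfolding reproducing_def
  proof (intro conjI allI impI ballI)
    fix x assume x: "x \<in> hom C \<one> V"
    have \<pi>x: "\<pi> \<cdot> x \<in> hom C \<one> T" using h(2) x by (rule cmp_hom)
    have "x = \<iota> \<cdot> (\<Sum>j<r. a j \<cdot> (b j \<cdot> (\<pi> \<cdot> x)))"
      using h(3)[OF x] direct_sum_hom_into[OF S \<pi>x] by simp
    also have "\<dots> = (\<Sum>j<r. \<iota> \<cdot> (a j \<cdot> (b j \<cdot> (\<pi> \<cdot> x))))"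
      by (rule cmp_sum_right[OF h(1)]) (auto intro!: cmp_hom[OF D(1)] cmp_hom[OF D(2)] \<pi>x)
    also have "\<dots> = (\<Sum>j<r. (\<iota> \<cdot> a j) \<cdot> ((b j \<cdot> \<pi>) \<cdot> x))"
    proof (rule sum.cong[OF refl])
      fix j assume "j \<in> {..<r}"
      then have a: "a j \<in> hom C \<one> T" and b: "b j \<in> hom C T \<one>" using D by auto
      show "\<iota> \<cdot> (a j \<cdot> (b j \<cdot> (\<pi> \<cdot> x))) = (\<iota> \<cdot> a j) \<cdot> ((b j \<cdot> \<pi>) \<cdot> x)"
        using cmp_assoc[OF h(1) a cmp_hom[OF b \<pi>x]] cmp_assoc[OF b h(2) x] by simp
    qed
    finally show "x = (\<Sum>j<r. (\<iota> \<cdot> a j) \<cdot> ((b j \<cdot> \<pi>) \<cdot> x))" .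
  qed (auto intro: cmp_hom h D)
  show "coreproducing V r (\<lambda>j. \<iota> \<cdot> a j) (\<lambda>j. b j \<cdot> \<pi>)"
    unfolding coreproducing_def
  proof (intro conjI allI impI ballI)
    fix y assume y: "y \<in> hom C V \<one>"
    have y\<iota>: "y \<cdot> \<iota> \<in> hom C T \<one>" using y h(1) by (rule cmp_hom)
    have "y = (\<Sum>j<r. ((y \<cdot> \<iota>) \<cdot> a j) \<cdot> b j) \<cdot> \<pi>"
      using h(4)[OF y] direct_sum_hom_from[OF S y\<iota>] by simp
    also have "\<dots> = (\<Sum>j<r. (((y \<cdot> \<iota>) \<cdot> a j) \<cdot> b j) \<cdot> \<pi>)"
      by (rule cmp_sum_left[OF h(2)]) (auto intro!: cmp_hom[OF _ D(1)] cmp_hom[OF _ D(2)] y\<iota>)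
    also have "\<dots> = (\<Sum>j<r. (y \<cdot> (\<iota> \<cdot> a j)) \<cdot> (b j \<cdot> \<pi>))"
    proof (rule sum.cong[OF refl])
      fix j assume "j \<in> {..<r}"
      then have a: "a j \<in> hom C \<one> T" and b: "b j \<in> hom C T \<one>" using D by auto
      show "(((y \<cdot> \<iota>) \<cdot> a j) \<cdot> b j) \<cdot> \<pi> = (y \<cdot> (\<iota> \<cdot> a j)) \<cdot> (b j \<cdot> \<pi>)"
        using cmp_assoc[OF y h(1) a] cmp_assoc[OF cmp_hom[OF y\<iota> a] b h(2)] by simp
    qed
    finally show "y = (\<Sum>j<r. (y \<cdot> (\<iota> \<cdot> a j)) \<cdot> (b j \<cdot> \<pi>))" .
  qed (auto intro: cmp_hom h D)
qed

lemma trivial_component_exists: "\<exists>T \<iota> \<pi>. is_trivial_component C V T \<iota> \<pi>"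
proof -
  obtain n S i p where "\<forall>j<n. is_simple C (S j)" "is_direct_sum C n S V i p"
    using semisimple by blast
  from isotypical_decomposition_exists[OF unit_simple this]
  show ?thesis unfolding is_trivial_component_def by blast
qed

lemma reproducing_exists: "\<exists>r f g. reproducing W r f g \<and> coreproducing W r f g"
proof -
  obtain T \<iota> \<pi> where T: "is_trivial_component C W T \<iota> \<pi>" using trivial_component_exists by blast
  then obtain r a b where "is_direct_sum C r (\<lambda>_. \<one>) T a b"
    using trivial_component_hom(5)[OF T] by (auto simp: is_trivial_def is_multiple_of_def)
  then show ?thesis using trivial_component_reproducing[OF T] by blast
qed

lemma subspace_basis_exists:
  "\<exists>B. finite B \<and> B \<subseteq> hom C X Y \<and> \<not> dependent B \<and> span B = hom C X Y"
proof -
  obtain B where B: "B \<subseteq> hom C X Y" "independent B" "hom C X Y \<subseteq> span B"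
    using maximal_independent_subset by blast
  obtain G where G: "finite G" "span G = hom C X Y" using hom_finite_dimensional by blast
  have "finite B" using independent_span_bound[OF G(1) B(2)] B(1) G(2) by auto
  moreover have "span B = hom C X Y" using B span_minimal[OF B(1) hom_subspace] by auto
  ultimately show ?thesis using B by blast
qed

text \<open>
  For the basis \<open>B\<close> underlying \<open>trace_on\<close>, expand \<open>b = \<Sum> \<gamma>\<^sub>j(b) f\<^sub>j\<close> and let \<open>\<rho>\<^sub>b\<close> be the coordinates with respect to
  \<open>B\<close>. Then \<open>\<Sum>\<^sub>b \<rho>\<^sub>b(\<phi> b) = \<Sum>\<^sub>j \<Sum>\<^sub>b \<gamma>\<^sub>j(b) \<rho>\<^sub>b(\<phi> f\<^sub>j) = \<Sum>\<^sub>j \<gamma>\<^sub>j(\<phi> f\<^sub>j)\<close>.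
\<close>
lemma trace_on_reproducing:
  assumes R: "reproducing W r f g"
    and \<phi>: "\<And>x. x \<in> hom C \<one> W \<Longrightarrow> \<phi> x \<in> hom C \<one> W"
      "\<And>x y. x \<in> hom C \<one> W \<Longrightarrow> y \<in> hom C \<one> W \<Longrightarrow> \<phi> (x + y) = \<phi> x + \<phi> y"
      "\<And>c x. x \<in> hom C \<one> W \<Longrightarrow> \<phi> (scl C c x) = scl C c (\<phi> x)"
  shows "scl C (trace_on (scl C) (hom C \<one> W) \<phi>) (idm C \<one>) = (\<Sum>j<r. g j \<cdot> \<phi> (f j))"
proof -
  let ?S = "hom C \<one> W"
  have fg: "f j \<in> ?S" "g j \<in> hom C W \<one>" if "j < r" for j
    using R that by (auto simp: reproducing_def)
  define P where "P B \<longleftrightarrow> B \<subseteq> ?S \<and> \<not> dependent B \<and> span B = ?S" for B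
  define B where "B = (SOME B. P B)"
  have "\<exists>B. P B" using subspace_basis_exists unfolding P_def by blast
  then have "P B" unfolding B_def by (rule someI_ex)
  then have B: "B \<subseteq> ?S" "independent B" "span B = ?S" by (auto simp: P_def)
  obtain G where G: "finite G" "span G = ?S" using hom_finite_dimensional by blast
  have finB: "finite B" using independent_span_bound[OF G(1) B(2)] B(1) G(2) by auto
  define \<gamma> where "\<gamma> j x = (SOME c. g j \<cdot> x = scl C c (idm C \<one>))" for j x
  have \<gamma>: "g j \<cdot> x = scl C (\<gamma> j x) (idm C \<one>)" if "j < r" "x \<in> ?S" for j x
    unfolding \<gamma>_def by (rule someI_ex) (rule unit_scalar[OF cmp_hom[OF fg(2)[OF that(1)] that(2)]])
  have \<gamma>_unique: "c = d" if "scl C c (idm C \<one>) = scl C d (idm C \<one>)" for c d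
    using that unit_idm_nonzero by simp
  have expand: "x = (\<Sum>j<r. scl C (\<gamma> j x) (f j))" if x: "x \<in> ?S" for x
  proof -
    have "x = (\<Sum>j<r. f j \<cdot> (g j \<cdot> x))" using R x by (simp add: reproducing_def)
    also have "\<dots> = (\<Sum>j<r. scl C (\<gamma> j x) (f j))"
    proof (rule sum.cong[OF refl])
      fix j assume "j \<in> {..<r}"
      then have j: "j < r" by simp
      show "f j \<cdot> (g j \<cdot> x) = scl C (\<gamma> j x) (f j)"
        unfolding \<gamma>[OF j x] cmp_scl_right[OF fg(1)[OF j] idm_hom] idm_right[OF fg(1)[OF j]] ..
    qed
    finally show ?thesis .
  qed
  have \<phi>_sum: "\<phi> (\<Sum>j\<in>A. scl C (c j) (x j)) = (\<Sum>j\<in>A. scl C (c j) (\<phi> (x j)))"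
    if "finite A" "\<And>j. j \<in> A \<Longrightarrow> x j \<in> ?S" for A :: "nat set" and c x
    using that
  proof (induction A)
    case empty
    show ?case using \<phi>(3)[OF zero_hom, of 0] by simp
  next
    case (insert a A)
    then show ?case by (simp add: \<phi>(2,3) scl_hom sum_hom)
  qed
  have g_sum: "g j \<cdot> (\<Sum>b\<in>B. scl C (c b) b) = scl C (\<Sum>b\<in>B. c b * \<gamma> j b) (idm C \<one>)"
    if j: "j < r" for j c
  proof -
    have "g j \<cdot> (\<Sum>b\<in>B. scl C (c b) b) = (\<Sum>b\<in>B. g j \<cdot> scl C (c b) b)"
      using B(1) by (intro cmp_sum_right[OF fg(2)[OF j]]) (auto intro: scl_hom)
    also have "\<dots> = (\<Sum>b\<in>B. scl C (c b * \<gamma> j b) (idm C \<one>))"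
    proof (rule sum.cong[OF refl])
      fix b assume "b \<in> B"
      then have b: "b \<in> ?S" using B by auto
      show "g j \<cdot> scl C (c b) b = scl C (c b * \<gamma> j b) (idm C \<one>)"
        unfolding cmp_scl_right[OF fg(2)[OF j] b] \<gamma>[OF j b] by simp
    qed
    finally show ?thesis by (simp add: scale_sum_left)
  qed
  have "trace_on (scl C) ?S \<phi> = (\<Sum>b\<in>B. representation B (\<phi> b) b)"
    unfolding trace_on_def Let_def B_def P_def ..
  also have "\<dots> = (\<Sum>b\<in>B. \<Sum>j<r. \<gamma> j b * representation B (\<phi> (f j)) b)"
  proof (rule sum.cong[OF refl])
    fix b assume "b \<in> B"
    then have b: "b \<in> ?S" using B by auto
    have "\<phi> b = (\<Sum>j<r. scl C (\<gamma> j b) (\<phi> (f j)))"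
      by (subst expand[OF b], subst \<phi>_sum) (auto simp: fg)
    then have "representation B (\<phi> b) = (\<lambda>b'. \<Sum>j<r. representation B (scl C (\<gamma> j b) (\<phi> (f j))) b')"
      using B by (simp only:) (rule representation_sum, auto simp: fg \<phi> scl_hom)
    then show "representation B (\<phi> b) b = (\<Sum>j<r. \<gamma> j b * representation B (\<phi> (f j)) b)"
      using B by (simp add: representation_scale fg \<phi>)
  qed
  also have "\<dots> = (\<Sum>j<r. \<Sum>b\<in>B. representation B (\<phi> (f j)) b * \<gamma> j b)"
    by (subst sum.swap) (simp add: mult.commute)
  finally have "scl C (trace_on (scl C) ?S \<phi>) (idm C \<one>) =
      (\<Sum>j<r. scl C (\<Sum>b\<in>B. representation B (\<phi> (f j)) b * \<gamma> j b) (idm C \<one>))"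
    by (simp only: scale_sum_left)
  also have "\<dots> = (\<Sum>j<r. g j \<cdot> \<phi> (f j))"
  proof (rule sum.cong[OF refl])
    fix j assume "j \<in> {..<r}"
    then have j: "j < r" by simp
    have "(\<Sum>b\<in>B. scl C (representation B (\<phi> (f j)) b) b) = \<phi> (f j)"
      by (rule sum_representation_eq) (use B finB \<phi> fg[OF j] in auto)
    then show "scl C (\<Sum>b\<in>B. representation B (\<phi> (f j)) b * \<gamma> j b) (idm C \<one>) = g j \<cdot> \<phi> (f j)"
      using g_sum[OF j, of "representation B (\<phi> (f j))"] by simp
  qed
  finally show ?thesis .
qed

section \<open>The exchange with a trivial object\<close>

text \<open>
  Naturality forces the exchange to be this sum, since it is the identity on each copy of \<open>\<one>\<close>. By
  \<open>trivial_swap_eq\<close> the sum does not depend on how \<open>T\<close> is decomposed.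
\<close>
definition swap_along :: "nat \<Rightarrow> (nat \<Rightarrow> 'm) \<Rightarrow> (nat \<Rightarrow> 'm) \<Rightarrow> 'o \<Rightarrow> 'm" where
  "swap_along r a b X = (\<Sum>j<r. (a j \<otimes> idm C X) \<cdot> (idm C X \<otimes> b j))"

lemma raw_tns_swap:
  assumes f: "f \<in> hom C X Y" and g: "g \<in> hom C X' Y'"
  shows "(f \<otimes> idm C Y') \<cdot> (idm C X \<otimes> g) = f \<otimes> g" "(idm C Y \<otimes> g) \<cdot> (f \<otimes> idm C X') = f \<otimes> g"
  using tns_cmp[OF f idm_hom idm_hom g] tns_cmp[OF idm_hom f g idm_hom]
    idm_right[OF f] idm_left[OF g] idm_left[OF f] idm_right[OF g] by simp_all

lemma swap_along_hom:
  assumes T: "is_direct_sum C r (\<lambda>_. \<one>) T a b"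
  shows "swap_along r a b X \<in> hom C (X \<odot> T) (T \<odot> X)"
proof -
  note D = is_direct_sumD[OF T]
  have "a j \<otimes> idm C X \<in> hom C X (T \<odot> X)" "idm C X \<otimes> b j \<in> hom C (X \<odot> T) X" if "j < r" for j
    using tns_hom[OF D(1)[OF that] idm_hom] tns_hom[OF idm_hom D(2)[OF that]] by auto
  then show ?thesis unfolding swap_along_def by (auto intro!: sum_hom cmp_hom)
qed

text \<open>
  In terms of the matrix entries \<open>x l j\<close> of \<open>g\<close>, which are endomorphisms of \<open>\<one>\<close>, one side contains
  \<open>x l j \<otimes> W\<close> and the other \<open>W \<otimes> x l j\<close>.
\<close>
lemma swap_along_natural:
  assumes T: "is_direct_sum C r (\<lambda>_. \<one>) T a b" and U: "is_direct_sum C s (\<lambda>_. \<one>) U a' b'"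
    and f: "f \<in> hom C V W" and g: "g \<in> hom C T U"
  shows "(g \<otimes> f) \<cdot> swap_along r a b V = swap_along s a' b' W \<cdot> (f \<otimes> g)"
proof -
  note D = is_direct_sumD[OF T] and E = is_direct_sumD[OF U]
  have a: "a j \<otimes> idm C X \<in> hom C X (T \<odot> X)" "idm C X \<otimes> b j \<in> hom C (X \<odot> T) X" if "j < r" for j X
    using tns_hom[OF D(1)[OF that] idm_hom] tns_hom[OF idm_hom D(2)[OF that]] by auto
  have a': "a' j \<otimes> idm C X \<in> hom C X (U \<odot> X)" "idm C X \<otimes> b' j \<in> hom C (X \<odot> U) X" if "j < s" for j X
    using tns_hom[OF E(1)[OF that] idm_hom] tns_hom[OF idm_hom E(2)[OF that]] by auto
  define x where "x l j = b' l \<cdot> (g \<cdot> a j)" for l j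
  have x: "x l j \<in> hom C \<one> \<one>" if "l < s" "j < r" for l j
    unfolding x_def by (intro cmp_hom[OF E(2)] cmp_hom[OF g] D that)
  have gf: "g \<otimes> f \<in> hom C (T \<odot> V) (U \<odot> W)" by (rule tns_hom[OF g f])
  have fg: "f \<otimes> g \<in> hom C (V \<odot> T) (W \<odot> U)" by (rule tns_hom[OF f g])
  have left: "(g \<otimes> f) \<cdot> swap_along r a b V = (\<Sum>j<r. \<Sum>l<s. (a' l \<otimes> idm C W) \<cdot> ((x l j \<otimes> idm C W) \<cdot> (f \<otimes> b j)))"
  proof -
    have "(g \<otimes> f) \<cdot> swap_along r a b V = (\<Sum>j<r. (g \<otimes> f) \<cdot> ((a j \<otimes> idm C V) \<cdot> (idm C V \<otimes> b j)))"
      unfolding swap_along_def by (rule cmp_sum_right[OF gf]) (auto intro!: cmp_hom a)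
    also have "\<dots> = (\<Sum>j<r. \<Sum>l<s. (a' l \<otimes> idm C W) \<cdot> ((x l j \<otimes> idm C W) \<cdot> (f \<otimes> b j)))"
    proof (rule sum.cong[OF refl])
      fix j assume "j \<in> {..<r}"
      then have j: "j < r" by simp
      have fb: "f \<otimes> b j \<in> hom C (V \<odot> T) W" using tns_hom[OF f D(2)[OF j]] by simp
      have xW: "x l j \<otimes> idm C W \<in> hom C W W" if "l < s" for l
        using tns_hom[OF x[OF that j] idm_hom] by simp
      have ga: "g \<cdot> a j = (\<Sum>l<s. a' l \<cdot> x l j)"
        unfolding x_def by (rule direct_sum_hom_into[OF U cmp_hom[OF g D(1)[OF j]]])
      have gaW: "(g \<cdot> a j) \<otimes> idm C W = (\<Sum>l<s. (a' l \<otimes> idm C W) \<cdot> (x l j \<otimes> idm C W))"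
        unfolding ga using tns_sum_left[OF idm_hom, of "{..<s}" "\<lambda>l. a' l \<cdot> x l j" \<one> U W]
          tns_cmp_left[OF E(1) x[OF _ j]]
        by (simp add: cmp_hom[OF E(1) x[OF _ j]])
      have "(g \<otimes> f) \<cdot> ((a j \<otimes> idm C V) \<cdot> (idm C V \<otimes> b j)) = ((g \<cdot> a j) \<otimes> f) \<cdot> (idm C V \<otimes> b j)"
        using cmp_assoc[OF gf a(1)[OF j] a(2)[OF j]] tns_cmp[OF g D(1)[OF j] f idm_hom]
          idm_right[OF f] by simp
      also have "(g \<cdot> a j) \<otimes> f = ((g \<cdot> a j) \<otimes> idm C W) \<cdot> f"
        using raw_tns_swap(1)[OF cmp_hom[OF g D(1)[OF j]] f] unit_left_mor[OF f] by simp
      also have "(((g \<cdot> a j) \<otimes> idm C W) \<cdot> f) \<cdot> (idm C V \<otimes> b j) =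
          ((g \<cdot> a j) \<otimes> idm C W) \<cdot> (f \<cdot> (idm C V \<otimes> b j))"
        using tns_hom[OF cmp_hom[OF g D(1)[OF j]] idm_hom[of W]]
        by (intro cmp_assoc[OF _ f a(2)[OF j]]) simp
      also have "f \<cdot> (idm C V \<otimes> b j) = f \<otimes> b j"
        using raw_tns_swap(1)[OF f D(2)[OF j]] unit_right_mor[OF f] by simp
      also have "((g \<cdot> a j) \<otimes> idm C W) \<cdot> (f \<otimes> b j) =
          (\<Sum>l<s. ((a' l \<otimes> idm C W) \<cdot> (x l j \<otimes> idm C W)) \<cdot> (f \<otimes> b j))"
        unfolding gaW by (rule cmp_sum_left[OF fb]) (auto intro!: cmp_hom a' xW)
      also have "\<dots> = (\<Sum>l<s. (a' l \<otimes> idm C W) \<cdot> ((x l j \<otimes> idm C W) \<cdot> (f \<otimes> b j)))"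
        by (rule sum.cong) (auto intro!: cmp_assoc a' xW fb)
      finally show "(g \<otimes> f) \<cdot> ((a j \<otimes> idm C V) \<cdot> (idm C V \<otimes> b j)) = \<dots>" .
    qed
    finally show ?thesis .
  qed
  have right: "swap_along s a' b' W \<cdot> (f \<otimes> g) = (\<Sum>l<s. \<Sum>j<r. (a' l \<otimes> idm C W) \<cdot> ((idm C W \<otimes> x l j) \<cdot> (f \<otimes> b j)))"
  proof -
    have "swap_along s a' b' W \<cdot> (f \<otimes> g) = (\<Sum>l<s. ((a' l \<otimes> idm C W) \<cdot> (idm C W \<otimes> b' l)) \<cdot> (f \<otimes> g))"
      unfolding swap_along_def by (rule cmp_sum_left[OF fg]) (auto intro!: cmp_hom a')
    also have "\<dots> = (\<Sum>l<s. \<Sum>j<r. (a' l \<otimes> idm C W) \<cdot> ((idm C W \<otimes> x l j) \<cdot> (f \<otimes> b j)))"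
    proof (rule sum.cong[OF refl])
      fix l assume "l \<in> {..<s}"
      then have l: "l < s" by simp
      have bg: "b' l \<cdot> g = (\<Sum>j<r. x l j \<cdot> b j)"
      proof -
        have "b' l \<cdot> g = (\<Sum>j<r. ((b' l \<cdot> g) \<cdot> a j) \<cdot> b j)"
          by (rule direct_sum_hom_from[OF T cmp_hom[OF E(2)[OF l] g]])
        also have "\<dots> = (\<Sum>j<r. x l j \<cdot> b j)"
          unfolding x_def by (rule sum.cong) (auto simp: cmp_assoc[OF E(2)[OF l] g D(1)])
        finally show ?thesis .
      qed
      have "((a' l \<otimes> idm C W) \<cdot> (idm C W \<otimes> b' l)) \<cdot> (f \<otimes> g) =
          (a' l \<otimes> idm C W) \<cdot> ((idm C W \<otimes> b' l) \<cdot> (f \<otimes> g))"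
        by (rule cmp_assoc[OF a'[OF l] fg])
      also have "(idm C W \<otimes> b' l) \<cdot> (f \<otimes> g) = f \<otimes> (b' l \<cdot> g)"
        using tns_cmp[OF idm_hom f E(2)[OF l] g] idm_left[OF f] by simp
      also have "f \<otimes> (b' l \<cdot> g) = (\<Sum>j<r. f \<otimes> (x l j \<cdot> b j))"
        unfolding bg by (rule tns_sum_right[OF f]) (auto intro!: cmp_hom x l D)
      also have "\<dots> = (\<Sum>j<r. (idm C W \<otimes> x l j) \<cdot> (f \<otimes> b j))"
        by (rule sum.cong) (use tns_cmp[OF idm_hom f x[OF l] D(2)] idm_left[OF f] in auto)
      also have "(a' l \<otimes> idm C W) \<cdot> \<dots> = (\<Sum>j<r. (a' l \<otimes> idm C W) \<cdot> ((idm C W \<otimes> x l j) \<cdot> (f \<otimes> b j)))"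
      proof (rule cmp_sum_right[OF a'(1)[OF l]])
        fix j assume "j \<in> {..<r}"
        then have j: "j < r" by simp
        show "(idm C W \<otimes> x l j) \<cdot> (f \<otimes> b j) \<in> hom C (V \<odot> T) W"
          using tns_hom[OF idm_hom[of W] x[OF l j]] tns_hom[OF f D(2)[OF j]]
          by (auto intro: cmp_hom)
      qed
      finally show "((a' l \<otimes> idm C W) \<cdot> (idm C W \<otimes> b' l)) \<cdot> (f \<otimes> g) = \<dots>" .
    qed
    finally show ?thesis .
  qed
  show ?thesis
    unfolding left right by (subst sum.swap) (auto intro!: sum.cong simp: unit_endo_central[OF x])
qed

lemma swap_along_unit:
  assumes "is_direct_sum C r (\<lambda>_. \<one>) \<one> a b"
  shows "swap_along r a b X = idm C X"
proof -
  note D = is_direct_sumD[OF assms]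
  have "swap_along r a b X = (\<Sum>j<r. (a j \<cdot> b j) \<otimes> idm C X)"
    unfolding swap_along_def
  proof (rule sum.cong[OF refl])
    fix j assume "j \<in> {..<r}"
    then have j: "a j \<in> hom C \<one> \<one>" "b j \<in> hom C \<one> \<one>" using D by auto
    show "(a j \<otimes> idm C X) \<cdot> (idm C X \<otimes> b j) = (a j \<cdot> b j) \<otimes> idm C X"
      using unit_endo_central[OF j(2), of X] tns_cmp_left[OF j, of X] by simp
  qed
  also have "\<dots> = (\<Sum>j<r. a j \<cdot> b j) \<otimes> idm C X"
    by (rule tns_sum_left[symmetric, OF idm_hom]) (auto intro: cmp_hom D)
  also have "\<dots> = idm C X" using D(4) unit_left_mor[OF idm_hom] by simp
  finally show ?thesis .
qed

lemma swap_along_iso: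
  assumes T: "is_direct_sum C r (\<lambda>_. \<one>) T a b"
  shows "is_iso C (X \<odot> T) (T \<odot> X) (swap_along r a b X)"
proof -
  note D = is_direct_sumD[OF T]
  have h: "a j \<otimes> idm C X \<in> hom C X (T \<odot> X)" "idm C X \<otimes> b j \<in> hom C (X \<odot> T) X"
    "idm C X \<otimes> a j \<in> hom C X (X \<odot> T)" "b j \<otimes> idm C X \<in> hom C (T \<odot> X) X" if "j < r" for j
    using tns_hom[OF D(1)[OF that] idm_hom[of X]] tns_hom[OF idm_hom[of X] D(2)[OF that]]
      tns_hom[OF idm_hom[of X] D(1)[OF that]] tns_hom[OF D(2)[OF that] idm_hom[of X]] by auto
  define w where "w = (\<Sum>j<r. (idm C X \<otimes> a j) \<cdot> (b j \<otimes> idm C X))"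
  have w: "w \<in> hom C (T \<odot> X) (X \<odot> T)" unfolding w_def by (auto intro!: sum_hom cmp_hom h)
  note t = swap_along_hom[OF T, of X]
  have ba: "(b l \<otimes> idm C X) \<cdot> (a j \<otimes> idm C X) = (if j = l then idm C X else 0)"
    "(idm C X \<otimes> b l) \<cdot> (idm C X \<otimes> a j) = (if j = l then idm C X else 0)" if "l < r" "j < r" for l j
    using tns_cmp_left[OF D(2)[OF that(1)] D(1)[OF that(2)], of X]
      tns_cmp_right[OF D(2)[OF that(1)] D(1)[OF that(2)], of X] D(3)[OF that(2,1)]
      unit_left_mor[OF idm_hom, of X] unit_right_mor[OF idm_hom, of X]
      zero_tns[OF idm_hom, of X] tns_zero[OF idm_hom, of X]
    by (auto split: if_splits)
  have "w \<cdot> swap_along r a b X = (\<Sum>j<r. w \<cdot> ((a j \<otimes> idm C X) \<cdot> (idm C X \<otimes> b j)))"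
    unfolding swap_along_def by (rule cmp_sum_right[OF w]) (auto intro!: cmp_hom h)
  also have "\<dots> = (\<Sum>j<r. idm C X \<otimes> (a j \<cdot> b j))"
  proof (rule sum.cong[OF refl])
    fix j assume "j \<in> {..<r}"
    then have j: "j < r" by simp
    have "w \<cdot> (a j \<otimes> idm C X) = (\<Sum>l<r. ((idm C X \<otimes> a l) \<cdot> (b l \<otimes> idm C X)) \<cdot> (a j \<otimes> idm C X))"
      unfolding w_def by (rule cmp_sum_left[OF h(1)[OF j]]) (auto intro!: cmp_hom h)
    also have "\<dots> = (\<Sum>l<r. if l = j then idm C X \<otimes> a j else 0)"
      by (rule sum.cong[OF refl])
        (auto simp: cmp_assoc[OF h(3,4,1)] j ba idm_right[OF h(3)] cmp_zero_right[OF h(3)])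
    also have "\<dots> = idm C X \<otimes> a j" using j by (simp add: sum.delta)
    finally have "w \<cdot> ((a j \<otimes> idm C X) \<cdot> (idm C X \<otimes> b j)) = (idm C X \<otimes> a j) \<cdot> (idm C X \<otimes> b j)"
      using cmp_assoc[OF w h(1,2)[OF j]] by simp
    also have "\<dots> = idm C X \<otimes> (a j \<cdot> b j)"
      using tns_cmp_right[OF D(1,2)[OF j]] by simp
    finally show "w \<cdot> ((a j \<otimes> idm C X) \<cdot> (idm C X \<otimes> b j)) = idm C X \<otimes> (a j \<cdot> b j)" .
  qed
  also have "\<dots> = idm C X \<otimes> (\<Sum>j<r. a j \<cdot> b j)"
    by (rule tns_sum_right[symmetric, OF idm_hom]) (auto intro: cmp_hom D)
  finally have 1: "w \<cdot> swap_along r a b X = idm C (X \<odot> T)" using D(4) tns_idm by simp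
  have "swap_along r a b X \<cdot> w = (\<Sum>j<r. swap_along r a b X \<cdot> ((idm C X \<otimes> a j) \<cdot> (b j \<otimes> idm C X)))"
    unfolding w_def by (rule cmp_sum_right[OF t]) (auto intro!: cmp_hom h)
  also have "\<dots> = (\<Sum>j<r. (a j \<cdot> b j) \<otimes> idm C X)"
  proof (rule sum.cong[OF refl])
    fix j assume "j \<in> {..<r}"
    then have j: "j < r" by simp
    have "swap_along r a b X \<cdot> (idm C X \<otimes> a j) =
        (\<Sum>l<r. ((a l \<otimes> idm C X) \<cdot> (idm C X \<otimes> b l)) \<cdot> (idm C X \<otimes> a j))"
      unfolding swap_along_def by (rule cmp_sum_left[OF h(3)[OF j]]) (auto intro!: cmp_hom h)
    also have "\<dots> = (\<Sum>l<r. if l = j then a j \<otimes> idm C X else 0)"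
      by (rule sum.cong[OF refl])
        (auto simp: cmp_assoc[OF h(1,2,3)] j ba idm_right[OF h(1)] cmp_zero_right[OF h(1)])
    also have "\<dots> = a j \<otimes> idm C X" using j by (simp add: sum.delta)
    finally have "swap_along r a b X \<cdot> ((idm C X \<otimes> a j) \<cdot> (b j \<otimes> idm C X)) =
        (a j \<otimes> idm C X) \<cdot> (b j \<otimes> idm C X)"
      using cmp_assoc[OF t h(3,4)[OF j]] by simp
    also have "\<dots> = (a j \<cdot> b j) \<otimes> idm C X"
      using tns_cmp_left[OF D(1,2)[OF j]] by simp
    finally show "swap_along r a b X \<cdot> ((idm C X \<otimes> a j) \<cdot> (b j \<otimes> idm C X)) = (a j \<cdot> b j) \<otimes> idm C X" .
  qed
  also have "\<dots> = (\<Sum>j<r. a j \<cdot> b j) \<otimes> idm C X"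
    by (rule tns_sum_left[symmetric, OF idm_hom]) (auto intro: cmp_hom D)
  finally have 2: "swap_along r a b X \<cdot> w = idm C (T \<odot> X)" using D(4) tns_idm by simp
  show ?thesis using t w 1 2 by (auto simp: is_iso_def is_inverse_def)
qed

lemma trivial_swap_unique:
  assumes T: "is_direct_sum C r (\<lambda>_. \<one>) T a b" and t: "is_trivial_swap C t"
  shows "t X T = swap_along r a b X"
proof -
  note D = is_direct_sumD[OF T]
  have triv: "is_trivial C T" using T by (auto simp: is_trivial_def is_multiple_of_def)
  have triv1: "is_trivial C \<one>"
    unfolding is_trivial_def is_multiple_of_def is_direct_sum_def
    using idm_hom[of \<one>] idm_left[OF idm_hom, of \<one>]
    by (intro exI[of _ 1] exI[of _ "\<lambda>_. idm C \<one>"]) auto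
  have tXT: "t X T \<in> hom C (X \<odot> T) (T \<odot> X)" using t triv by (auto simp: is_trivial_swap_def is_iso_def)
  have h: "idm C X \<otimes> b j \<in> hom C (X \<odot> T) X" "idm C X \<otimes> a j \<in> hom C X (X \<odot> T)" if "j < r" for j
    using tns_hom[OF idm_hom[of X] D(2)[OF that]] tns_hom[OF idm_hom[of X] D(1)[OF that]] by auto
  have "idm C (X \<odot> T) = (\<Sum>j<r. (idm C X \<otimes> a j) \<cdot> (idm C X \<otimes> b j))"
  proof -
    have "idm C (X \<odot> T) = (\<Sum>j<r. idm C X \<otimes> (a j \<cdot> b j))"
      using tns_sum_right[OF idm_hom, of "{..<r}" "\<lambda>j. a j \<cdot> b j" T T X] D(4) tns_idm
      by (simp add: cmp_hom[OF D(1,2)])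
    also have "\<dots> = (\<Sum>j<r. (idm C X \<otimes> a j) \<cdot> (idm C X \<otimes> b j))"
      by (rule sum.cong) (auto simp: tns_cmp_right[OF D(1,2)])
    finally show ?thesis .
  qed
  then have "t X T = t X T \<cdot> (\<Sum>j<r. (idm C X \<otimes> a j) \<cdot> (idm C X \<otimes> b j))"
    using idm_right[OF tXT] by simp
  also have "\<dots> = (\<Sum>j<r. t X T \<cdot> ((idm C X \<otimes> a j) \<cdot> (idm C X \<otimes> b j)))"
    by (rule cmp_sum_right[OF tXT]) (auto intro!: cmp_hom h)
  also have "\<dots> = swap_along r a b X"
    unfolding swap_along_def
  proof (rule sum.cong[OF refl])
    fix j assume "j \<in> {..<r}"
    then have j: "j < r" by simp
    have aX: "a j \<otimes> idm C X \<in> hom C X (T \<odot> X)" using tns_hom[OF D(1)[OF j] idm_hom[of X]] by simp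
    have "t X T \<cdot> (idm C X \<otimes> a j) = (a j \<otimes> idm C X) \<cdot> t X \<one>"
      using t triv triv1 idm_hom[of X] D(1)[OF j] unfolding is_trivial_swap_def by metis
    also have "t X \<one> = idm C X" using t by (auto simp: is_trivial_swap_def)
    finally show "t X T \<cdot> ((idm C X \<otimes> a j) \<cdot> (idm C X \<otimes> b j)) = (a j \<otimes> idm C X) \<cdot> (idm C X \<otimes> b j)"
      using cmp_assoc[OF tXT h(2,1)[OF j]] idm_right[OF aX] by simp
  qed
  finally show ?thesis .
qed

text \<open>
  A decomposition is chosen for each trivial object; by naturality along identity morphisms the
  choice is immaterial, in particular the one for \<open>\<one>\<close> itself.
\<close>
lemma trivial_swap_exists: "\<exists>t. is_trivial_swap C t"
proof -
  have "\<exists>r a b. is_trivial C T \<longrightarrow> is_direct_sum C r (\<lambda>_. \<one>) T a b" for T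
    by (auto simp: is_trivial_def is_multiple_of_def)
  then obtain r a b where D: "\<And>T. is_trivial C T \<Longrightarrow> is_direct_sum C (r T) (\<lambda>_. \<one>) T (a T) (b T)"
    by metis
  have triv1: "is_trivial C \<one>"
    unfolding is_trivial_def is_multiple_of_def is_direct_sum_def
    using idm_hom[of \<one>] idm_left[OF idm_hom, of \<one>]
    by (intro exI[of _ 1] exI[of _ "\<lambda>_. idm C \<one>"]) auto
  have "is_trivial_swap C (\<lambda>V T. swap_along (r T) (a T) (b T) V)"
    unfolding is_trivial_swap_def
    using swap_along_iso[OF D] swap_along_natural[OF D D] swap_along_unit[OF D[OF triv1]] by blast
  then show ?thesis by (rule exI[of "is_trivial_swap C"])
qed

lemma trivial_swap_eq:
  assumes "is_direct_sum C r (\<lambda>_. \<one>) T a b"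
  shows "trivial_swap C X T = swap_along r a b X"
proof -
  obtain t where t: "is_trivial_swap C t" using trivial_swap_exists by (rule exE)
  show ?thesis
    unfolding trivial_swap_def
  proof (rule the_equality)
    show "\<exists>t. is_trivial_swap C t \<and> swap_along r a b X = t X T"
      using t trivial_swap_unique[OF assms t] by (intro exI[of _ t]) simp
  qed (auto simp: trivial_swap_unique[OF assms])
qed

end

section \<open>Iterated tensor functors\<close>

context semisimple_monoidal_category
begin

definition pow_ob :: "'o \<Rightarrow> nat \<Rightarrow> 'o \<Rightarrow> 'o" where "pow_ob V n = (tns_ob C V ^^ n)"

lemma pow_ob_simps [simp]: "pow_ob V 0 Z = Z" "pow_ob V (Suc n) Z = V \<odot> pow_ob V n Z"
  by (simp_all add: pow_ob_def)

lemma pow_ob_shift [simp]: "pow_ob V n (V \<odot> Z) = V \<odot> pow_ob V n Z"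
  by (induction n) simp_all

lemma tpow_eq_pow_ob: "tpow C V n = pow_ob V n \<one>"
  by (induction n) simp_all

definition pow_arr :: "'o \<Rightarrow> nat \<Rightarrow> ('o, 'm) arrow \<Rightarrow> ('o, 'm) arrow" where
  "pow_arr V n = ((\<lambda>a. V \<rhd> a) ^^ n)"

lemma pow_arr_simps [simp]: "pow_arr V 0 a = a" "pow_arr V (Suc n) a = V \<rhd> pow_arr V n a"
  by (simp_all add: pow_arr_def)

lemma pow_arr_shift [simp]: "pow_arr V n (V \<rhd> a) = V \<rhd> pow_arr V n a"
  by (induction n) simp_all

lemma pow_arr_typed [simp]: "src (pow_arr V n a) = pow_ob V n (src a)" "tgt (pow_arr V n a) = pow_ob V n (tgt a)"
  "arr a \<Longrightarrow> arr (pow_arr V n a)"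
  by (induction n) simp_all

lemma pow_arr_ide [simp]: "pow_arr V n (ide X) = ide (pow_ob V n X)"
  by (induction n) simp_all

lemma pow_arr_comp: "arr g \<Longrightarrow> arr f \<Longrightarrow> src g = tgt f \<Longrightarrow> pow_arr V n (g \<bullet> f) = pow_arr V n g \<bullet> pow_arr V n f"
  by (induction n) (simp_all add: ide_ten_comp)

text \<open>
  The comparison \<open>pow_ob V n Y \<odot> Z \<rightarrow> pow_ob V n (Y \<odot> Z)\<close>, which makes the iterate of \<open>V \<odot> -\<close> commute with
  right tensoring. For \<open>Y = \<one>\<close> and \<open>Z = V\<close> it is the canonical isomorphism \<open>assoc_pow\<close>.
\<close>
primrec strength :: "'o \<Rightarrow> nat \<Rightarrow> 'o \<Rightarrow> 'o \<Rightarrow> ('o, 'm) arrow" where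
  "strength V 0 Y Z = ide (Y \<odot> Z)"
| "strength V (Suc n) Y Z = (V \<rhd> strength V n Y Z) \<bullet> asc V (pow_ob V n Y) Z"

lemma strength_typed [simp]:
  "arr (strength V n Y Z) \<and> src (strength V n Y Z) = pow_ob V n Y \<odot> Z \<and> tgt (strength V n Y Z) = pow_ob V n (Y \<odot> Z)"
  by (induction n) simp_all

lemma strength_unit_right [simp]: "strength V n Y \<one> = ide (pow_ob V n Y)"
  by (induction n) simp_all

lemma mor_strength: "mor (strength V m \<one> V) = assoc_pow C V m"
  by (induction m) (simp_all add: tpow_eq_pow_ob)

lemma strength_natural_right:
  assumes "a \<^bold>: Z \<rightarrow> Z'"
  shows "strength V n Y Z' \<bullet> ((pow_ob V n Y) \<rhd> a) = pow_arr V n (Y \<rhd> a) \<bullet> strength V n Y Z"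
proof (induction n)
  case (Suc n)
  have "strength V (Suc n) Y Z' \<bullet> ((pow_ob V (Suc n) Y) \<rhd> a) =
      (V \<rhd> strength V n Y Z') \<bullet> (asc V (pow_ob V n Y) Z' \<bullet> ((V \<rhd> ide (pow_ob V n Y)) \<boxtimes> a))"
    using assms by simp
  also have "\<dots> = ((V \<rhd> strength V n Y Z') \<bullet> (V \<rhd> ((pow_ob V n Y) \<rhd> a))) \<bullet> asc V (pow_ob V n Y) Z"
    using assms by (subst asc_nat) simp_all
  also have "(V \<rhd> strength V n Y Z') \<bullet> (V \<rhd> ((pow_ob V n Y) \<rhd> a)) =
      V \<rhd> (pow_arr V n (Y \<rhd> a) \<bullet> strength V n Y Z)"
    using assms by (simp add: ten_comp_ten Suc.IH)
  finally show ?case using assms by (simp add: ide_ten_comp)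
qed (use assms in simp)

lemma strength_natural_left:
  assumes "b \<^bold>: Y \<rightarrow> Y'"
  shows "strength V n Y' Z \<bullet> (pow_arr V n b \<lhd> Z) = pow_arr V n (b \<lhd> Z) \<bullet> strength V n Y Z"
proof (induction n)
  case (Suc n)
  have "strength V (Suc n) Y' Z \<bullet> (pow_arr V (Suc n) b \<lhd> Z) =
      (V \<rhd> strength V n Y' Z) \<bullet> (asc V (pow_ob V n Y') Z \<bullet> ((V \<rhd> pow_arr V n b) \<lhd> Z))"
    using assms by simp
  also have "\<dots> = ((V \<rhd> strength V n Y' Z) \<bullet> (V \<rhd> (pow_arr V n b \<lhd> Z))) \<bullet> asc V (pow_ob V n Y) Z"
    using assms by (subst asc_nat) simp_all
  also have "(V \<rhd> strength V n Y' Z) \<bullet> (V \<rhd> (pow_arr V n b \<lhd> Z)) =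
      V \<rhd> (pow_arr V n (b \<lhd> Z) \<bullet> strength V n Y Z)"
    using assms by (simp add: ten_comp_ten Suc.IH)
  finally show ?case using assms by (simp add: ide_ten_comp)
qed (use assms in simp)

text \<open>
  The strength peels off the outermost factor \<open>V\<close> by definition; it can also peel off the innermost one.
\<close>
lemma strength_shift: "strength V (Suc n) Y Z = pow_arr V n (asc V Y Z) \<bullet> strength V n (V \<odot> Y) Z"
proof (induction n)
  case (Suc n)
  have "strength V (Suc (Suc n)) Y Z = (V \<rhd> strength V (Suc n) Y Z) \<bullet> asc V (pow_ob V (Suc n) Y) Z"
    by (rule strength.simps)
  also have "\<dots> = (V \<rhd> (pow_arr V n (asc V Y Z) \<bullet> strength V n (V \<odot> Y) Z)) \<bullet> asc V (pow_ob V (Suc n) Y) Z"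
    by (simp only: Suc.IH)
  finally show ?case by (simp add: ide_ten_comp)
qed simp

text \<open>
  The pentagon, iterated: tensoring with \<open>W\<close> and then with \<open>Z\<close> agrees with tensoring with \<open>W \<odot> Z\<close>.
\<close>
lemma strength_asc:
  "strength V n Y (W \<odot> Z) \<bullet> asc (pow_ob V n Y) W Z =
    pow_arr V n (asc Y W Z) \<bullet> strength V n (Y \<odot> W) Z \<bullet> (strength V n Y W \<lhd> Z)"
proof (induction n)
  case (Suc n)
  let ?P = "pow_ob V n Y"
  have "strength V (Suc n) Y (W \<odot> Z) \<bullet> asc (pow_ob V (Suc n) Y) W Z =
      (V \<rhd> strength V n Y (W \<odot> Z)) \<bullet> (asc V ?P (W \<odot> Z) \<bullet> asc (V \<odot> ?P) W Z)"
    by simp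
  also have "\<dots> = ((V \<rhd> strength V n Y (W \<odot> Z)) \<bullet> (V \<rhd> asc ?P W Z)) \<bullet>
      asc V (?P \<odot> W) Z \<bullet> (asc V ?P W \<lhd> Z)"
    by (simp add: asc_pentagon)
  also have "(V \<rhd> strength V n Y (W \<odot> Z)) \<bullet> (V \<rhd> asc ?P W Z) =
      (V \<rhd> pow_arr V n (asc Y W Z)) \<bullet> (V \<rhd> strength V n (Y \<odot> W) Z) \<bullet> (V \<rhd> (strength V n Y W \<lhd> Z))"
    by (simp add: ten_comp_ten Suc.IH)
  also have "((V \<rhd> pow_arr V n (asc Y W Z)) \<bullet> (V \<rhd> strength V n (Y \<odot> W) Z) \<bullet>
      (V \<rhd> (strength V n Y W \<lhd> Z))) \<bullet> asc V (?P \<odot> W) Z \<bullet> (asc V ?P W \<lhd> Z) =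
      (V \<rhd> pow_arr V n (asc Y W Z)) \<bullet> (V \<rhd> strength V n (Y \<odot> W) Z) \<bullet>
      ((V \<rhd> (strength V n Y W \<lhd> Z)) \<bullet> asc V (?P \<odot> W) Z) \<bullet> (asc V ?P W \<lhd> Z)"
    by simp
  also have "(V \<rhd> (strength V n Y W \<lhd> Z)) \<bullet> asc V (?P \<odot> W) Z =
      asc V (pow_ob V n (Y \<odot> W)) Z \<bullet> ((V \<rhd> strength V n Y W) \<lhd> Z)"
    by (subst asc_nat') simp_all
  finally show ?case by (simp add: comp_ten_ide)
qed simp

text \<open>
  The element \<open>f\<close> of \<open>V\<^sup>n\<close>, inserted to the left of \<open>Z\<close>. This is the natural transformation from the
  identity to the \<open>n\<close>-fold iterate of \<open>V \<odot> -\<close> with value \<open>f\<close> at \<open>\<one>\<close>.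
\<close>
definition extend :: "'o \<Rightarrow> nat \<Rightarrow> ('o, 'm) arrow \<Rightarrow> 'o \<Rightarrow> ('o, 'm) arrow" where
  "extend V n f Z = strength V n \<one> Z \<bullet> (f \<lhd> Z)"

lemma extend_typed:
  "f \<^bold>: \<one> \<rightarrow> pow_ob V n \<one> \<Longrightarrow> extend V n f Z \<^bold>: Z \<rightarrow> pow_ob V n Z"
  by (simp add: extend_def)

lemma extend_unit: "f \<^bold>: \<one> \<rightarrow> pow_ob V n \<one> \<Longrightarrow> extend V n f \<one> = f"
  by (simp add: extend_def)

lemma extend_natural:
  assumes f: "f \<^bold>: \<one> \<rightarrow> pow_ob V n \<one>" and a: "a \<^bold>: Z \<rightarrow> Z'"
  shows "extend V n f Z' \<bullet> a = pow_arr V n a \<bullet> extend V n f Z"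
proof -
  have "extend V n f Z' \<bullet> a = strength V n \<one> Z' \<bullet> ((f \<lhd> Z') \<bullet> (\<one> \<rhd> a))"
    using f a by (simp add: extend_def)
  also have "(f \<lhd> Z') \<bullet> (\<one> \<rhd> a) = ((pow_ob V n \<one>) \<rhd> a) \<bullet> (f \<lhd> Z)"
    using f a by (intro ten_swap) auto
  also have "strength V n \<one> Z' \<bullet> ((pow_ob V n \<one>) \<rhd> a) \<bullet> (f \<lhd> Z) =
      (strength V n \<one> Z' \<bullet> ((pow_ob V n \<one>) \<rhd> a)) \<bullet> (f \<lhd> Z)"
    using f a by simp
  also have "\<dots> = (pow_arr V n a \<bullet> strength V n \<one> Z) \<bullet> (f \<lhd> Z)"
    using a by (simp add: strength_natural_right)
  finally show ?thesis using f a by (simp add: extend_def)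
qed

lemma extend_ten:
  assumes f: "f \<^bold>: \<one> \<rightarrow> pow_ob V n \<one>"
  shows "strength V n W Z \<bullet> (extend V n f W \<lhd> Z) = extend V n f (W \<odot> Z)"
proof -
  have "extend V n f (W \<odot> Z) = strength V n \<one> (W \<odot> Z) \<bullet> ((f \<boxtimes> (W \<rhd> ide Z)) \<bullet> asc \<one> W Z)"
    using f by (simp add: extend_def)
  also have "(f \<boxtimes> (W \<rhd> ide Z)) \<bullet> asc \<one> W Z = asc (pow_ob V n \<one>) W Z \<bullet> ((f \<lhd> W) \<lhd> Z)"
    using f by (subst asc_nat') simp_all
  also have "strength V n \<one> (W \<odot> Z) \<bullet> asc (pow_ob V n \<one>) W Z \<bullet> ((f \<lhd> W) \<lhd> Z) =
      (strength V n \<one> (W \<odot> Z) \<bullet> asc (pow_ob V n \<one>) W Z) \<bullet> ((f \<lhd> W) \<lhd> Z)"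
    using f by simp
  also have "\<dots> = strength V n W Z \<bullet> (strength V n \<one> W \<lhd> Z) \<bullet> ((f \<lhd> W) \<lhd> Z)"
    unfolding strength_asc using f by simp
  finally show ?thesis using f by (simp add: extend_def comp_ten_ide)
qed

text \<open>
  The contribution of \<open>f\<close> and \<open>g\<close> to the Frobenius-Schur endomorphism: \<open>n\<close> strands leave \<open>f\<close> to the left of the
  incoming strand; the first of them goes out, and the others and the incoming strand enter \<open>g\<close>.
\<close>
definition fs_summand :: "'o \<Rightarrow> nat \<Rightarrow> ('o, 'm) arrow \<Rightarrow> ('o, 'm) arrow \<Rightarrow> ('o, 'm) arrow" where
  "fs_summand V n f g = (V \<rhd> g) \<bullet> extend V n f V"

lemma fs_summand_typed:
  "f \<^bold>: \<one> \<rightarrow> pow_ob V n \<one> \<Longrightarrow> g \<^bold>: pow_ob V n \<one> \<rightarrow> \<one> \<Longrightarrow> fs_summand V n f g \<^bold>: V \<rightarrow> V"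
  using pow_ob_shift[of V n \<one>] by (simp add: fs_summand_def extend_typed del: pow_ob_shift)

end

context dual_pair
begin

text \<open>
  Everything before the insertion of \<open>f\<close> is an arrow \<open>b : U \<rightarrow> V\<close> into the right dual \<open>V\<close> of \<open>D\<close> which mates
  with \<open>g\<close>, that is, \<open>e \<cdot> (D \<otimes> b) = g\<close>. It slides past \<open>f\<close> and meets the evaluation.
\<close>
lemma straighten:
  assumes f: "f \<^bold>: \<one> \<rightarrow> U \<odot> D" and g: "g \<^bold>: D \<odot> U \<rightarrow> \<one>"
  shows "((U \<rhd> e) \<bullet> asc U D V) \<bullet> (f \<lhd> V) \<bullet> (V \<rhd> g) \<bullet> (asc V D U \<bullet> (d \<lhd> U)) =
    (U \<rhd> g) \<bullet> asc U D U \<bullet> (f \<lhd> U)"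
proof -
  define b where "b = (V \<rhd> g) \<bullet> db_at U"
  have b: "b \<^bold>: U \<rightarrow> V" using g by (simp add: b_def)
  have eb: "e \<bullet> (D \<rhd> b) = g"
  proof -
    have "e \<bullet> (D \<rhd> b) = (ev_at \<one> \<bullet> (D \<rhd> (V \<rhd> g))) \<bullet> (D \<rhd> db_at U)"
      using g by (simp add: b_def ev_at_unit ide_ten_comp)
    also have "\<dots> = g \<bullet> (ev_at (D \<odot> U) \<bullet> (D \<rhd> db_at U))"
      using g ev_at_natural[of g "D \<odot> U" \<one>] by simp
    finally show ?thesis using g by (simp add: ev_at_ten_db_at)
  qed
  have "((U \<rhd> e) \<bullet> asc U D V) \<bullet> (f \<lhd> V) \<bullet> (V \<rhd> g) \<bullet> (asc V D U \<bullet> (d \<lhd> U)) =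
      (U \<rhd> e) \<bullet> asc U D V \<bullet> ((f \<lhd> V) \<bullet> (\<one> \<rhd> b))"
    using f g b by (simp add: b_def db_at_def)
  also have "(f \<lhd> V) \<bullet> (\<one> \<rhd> b) = ((U \<rhd> ide D) \<boxtimes> b) \<bullet> (f \<lhd> U)"
    using f b ten_swap[of f \<one> "U \<odot> D" b U V] by simp
  also have "(U \<rhd> e) \<bullet> asc U D V \<bullet> ((U \<rhd> ide D) \<boxtimes> b) \<bullet> (f \<lhd> U) =
      (U \<rhd> e) \<bullet> (asc U D V \<bullet> ((U \<rhd> ide D) \<boxtimes> b)) \<bullet> (f \<lhd> U)"
    using f b by simp
  also have "asc U D V \<bullet> ((U \<rhd> ide D) \<boxtimes> b) = (U \<rhd> (D \<rhd> b)) \<bullet> asc U D U"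
    using b by (subst asc_nat) simp_all
  also have "(U \<rhd> e) \<bullet> ((U \<rhd> (D \<rhd> b)) \<bullet> asc U D U) \<bullet> (f \<lhd> U) =
      (U \<rhd> (e \<bullet> (D \<rhd> b))) \<bullet> asc U D U \<bullet> (f \<lhd> U)"
    using f b by (simp add: ide_ten_comp)
  finally show ?thesis unfolding eb .
qed

text \<open>
  The counit and the unit of the composite adjunction between the \<open>n\<close>-fold iterates of \<open>D \<odot> -\<close> and
  \<open>V \<odot> -\<close>. At \<open>\<one>\<close> they are the nested evaluation and coevaluation of \<open>D\<^sup>n\<close> and \<open>V\<^sup>n\<close>.
\<close>
primrec ev_pow :: "nat \<Rightarrow> 'o \<Rightarrow> ('o, 'm) arrow" where
  "ev_pow 0 Z = ide Z"
| "ev_pow (Suc n) Z = ev_at Z \<bullet> (D \<rhd> ev_pow n (V \<odot> Z))"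

primrec db_pow :: "nat \<Rightarrow> 'o \<Rightarrow> ('o, 'm) arrow" where
  "db_pow 0 Z = ide Z"
| "db_pow (Suc n) Z = pow_arr V n (db_at (pow_ob D n Z)) \<bullet> db_pow n Z"

lemma ev_pow_typed [simp]:
  "arr (ev_pow n Z) \<and> src (ev_pow n Z) = pow_ob D n (pow_ob V n Z) \<and> tgt (ev_pow n Z) = Z"
  by (induction n arbitrary: Z) simp_all

lemma db_pow_typed [simp]:
  "arr (db_pow n Z) \<and> src (db_pow n Z) = Z \<and> tgt (db_pow n Z) = pow_ob V n (pow_ob D n Z)"
  by (induction n) simp_all

lemma ev_pow_natural:
  assumes "a \<^bold>: X \<rightarrow> Y"
  shows "ev_pow n Y \<bullet> pow_arr D n (pow_arr V n a) = a \<bullet> ev_pow n X"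
  using assms
proof (induction n arbitrary: a X Y)
  case (Suc n)
  have "ev_pow (Suc n) Y \<bullet> pow_arr D (Suc n) (pow_arr V (Suc n) a) =
      ev_at Y \<bullet> ((D \<rhd> ev_pow n (V \<odot> Y)) \<bullet> (D \<rhd> pow_arr D n (pow_arr V n (V \<rhd> a))))"
    using Suc.prems by simp
  also have "(D \<rhd> ev_pow n (V \<odot> Y)) \<bullet> (D \<rhd> pow_arr D n (pow_arr V n (V \<rhd> a))) =
      (D \<rhd> (V \<rhd> a)) \<bullet> (D \<rhd> ev_pow n (V \<odot> X))"
    using Suc.prems Suc.IH[of "V \<rhd> a" "V \<odot> X" "V \<odot> Y"] by (simp add: ten_comp_ten)
  also have "ev_at Y \<bullet> \<dots> = (ev_at Y \<bullet> (D \<rhd> (V \<rhd> a))) \<bullet> (D \<rhd> ev_pow n (V \<odot> X))"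
    using Suc.prems by simp
  also have "\<dots> = (a \<bullet> ev_at X) \<bullet> (D \<rhd> ev_pow n (V \<odot> X))"
    using Suc.prems by (simp add: ev_at_natural)
  finally show ?case using Suc.prems by simp
qed simp

lemma db_pow_natural:
  assumes a: "a \<^bold>: X \<rightarrow> Y"
  shows "db_pow n Y \<bullet> a = pow_arr V n (pow_arr D n a) \<bullet> db_pow n X"
proof (induction n)
  case (Suc n)
  have "db_pow (Suc n) Y \<bullet> a = pow_arr V n (db_at (pow_ob D n Y)) \<bullet> (db_pow n Y \<bullet> a)"
    using a by simp
  also have "\<dots> = pow_arr V n (db_at (pow_ob D n Y) \<bullet> pow_arr D n a) \<bullet> db_pow n X"
    unfolding Suc.IH using a by (simp add: pow_arr_comp)
  also have "db_at (pow_ob D n Y) \<bullet> pow_arr D n a = (V \<rhd> pow_arr D (Suc n) a) \<bullet> db_at (pow_ob D n X)"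
    using a by (simp add: db_at_natural)
  finally show ?case using a by (simp add: pow_arr_comp)
qed (use a in simp)

text \<open>
  The nested evaluation can be built from the outermost or from the innermost pair of strands. This
  equality, together with naturality, is what makes \<open>fs_summand\<close> self-dual below.
\<close>
lemma ev_pow_Suc_inner: "ev_pow (Suc n) Z = ev_pow n Z \<bullet> pow_arr D n (ev_at (pow_ob V n Z))"
proof (induction n arbitrary: Z)
  case (Suc n)
  have "ev_pow (Suc (Suc n)) Z = ev_at Z \<bullet> (D \<rhd> ev_pow (Suc n) (V \<odot> Z))"
    by (rule ev_pow.simps)
  also have "\<dots> = ev_at Z \<bullet> (D \<rhd> (ev_pow n (V \<odot> Z) \<bullet> pow_arr D n (ev_at (pow_ob V n (V \<odot> Z)))))"
    by (simp only: Suc.IH)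
  finally show ?case by (simp add: ide_ten_comp)
qed simp

lemma ev_pow_db_pow: "pow_arr V n (ev_pow n Z) \<bullet> db_pow n (pow_ob V n Z) = ide (pow_ob V n Z)"
proof (induction n arbitrary: Z)
  case (Suc n)
  let ?P = "pow_ob V n (V \<odot> Z)"
  have "pow_arr V (Suc n) (ev_pow (Suc n) Z) \<bullet> db_pow (Suc n) (pow_ob V (Suc n) Z) =
      pow_arr V n (V \<rhd> ev_pow (Suc n) Z) \<bullet> pow_arr V n (db_at (pow_ob D n ?P)) \<bullet> db_pow n ?P"
    by simp
  also have "\<dots> = pow_arr V n ((V \<rhd> ev_at Z) \<bullet> ((V \<rhd> (D \<rhd> ev_pow n (V \<odot> Z))) \<bullet> db_at (pow_ob D n ?P))) \<bullet> db_pow n ?P"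
    by (simp add: pow_arr_comp ide_ten_comp)
  also have "(V \<rhd> (D \<rhd> ev_pow n (V \<odot> Z))) \<bullet> db_at (pow_ob D n ?P) = db_at (V \<odot> Z) \<bullet> ev_pow n (V \<odot> Z)"
    by (subst db_at_natural) simp_all
  also have "(V \<rhd> ev_at Z) \<bullet> db_at (V \<odot> Z) \<bullet> ev_pow n (V \<odot> Z) = ev_pow n (V \<odot> Z)"
    using comp_prefix[OF ev_at_db_at[of Z], where h = "ev_pow n (V \<odot> Z)"] by simp
  finally show ?case using Suc.IH[of "V \<odot> Z"] by simp
qed simp

lemma ev_pow_pow_arr_db_pow: "ev_pow n (pow_ob D n Z) \<bullet> pow_arr D n (db_pow n Z) = ide (pow_ob D n Z)"
proof (induction n arbitrary: Z)
  case (Suc n)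
  let ?P = "pow_ob D n Z"
  have "ev_pow (Suc n) (pow_ob D (Suc n) Z) \<bullet> pow_arr D (Suc n) (db_pow (Suc n) Z) =
      ev_at (D \<odot> ?P) \<bullet> (D \<rhd> ((ev_pow n (V \<odot> (D \<odot> ?P)) \<bullet> pow_arr D n (pow_arr V n (db_at ?P))) \<bullet> pow_arr D n (db_pow n Z)))"
    by (simp add: pow_arr_comp ide_ten_comp)
  also have "ev_pow n (V \<odot> (D \<odot> ?P)) \<bullet> pow_arr D n (pow_arr V n (db_at ?P)) = db_at ?P \<bullet> ev_pow n ?P"
    by (rule ev_pow_natural) simp
  also have "(db_at ?P \<bullet> ev_pow n ?P) \<bullet> pow_arr D n (db_pow n Z) = db_at ?P"
    by (simp add: Suc.IH)
  finally show ?case by (simp add: ev_at_ten_db_at)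
qed simp

text \<open>
  The analogue of \<open>ev_at_ten\<close> for the iterates: right tensoring commutes with the nested evaluation up
  to the strengths of both iterates.
\<close>
lemma ev_pow_ten:
  "ev_pow n Y \<lhd> Z = ev_pow n (Y \<odot> Z) \<bullet> pow_arr D n (strength V n Y Z) \<bullet> strength D n (pow_ob V n Y) Z"
proof (induction n arbitrary: Y)
  case (Suc n)
  let ?P = "pow_ob V n (V \<odot> Y)"
  have "ev_pow (Suc n) Y \<lhd> Z = ev_at (Y \<odot> Z) \<bullet> (D \<rhd> asc V Y Z) \<bullet>
      (asc D (V \<odot> Y) Z \<bullet> ((D \<rhd> ev_pow n (V \<odot> Y)) \<lhd> Z))"
    by (simp add: comp_ten_ide ev_at_ten)
  also have "asc D (V \<odot> Y) Z \<bullet> ((D \<rhd> ev_pow n (V \<odot> Y)) \<lhd> Z) =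
      (D \<rhd> (ev_pow n (V \<odot> Y) \<lhd> Z)) \<bullet> asc D (pow_ob D n ?P) Z"
    by (subst asc_nat) simp_all
  also have "ev_pow n (V \<odot> Y) \<lhd> Z =
      ev_pow n ((V \<odot> Y) \<odot> Z) \<bullet> pow_arr D n (strength V n (V \<odot> Y) Z) \<bullet> strength D n ?P Z"
    by (rule Suc.IH)
  also have "ev_at (Y \<odot> Z) \<bullet> (D \<rhd> asc V Y Z) \<bullet>
      ((D \<rhd> (ev_pow n ((V \<odot> Y) \<odot> Z) \<bullet> pow_arr D n (strength V n (V \<odot> Y) Z) \<bullet> strength D n ?P Z)) \<bullet> asc D (pow_ob D n ?P) Z) =
      ev_at (Y \<odot> Z) \<bullet> (D \<rhd> ((asc V Y Z \<bullet> ev_pow n ((V \<odot> Y) \<odot> Z)) \<bullet> pow_arr D n (strength V n (V \<odot> Y) Z))) \<bullet>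
      (D \<rhd> strength D n ?P Z) \<bullet> asc D (pow_ob D n ?P) Z"
    by (simp add: ide_ten_comp)
  also have "asc V Y Z \<bullet> ev_pow n ((V \<odot> Y) \<odot> Z) = ev_pow n (V \<odot> (Y \<odot> Z)) \<bullet> pow_arr D n (pow_arr V n (asc V Y Z))"
    by (subst ev_pow_natural) simp_all
  also have "(ev_pow n (V \<odot> (Y \<odot> Z)) \<bullet> pow_arr D n (pow_arr V n (asc V Y Z))) \<bullet> pow_arr D n (strength V n (V \<odot> Y) Z) =
      ev_pow n (V \<odot> (Y \<odot> Z)) \<bullet> pow_arr D n (strength V (Suc n) Y Z)"
    unfolding strength_shift by (simp add: pow_arr_comp)
  finally show ?case by (simp add: ide_ten_comp)
qed simp

text \<open>
  Here \<open>g\<close> and \<open>g'\<close> are \<open>f'\<close> and \<open>f\<close>, read as functionals through the nested evaluation. Both sides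
  evaluate \<open>n + 1\<close> nested pairs among the strands of \<open>f'\<close>, \<open>D\<close>, \<open>f\<close>, \<open>V\<close>, in this order. The left side
  splits off the outermost pair, \<open>V\<close> with the first strand of \<open>f'\<close>; the right side the innermost pair,
  \<open>D\<close> with the first strand of \<open>f\<close>.
\<close>
lemma fs_summand_dual:
  assumes f: "f \<^bold>: \<one> \<rightarrow> pow_ob V n \<one>" and f': "f' \<^bold>: \<one> \<rightarrow> pow_ob D n \<one>"
    and g: "g = ev_pow n \<one> \<bullet> extend D n f' (pow_ob V n \<one>)" and g': "g' = ev_pow n \<one> \<bullet> pow_arr D n f"
  shows "e \<bullet> (fs_summand D n f' g' \<lhd> V) = e \<bullet> (D \<rhd> fs_summand V n f g)"
proof -
  note t = extend_typed[OF f] extend_typed[OF f']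
  let ?fV = "extend V n f V"
  have tV: "?fV \<^bold>: V \<rightarrow> V \<odot> pow_ob V n \<one>" using t(1)[of V] pow_ob_shift[of V n \<one>] by simp
  have tD: "extend D n f' D \<^bold>: D \<rightarrow> D \<odot> pow_ob D n \<one>" using t(2)[of D] pow_ob_shift[of D n \<one>] by simp
  have tg: "g \<^bold>: pow_ob V n \<one> \<rightarrow> \<one>" and tg': "g' \<^bold>: pow_ob D n \<one> \<rightarrow> \<one>" using t f by (simp_all add: g g')
  have pV: "pow_ob V n V = V \<odot> pow_ob V n \<one>" and pD: "pow_ob D n D = D \<odot> pow_ob D n \<one>"
    using pow_ob_shift[of V n \<one>] pow_ob_shift[of D n \<one>] by simp_all
  have g'V: "g' \<lhd> V = ev_pow n V \<bullet> pow_arr D n ?fV \<bullet> strength D n \<one> V"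
  proof -
    have "g' \<lhd> V = ev_pow n V \<bullet> pow_arr D n (strength V n \<one> V) \<bullet> (strength D n (pow_ob V n \<one>) V \<bullet> (pow_arr D n f \<lhd> V))"
      using f by (simp add: g' comp_ten_ide ev_pow_ten)
    also have "strength D n (pow_ob V n \<one>) V \<bullet> (pow_arr D n f \<lhd> V) = pow_arr D n (f \<lhd> V) \<bullet> strength D n \<one> V"
      using f by (subst strength_natural_left) simp_all
    finally show ?thesis using f by (simp add: extend_def pow_arr_comp)
  qed
  have "fs_summand D n f' g' \<lhd> V = ((D \<rhd> g') \<lhd> V) \<bullet> (extend D n f' D \<lhd> V)"
    using tg' tD by (simp add: fs_summand_def comp_ten_ide)
  also have "(D \<rhd> g') \<lhd> V = (D \<rhd> (g' \<lhd> V)) \<bullet> asc D (pow_ob D n \<one>) V"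
    using tg' asc_nat[of "ide D" g' "ide V" D \<one> V] by simp
  also have "((D \<rhd> (g' \<lhd> V)) \<bullet> asc D (pow_ob D n \<one>) V) \<bullet> (extend D n f' D \<lhd> V) =
      (D \<rhd> ev_pow n V) \<bullet> pow_arr D (Suc n) ?fV \<bullet> strength D (Suc n) \<one> V \<bullet> (extend D n f' D \<lhd> V)"
    unfolding g'V using tV tD by (simp add: ide_ten_comp pV)
  also have "strength D (Suc n) \<one> V = strength D n D V" unfolding strength_shift by simp
  also have "strength D n D V \<bullet> (extend D n f' D \<lhd> V) = extend D n f' (D \<odot> V)"
    by (rule extend_ten[OF f'])
  finally have "e \<bullet> (fs_summand D n f' g' \<lhd> V) =
      ev_pow (Suc n) \<one> \<bullet> pow_arr D (Suc n) ?fV \<bullet> extend D n f' (D \<odot> V)"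
    using tV t(2)[of "D \<odot> V"] by (simp add: ev_at_unit pV)
  also have "\<dots> = ev_pow n \<one> \<bullet> (pow_arr D n (ev_at (pow_ob V n \<one>) \<bullet> (D \<rhd> ?fV)) \<bullet> extend D n f' (D \<odot> V))"
    unfolding ev_pow_Suc_inner using tV t(2)[of "D \<odot> V"] by (simp add: pow_arr_comp)
  also have "pow_arr D n (ev_at (pow_ob V n \<one>) \<bullet> (D \<rhd> ?fV)) \<bullet> extend D n f' (D \<odot> V) =
      extend D n f' (pow_ob V n \<one>) \<bullet> ev_at (pow_ob V n \<one>) \<bullet> (D \<rhd> ?fV)"
    using tV by (subst extend_natural[OF f', symmetric]) simp_all
  also have "ev_pow n \<one> \<bullet> \<dots> = (g \<bullet> ev_at (pow_ob V n \<one>)) \<bullet> (D \<rhd> ?fV)"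
    using t(2)[of "pow_ob V n \<one>"] tV by (simp add: g)
  also have "\<dots> = (ev_at \<one> \<bullet> (D \<rhd> (V \<rhd> g))) \<bullet> (D \<rhd> ?fV)"
    using ev_at_natural[OF tg] by simp
  also have "\<dots> = e \<bullet> (D \<rhd> fs_summand V n f g)"
    using tg tV by (simp add: fs_summand_def ev_at_unit ide_ten_comp)
  finally show ?thesis .
qed

end

section \<open>Dual morphisms and pivotality\<close>

context semisimple_monoidal_category
begin

lemma mor_hom: "a \<^bold>: X \<rightarrow> Y \<Longrightarrow> mor a \<in> hom C X Y"
  by (auto simp: arr_def)

lemma dual_pair_Arrow_iff:
  "is_left_dual C V D e d \<longleftrightarrow> dual_pair C V D (Arrow (D \<odot> V) e \<one>) (Arrow \<one> d (V \<odot> D))"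
proof -
  let ?e = "Arrow (D \<odot> V) e \<one>" and ?d = "Arrow \<one> d (V \<odot> D)"
  have t: "e \<in> hom C (D \<odot> V) \<one> \<and> d \<in> hom C \<one> (V \<odot> D) \<longleftrightarrow> arr ?e \<and> arr ?d"
    by (simp add: arr_def)
  show ?thesis
  proof (cases "arr ?e \<and> arr ?d")
    case True
    have iff: "a = ide X \<longleftrightarrow> mor a = idm C X" if "src a = X" "tgt a = X" for a X
      using that by (metis arrow_eqI src_tgt_simps(3,4) mor_simps(2))
    have "(V \<rhd> ?e) \<bullet> asc V D V \<bullet> (?d \<lhd> V) = ((V \<rhd> ?e) \<bullet> asc V D V) \<bullet> (?d \<lhd> V)"
      using True by simp
    then have 1: "(V \<rhd> ?e) \<bullet> asc V D V \<bullet> (?d \<lhd> V) = ide V \<longleftrightarrow>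
        mor (((V \<rhd> ?e) \<bullet> asc V D V) \<bullet> (?d \<lhd> V)) = idm C V"
      by (simp only:) (rule iff, simp_all)
    have "(?e \<lhd> D) \<bullet> asc_inv D V D \<bullet> (D \<rhd> ?d) = ((?e \<lhd> D) \<bullet> asc_inv D V D) \<bullet> (D \<rhd> ?d)"
      using True by simp
    then have 2: "(?e \<lhd> D) \<bullet> asc_inv D V D \<bullet> (D \<rhd> ?d) = ide D \<longleftrightarrow>
        mor (((?e \<lhd> D) \<bullet> asc_inv D V D) \<bullet> (D \<rhd> ?d)) = idm C D"
      by (simp only:) (rule iff, simp_all)
    show ?thesis using 1 2
      unfolding is_left_dual_def dual_pair_def dual_pair_axioms_def
      using True t semisimple_monoidal_category_axioms by (simp del: comp_assoc)
  next
    case False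
    then show ?thesis unfolding is_left_dual_def dual_pair_def dual_pair_axioms_def using t by auto
  qed
qed

lemma is_right_dual_iff_left: "is_right_dual C V X e d \<longleftrightarrow> is_left_dual C X V e d"
  by (auto simp: is_right_dual_def is_left_dual_def)

end

context dual_pair
begin

lemma dual_pair_transport:
  assumes u: "u \<^bold>: D' \<rightarrow> D" and w: "w \<^bold>: D \<rightarrow> D'" and uw: "u \<bullet> w = ide D" "w \<bullet> u = ide D'"
  shows "dual_pair C V D' (e \<bullet> (u \<lhd> V)) ((V \<rhd> w) \<bullet> d)"
proof unfold_locales
  show "e \<bullet> (u \<lhd> V) \<^bold>: D' \<odot> V \<rightarrow> \<one>" "(V \<rhd> w) \<bullet> d \<^bold>: \<one> \<rightarrow> V \<odot> D'"
    using u w by simp_all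
  have "(V \<rhd> (e \<bullet> (u \<lhd> V))) \<bullet> asc V D' V \<bullet> (((V \<rhd> w) \<bullet> d) \<lhd> V) =
      (V \<rhd> e) \<bullet> ((V \<rhd> (u \<lhd> V)) \<bullet> asc V D' V) \<bullet> ((V \<rhd> w) \<lhd> V) \<bullet> (d \<lhd> V)"
    using u w by (simp add: ide_ten_comp comp_ten_ide)
  also have "(V \<rhd> (u \<lhd> V)) \<bullet> asc V D' V = asc V D V \<bullet> ((V \<rhd> u) \<lhd> V)"
    using u by (subst asc_nat') simp_all
  also have "(V \<rhd> e) \<bullet> (asc V D V \<bullet> ((V \<rhd> u) \<lhd> V)) \<bullet> ((V \<rhd> w) \<lhd> V) \<bullet> (d \<lhd> V) =
      (V \<rhd> e) \<bullet> asc V D V \<bullet> (((V \<rhd> (u \<bullet> w)) \<lhd> V) \<bullet> (d \<lhd> V))"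
    using u w by (simp add: ide_ten_comp comp_ten_ide del: uw)
  finally show "(V \<rhd> (e \<bullet> (u \<lhd> V))) \<bullet> asc V D' V \<bullet> (((V \<rhd> w) \<bullet> d) \<lhd> V) = ide V"
    by (simp add: uw zigzag_V)
  have "((e \<bullet> (u \<lhd> V)) \<lhd> D') \<bullet> asc_inv D' V D' \<bullet> (D' \<rhd> ((V \<rhd> w) \<bullet> d)) =
      (e \<lhd> D') \<bullet> (((u \<lhd> V) \<lhd> D') \<bullet> asc_inv D' V D') \<bullet> (D' \<rhd> (V \<rhd> w)) \<bullet> (D' \<rhd> d)"
    using u w by (simp add: ide_ten_comp comp_ten_ide)
  also have "((u \<lhd> V) \<lhd> D') \<bullet> asc_inv D' V D' = asc_inv D V D' \<bullet> (u \<boxtimes> (V \<rhd> ide D'))"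
    using u by (subst asc_inv_nat') simp_all
  also have "(e \<lhd> D') \<bullet> (asc_inv D V D' \<bullet> (u \<boxtimes> (V \<rhd> ide D'))) \<bullet> (D' \<rhd> (V \<rhd> w)) \<bullet> (D' \<rhd> d) =
      ev_at D' \<bullet> ((u \<lhd> (V \<odot> D')) \<bullet> (D' \<rhd> ((V \<rhd> w) \<bullet> d)))"
    using u w by (simp add: ev_at_def ide_ten_comp)
  also have "(u \<lhd> (V \<odot> D')) \<bullet> (D' \<rhd> ((V \<rhd> w) \<bullet> d)) = (D \<rhd> ((V \<rhd> w) \<bullet> d)) \<bullet> u"
    using u w ten_swap[of u D' D "(V \<rhd> w) \<bullet> d" \<one> "V \<odot> D'"] by simp
  also have "ev_at D' \<bullet> (D \<rhd> ((V \<rhd> w) \<bullet> d)) \<bullet> u =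
      (ev_at D' \<bullet> (D \<rhd> (V \<rhd> w))) \<bullet> (D \<rhd> d) \<bullet> u"
    using u w by (simp add: ide_ten_comp)
  also have "ev_at D' \<bullet> (D \<rhd> (V \<rhd> w)) = w \<bullet> ev_at D" using w by (rule ev_at_natural)
  also have "(w \<bullet> ev_at D) \<bullet> (D \<rhd> d) \<bullet> u = w \<bullet> (ev_at D \<bullet> (D \<rhd> d)) \<bullet> u"
    using u w by simp
  also have "ev_at D \<bullet> (D \<rhd> d) = ide D" by (simp add: ev_at_def zigzag_D)
  finally show "((e \<bullet> (u \<lhd> V)) \<lhd> D') \<bullet> asc_inv D' V D' \<bullet> (D' \<rhd> ((V \<rhd> w) \<bullet> d)) = ide D'"
    using u w uw by simp
qed

end

context semisimple_pivotal_category
begin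

definition ev_arr :: "'o \<Rightarrow> ('o, 'm) arrow" where "ev_arr V = Arrow (V\<^sup>\<or> \<odot> V) (ev C V) \<one>"
definition db_arr :: "'o \<Rightarrow> ('o, 'm) arrow" where "db_arr V = Arrow \<one> (db C V) (V \<odot> V\<^sup>\<or>)"
definition piv_arr :: "'o \<Rightarrow> ('o, 'm) arrow" where "piv_arr V = Arrow V (piv C V) (V\<^sup>\<or>\<^sup>\<or>)"
definition piv_inv_arr :: "'o \<Rightarrow> ('o, 'm) arrow" where "piv_inv_arr V = Arrow (V\<^sup>\<or>\<^sup>\<or>) (piv_inv C V) V"

lemma dual_pair_dual: "dual_pair C V (V\<^sup>\<or>) (ev_arr V) (db_arr V)"
  using left_duals[of V] unfolding dual_pair_Arrow_iff ev_arr_def db_arr_def .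

lemma dual_unit [simp]: "\<one>\<^sup>\<or> = \<one>" by (rule dual_unit_ob)

lemma mor_piv_simps [simp]:
  "mor (ev_arr V) = ev C V" "mor (db_arr V) = db C V" "mor (piv_arr V) = piv C V" "mor (piv_inv_arr V) = piv_inv C V"
  by (simp_all add: ev_arr_def db_arr_def piv_arr_def piv_inv_arr_def)

lemma ev_arr_typed [simp]: "arr (ev_arr V)" "src (ev_arr V) = V\<^sup>\<or> \<odot> V" "tgt (ev_arr V) = \<one>"
  and db_arr_typed [simp]: "arr (db_arr V)" "src (db_arr V) = \<one>" "tgt (db_arr V) = V \<odot> V\<^sup>\<or>"
  using dual_pair.ed_simps[OF dual_pair_dual] by simp_all

lemma is_inverse_piv_inv: "is_inverse C V (V\<^sup>\<or>\<^sup>\<or>) (piv C V) (piv_inv C V)"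
  unfolding piv_inv_def by (rule is_inverse_inv_mor[OF piv_iso])

lemma j_typed [simp]: "arr (piv_arr V)" "src (piv_arr V) = V" "tgt (piv_arr V) = V\<^sup>\<or>\<^sup>\<or>"
  "arr (piv_inv_arr V)" "src (piv_inv_arr V) = V\<^sup>\<or>\<^sup>\<or>" "tgt (piv_inv_arr V) = V"
  using piv_iso[of V] is_inverse_piv_inv[of V]
  by (simp_all add: piv_arr_def piv_inv_arr_def arr_def is_iso_def is_inverse_def)

lemma piv_inv_arr_piv_arr [simp]: "piv_inv_arr V \<bullet> piv_arr V = ide V" "piv_arr V \<bullet> piv_inv_arr V = ide (V\<^sup>\<or>\<^sup>\<or>)"
  using is_inverse_piv_inv[of V] by (auto intro!: arrow_eqI simp: is_inverse_def)

text \<open>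
  \<open>W\<close> is isomorphic to \<open>W\<^sup>\<or>\<^sup>\<or>\<close>, a left dual of \<open>W\<^sup>\<or>\<close>; so \<open>W\<^sup>\<or>\<close> is a right dual of \<open>W\<close>.
\<close>
lemma right_dual_exists: "\<exists>X e d. is_right_dual C W X e d"
proof -
  interpret dual_pair C "W\<^sup>\<or>" "W\<^sup>\<or>\<^sup>\<or>" "ev_arr (W\<^sup>\<or>)" "db_arr (W\<^sup>\<or>)" by (rule dual_pair_dual)
  have "dual_pair C (W\<^sup>\<or>) W (ev_arr (W\<^sup>\<or>) \<bullet> (piv_arr W \<lhd> W\<^sup>\<or>)) ((W\<^sup>\<or> \<rhd> piv_inv_arr W) \<bullet> db_arr (W\<^sup>\<or>))"
    by (rule dual_pair_transport) simp_all
  then have "is_left_dual C (W\<^sup>\<or>) W (mor (ev_arr (W\<^sup>\<or>) \<bullet> (piv_arr W \<lhd> W\<^sup>\<or>)))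
      (mor ((W\<^sup>\<or> \<rhd> piv_inv_arr W) \<bullet> db_arr (W\<^sup>\<or>)))"
    unfolding dual_pair_Arrow_iff by (simp add: compose_def ten_def ide_def ev_arr_def db_arr_def piv_arr_def piv_inv_arr_def)
  then show ?thesis unfolding is_right_dual_iff_left by blast
qed

lemma mate_unique:
  "\<lbrakk>g \<^bold>: Y \<rightarrow> V\<^sup>\<or>; g' \<^bold>: Y \<rightarrow> V\<^sup>\<or>; ev_arr V \<bullet> (g \<lhd> V) = ev_arr V \<bullet> (g' \<lhd> V)\<rbrakk> \<Longrightarrow> g = g'"
  by (rule dual_pair.ev_mate_unique[OF dual_pair_dual])

lemma mate_exists: "p \<^bold>: Y \<odot> V \<rightarrow> \<one> \<Longrightarrow> \<exists>g. g \<^bold>: Y \<rightarrow> V\<^sup>\<or> \<and> ev_arr V \<bullet> (g \<lhd> V) = p"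
  by (rule dual_pair.ev_mate_exists[OF dual_pair_dual])

text \<open>
  Evaluates the definite descriptions by which \<open>dual_mor\<close> and \<open>dual_tensor\<close> are defined.
\<close>
lemma the_mate:
  assumes g: "g \<^bold>: Y \<rightarrow> V\<^sup>\<or>" "ev_arr V \<bullet> (g \<lhd> V) = p"
  shows "(THE h. h \<in> hom C Y (V\<^sup>\<or>) \<and> ev C V \<cdot> (h \<otimes> idm C V) = mor p) = mor g"
proof (rule the_equality)
  show "mor g \<in> hom C Y (V\<^sup>\<or>) \<and> ev C V \<cdot> (mor g \<otimes> idm C V) = mor p"
    using g by (auto simp: arr_def)
next
  fix h assume h: "h \<in> hom C Y (V\<^sup>\<or>) \<and> ev C V \<cdot> (h \<otimes> idm C V) = mor p"
  let ?h = "Arrow Y h (V\<^sup>\<or>)"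
  have t: "?h \<^bold>: Y \<rightarrow> V\<^sup>\<or>" using h by (simp add: arr_def)
  have "ev_arr V \<bullet> (?h \<lhd> V) = ev_arr V \<bullet> (g \<lhd> V)"
    by (rule arrow_eqI) (use h g in auto)
  then have "?h = g" by (rule mate_unique[OF t g(1)])
  then show "h = mor g" by (metis arrow.sel(2))
qed

definition dual_arr :: "('o, 'm) arrow \<Rightarrow> ('o, 'm) arrow" where
  "dual_arr f = Arrow ((tgt f)\<^sup>\<or>) (dual_mor C (src f) (tgt f) (mor f)) ((src f)\<^sup>\<or>)"

lemma dual_arr_eqI:
  assumes f: "f \<^bold>: V \<rightarrow> W" and g: "g \<^bold>: W\<^sup>\<or> \<rightarrow> V\<^sup>\<or>"
    and eq: "ev_arr V \<bullet> (g \<lhd> V) = ev_arr W \<bullet> (W\<^sup>\<or> \<rhd> f)"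
  shows "dual_arr f = g"
  using the_mate[OF g eq] f g by (intro arrow_eqI) (simp_all add: dual_arr_def dual_mor_def)

lemma dual_arr_props:
  assumes f: "f \<^bold>: V \<rightarrow> W"
  shows "dual_arr f \<^bold>: W\<^sup>\<or> \<rightarrow> V\<^sup>\<or>" "ev_arr V \<bullet> (dual_arr f \<lhd> V) = ev_arr W \<bullet> (W\<^sup>\<or> \<rhd> f)"
proof -
  obtain g where g: "g \<^bold>: W\<^sup>\<or> \<rightarrow> V\<^sup>\<or>" "ev_arr V \<bullet> (g \<lhd> V) = ev_arr W \<bullet> (W\<^sup>\<or> \<rhd> f)"
    using mate_exists[of "ev_arr W \<bullet> (W\<^sup>\<or> \<rhd> f)" "W\<^sup>\<or>" V] f by auto
  have "dual_arr f = g" by (rule dual_arr_eqI[OF f g])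
  then show "dual_arr f \<^bold>: W\<^sup>\<or> \<rightarrow> V\<^sup>\<or>" "ev_arr V \<bullet> (dual_arr f \<lhd> V) = ev_arr W \<bullet> (W\<^sup>\<or> \<rhd> f)"
    using g by simp_all
qed

lemma dual_arr_typed [simp]: "arr f \<Longrightarrow> arr (dual_arr f)" "src (dual_arr f) = (tgt f)\<^sup>\<or>" "tgt (dual_arr f) = (src f)\<^sup>\<or>"
  using dual_arr_props(1)[of f] by (simp_all add: dual_arr_def)

lemma dual_arr_ide: "dual_arr (ide V) = ide (V\<^sup>\<or>)"
  by (rule dual_arr_eqI) simp_all

lemma dual_arr_comp:
  assumes "f \<^bold>: U \<rightarrow> V" "g \<^bold>: V \<rightarrow> W"
  shows "dual_arr (g \<bullet> f) = dual_arr f \<bullet> dual_arr g"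
proof (rule dual_arr_eqI)
  have "ev_arr U \<bullet> ((dual_arr f \<bullet> dual_arr g) \<lhd> U) = (ev_arr U \<bullet> (dual_arr f \<lhd> U)) \<bullet> (dual_arr g \<lhd> U)"
    using assms by (simp add: comp_ten_ide)
  also have "\<dots> = ev_arr V \<bullet> ((V\<^sup>\<or> \<rhd> f) \<bullet> (dual_arr g \<lhd> U))"
    using assms dual_arr_props(2)[OF assms(1)] by simp
  also have "(V\<^sup>\<or> \<rhd> f) \<bullet> (dual_arr g \<lhd> U) = (dual_arr g \<lhd> V) \<bullet> (W\<^sup>\<or> \<rhd> f)"
    using assms ten_swap[of "dual_arr g" "W\<^sup>\<or>" "V\<^sup>\<or>" f U V] by simp
  also have "ev_arr V \<bullet> \<dots> = (ev_arr V \<bullet> (dual_arr g \<lhd> V)) \<bullet> (W\<^sup>\<or> \<rhd> f)"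
    using assms by simp
  also have "\<dots> = ev_arr W \<bullet> (W\<^sup>\<or> \<rhd> (g \<bullet> f))"
    using assms dual_arr_props(2)[OF assms(2)] by (simp add: ide_ten_comp)
  finally show "ev_arr U \<bullet> ((dual_arr f \<bullet> dual_arr g) \<lhd> U) = ev_arr W \<bullet> (W\<^sup>\<or> \<rhd> (g \<bullet> f))" .
qed (use assms in simp_all)

text \<open>
  Mates with respect to the evaluations are mates with respect to the coevaluations: expand \<open>k\<close> as the
  transpose of its pairing with \<open>V\<close>, and a zigzag of \<open>Y\<close> cancels.
\<close>
lemma db_mate:
  assumes h: "h \<^bold>: V \<rightarrow> Y" and k: "k \<^bold>: Y\<^sup>\<or> \<rightarrow> V\<^sup>\<or>"
    and eq: "ev_arr V \<bullet> (k \<lhd> V) = ev_arr Y \<bullet> (Y\<^sup>\<or> \<rhd> h)"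
  shows "(Y \<rhd> k) \<bullet> db_arr Y = (h \<lhd> V\<^sup>\<or>) \<bullet> db_arr V"
proof -
  interpret v: dual_pair C V "V\<^sup>\<or>" "ev_arr V" "db_arr V" by (rule dual_pair_dual)
  interpret y: dual_pair C Y "Y\<^sup>\<or>" "ev_arr Y" "db_arr Y" by (rule dual_pair_dual)
  let ?x = "(h \<lhd> V\<^sup>\<or>) \<bullet> db_arr V"
  have "k = v.rtranspose (Y\<^sup>\<or>) (v.runtranspose \<one> k)"
    using v.rtranspose_runtranspose[of k "Y\<^sup>\<or>" \<one>] k by simp
  also have "v.runtranspose \<one> k = ev_arr Y \<bullet> (Y\<^sup>\<or> \<rhd> h)"
    unfolding v.runtranspose_def using eq k by simp
  also have "v.rtranspose (Y\<^sup>\<or>) \<dots> = (ev_arr Y \<lhd> V\<^sup>\<or>) \<bullet>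
      (((Y\<^sup>\<or> \<rhd> h) \<lhd> V\<^sup>\<or>) \<bullet> asc_inv (Y\<^sup>\<or>) V (V\<^sup>\<or>)) \<bullet> (Y\<^sup>\<or> \<rhd> db_arr V)"
    using h by (simp add: v.rtranspose_def comp_ten_ide)
  also have "((Y\<^sup>\<or> \<rhd> h) \<lhd> V\<^sup>\<or>) \<bullet> asc_inv (Y\<^sup>\<or>) V (V\<^sup>\<or>) =
      asc_inv (Y\<^sup>\<or>) Y (V\<^sup>\<or>) \<bullet> (Y\<^sup>\<or> \<rhd> (h \<lhd> V\<^sup>\<or>))"
    using h by (subst asc_inv_nat') simp_all
  finally have k_eq: "k = y.ev_at (V\<^sup>\<or>) \<bullet> (Y\<^sup>\<or> \<rhd> ?x)"
    using h by (simp add: y.ev_at_def ide_ten_comp)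
  have "(Y \<rhd> k) \<bullet> db_arr Y =
      (Y \<rhd> y.ev_at (V\<^sup>\<or>)) \<bullet> ((Y \<rhd> (Y\<^sup>\<or> \<rhd> ?x)) \<bullet> y.db_at \<one>)"
    unfolding k_eq using h by (simp add: ide_ten_comp y.db_at_unit)
  also have "(Y \<rhd> (Y\<^sup>\<or> \<rhd> ?x)) \<bullet> y.db_at \<one> = y.db_at (Y \<odot> V\<^sup>\<or>) \<bullet> ?x"
    using h by (intro y.db_at_natural[symmetric]) simp
  also have "(Y \<rhd> y.ev_at (V\<^sup>\<or>)) \<bullet> y.db_at (Y \<odot> V\<^sup>\<or>) \<bullet> ?x = ?x"
    using comp_prefix[OF y.ev_at_db_at, where h = ?x] h by simp
  finally show ?thesis .
qed

definition ev_nested_arr :: "'o \<Rightarrow> 'o \<Rightarrow> ('o, 'm) arrow" where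
  "ev_nested_arr V W = ev_arr W \<bullet> (W\<^sup>\<or> \<rhd> ((ev_arr V \<lhd> W) \<bullet> asc_inv (V\<^sup>\<or>) V W)) \<bullet>
     asc (W\<^sup>\<or>) (V\<^sup>\<or>) (V \<odot> W)"

lemma ev_nested_arr_typed [simp]:
  "arr (ev_nested_arr V W)" "src (ev_nested_arr V W) = (W\<^sup>\<or> \<odot> V\<^sup>\<or>) \<odot> (V \<odot> W)" "tgt (ev_nested_arr V W) = \<one>"
  by (simp_all add: ev_nested_arr_def)

lemma mor_ev_nested_arr: "mor (ev_nested_arr V W) = ev_nested C V W"
proof -
  have "ev_nested_arr V W = (ev_arr W \<bullet> (W\<^sup>\<or> \<rhd> ((ev_arr V \<lhd> W) \<bullet> asc_inv (V\<^sup>\<or>) V W))) \<bullet>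
     asc (W\<^sup>\<or>) (V\<^sup>\<or>) (V \<odot> W)"
    by (simp add: ev_nested_arr_def)
  then show ?thesis by (simp add: ev_nested_def del: comp_assoc)
qed

text \<open>
  The nested evaluation is the composite of two adjunctions: pairing with \<open>V \<odot> W\<close> means to transpose
  along \<open>V\<close> and then to pair with \<open>W\<close>. Hence \<open>W\<^sup>\<or> \<odot> V\<^sup>\<or>\<close> has the universal property of a dual of \<open>V \<odot> W\<close>,
  and \<open>dual_tensor\<close> is invertible.
\<close>
lemma ev_nested_arr_mate_transpose:
  assumes g: "g \<^bold>: Y \<rightarrow> W\<^sup>\<or> \<odot> V\<^sup>\<or>"
  shows "ev_nested_arr V W \<bullet> (g \<lhd> (V \<odot> W)) \<bullet> asc Y V W =
    ev_arr W \<bullet> (dual_pair.runtranspose C V (V\<^sup>\<or>) (ev_arr V) (W\<^sup>\<or>) g \<lhd> W)"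
proof -
  interpret v: dual_pair C V "V\<^sup>\<or>" "ev_arr V" "db_arr V" by (rule dual_pair_dual)
  have "ev_nested_arr V W \<bullet> (g \<lhd> (V \<odot> W)) \<bullet> asc Y V W =
      ev_nested_arr V W \<bullet> ((g \<boxtimes> (V \<rhd> ide W)) \<bullet> asc Y V W)" by simp
  also have "(g \<boxtimes> (V \<rhd> ide W)) \<bullet> asc Y V W = asc (W\<^sup>\<or> \<odot> V\<^sup>\<or>) V W \<bullet> ((g \<lhd> V) \<lhd> W)"
    using g by (subst asc_nat') simp_all
  also have "ev_nested_arr V W \<bullet> asc (W\<^sup>\<or> \<odot> V\<^sup>\<or>) V W \<bullet> ((g \<lhd> V) \<lhd> W) =
      ev_arr W \<bullet> (W\<^sup>\<or> \<rhd> (ev_arr V \<lhd> W)) \<bullet>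
      ((W\<^sup>\<or> \<rhd> asc_inv (V\<^sup>\<or>) V W) \<bullet> asc (W\<^sup>\<or>) (V\<^sup>\<or>) (V \<odot> W)) \<bullet>
      asc (W\<^sup>\<or> \<odot> V\<^sup>\<or>) V W \<bullet> ((g \<lhd> V) \<lhd> W)"
    using g by (simp add: ev_nested_arr_def ide_ten_comp)
  also have "\<dots> = ev_arr W \<bullet> ((W\<^sup>\<or> \<rhd> (ev_arr V \<lhd> W)) \<bullet> asc (W\<^sup>\<or>) (V\<^sup>\<or> \<odot> V) W) \<bullet>
      (asc (W\<^sup>\<or>) (V\<^sup>\<or>) V \<lhd> W) \<bullet> ((g \<lhd> V) \<lhd> W)"
    unfolding pentagon_asc_asc_inv using g by simp
  also have "(W\<^sup>\<or> \<rhd> (ev_arr V \<lhd> W)) \<bullet> asc (W\<^sup>\<or>) (V\<^sup>\<or> \<odot> V) W = (W\<^sup>\<or> \<rhd> ev_arr V) \<lhd> W"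
    by (subst asc_nat') simp_all
  finally show ?thesis using g by (simp add: v.runtranspose_def comp_ten_ide)
qed

lemma ev_nested_arr_mate_unique:
  assumes g: "g \<^bold>: Y \<rightarrow> W\<^sup>\<or> \<odot> V\<^sup>\<or>" and g': "g' \<^bold>: Y \<rightarrow> W\<^sup>\<or> \<odot> V\<^sup>\<or>"
    and eq: "ev_nested_arr V W \<bullet> (g \<lhd> (V \<odot> W)) = ev_nested_arr V W \<bullet> (g' \<lhd> (V \<odot> W))"
  shows "g = g'"
proof -
  interpret v: dual_pair C V "V\<^sup>\<or>" "ev_arr V" "db_arr V" by (rule dual_pair_dual)
  have "(ev_nested_arr V W \<bullet> (g \<lhd> (V \<odot> W))) \<bullet> asc Y V W = (ev_nested_arr V W \<bullet> (g' \<lhd> (V \<odot> W))) \<bullet> asc Y V W"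
    by (simp only: eq)
  then have "ev_arr W \<bullet> (v.runtranspose (W\<^sup>\<or>) g \<lhd> W) = ev_arr W \<bullet> (v.runtranspose (W\<^sup>\<or>) g' \<lhd> W)"
    using g g' by (simp add: ev_nested_arr_mate_transpose[OF g] ev_nested_arr_mate_transpose[OF g'])
  then have "v.runtranspose (W\<^sup>\<or>) g = v.runtranspose (W\<^sup>\<or>) g'"
    by (rule mate_unique[OF v.runtranspose_typed[OF g] v.runtranspose_typed[OF g']])
  then show ?thesis
    using v.rtranspose_runtranspose[OF g] v.rtranspose_runtranspose[OF g'] by metis
qed

lemma ev_nested_arr_mate_exists:
  assumes p: "p \<^bold>: Y \<odot> (V \<odot> W) \<rightarrow> \<one>"
  shows "\<exists>g. g \<^bold>: Y \<rightarrow> W\<^sup>\<or> \<odot> V\<^sup>\<or> \<and> ev_nested_arr V W \<bullet> (g \<lhd> (V \<odot> W)) = p"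
proof -
  interpret v: dual_pair C V "V\<^sup>\<or>" "ev_arr V" "db_arr V" by (rule dual_pair_dual)
  obtain h where h: "h \<^bold>: Y \<odot> V \<rightarrow> W\<^sup>\<or>" "ev_arr W \<bullet> (h \<lhd> W) = p \<bullet> asc Y V W"
    using mate_exists[of "p \<bullet> asc Y V W" "Y \<odot> V" W] p by auto
  define g where "g = v.rtranspose Y h"
  have g: "g \<^bold>: Y \<rightarrow> W\<^sup>\<or> \<odot> V\<^sup>\<or>" unfolding g_def by (rule v.rtranspose_typed[OF h(1)])
  have hg: "v.runtranspose (W\<^sup>\<or>) g = h" unfolding g_def by (rule v.runtranspose_rtranspose[OF h(1)])
  have "ev_nested_arr V W \<bullet> (g \<lhd> (V \<odot> W)) =
      (ev_nested_arr V W \<bullet> (g \<lhd> (V \<odot> W)) \<bullet> asc Y V W) \<bullet> asc_inv Y V W"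
    using g by simp
  also have "\<dots> = (p \<bullet> asc Y V W) \<bullet> asc_inv Y V W"
    unfolding ev_nested_arr_mate_transpose[OF g] hg h(2) ..
  finally show ?thesis using g p by auto
qed

definition dual_tensor_arr :: "'o \<Rightarrow> 'o \<Rightarrow> ('o, 'm) arrow" where
  "dual_tensor_arr V W = Arrow (W\<^sup>\<or> \<odot> V\<^sup>\<or>) (dual_tensor C V W) ((V \<odot> W)\<^sup>\<or>)"

lemma dual_tensor_arr_props: "dual_tensor_arr V W \<^bold>: W\<^sup>\<or> \<odot> V\<^sup>\<or> \<rightarrow> (V \<odot> W)\<^sup>\<or>"
  "ev_arr (V \<odot> W) \<bullet> (dual_tensor_arr V W \<lhd> (V \<odot> W)) = ev_nested_arr V W"
proof -
  obtain g where g: "g \<^bold>: W\<^sup>\<or> \<odot> V\<^sup>\<or> \<rightarrow> (V \<odot> W)\<^sup>\<or>" "ev_arr (V \<odot> W) \<bullet> (g \<lhd> (V \<odot> W)) = ev_nested_arr V W"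
    using mate_exists[of "ev_nested_arr V W" "W\<^sup>\<or> \<odot> V\<^sup>\<or>" "V \<odot> W"] by auto
  have "dual_tensor_arr V W = g"
    using the_mate[OF g] g by (intro arrow_eqI) (simp_all add: dual_tensor_arr_def dual_tensor_def mor_ev_nested_arr)
  then show "dual_tensor_arr V W \<^bold>: W\<^sup>\<or> \<odot> V\<^sup>\<or> \<rightarrow> (V \<odot> W)\<^sup>\<or>"
    "ev_arr (V \<odot> W) \<bullet> (dual_tensor_arr V W \<lhd> (V \<odot> W)) = ev_nested_arr V W"
    using g by simp_all
qed

lemma dual_tensor_arr_typed [simp]: "arr (dual_tensor_arr V W)" "src (dual_tensor_arr V W) = W\<^sup>\<or> \<odot> V\<^sup>\<or>" "tgt (dual_tensor_arr V W) = (V \<odot> W)\<^sup>\<or>"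
  "mor (dual_tensor_arr V W) = dual_tensor C V W"
  using dual_tensor_arr_props(1)[of V W] by (simp_all add: dual_tensor_arr_def)

lemma dual_tensor_arr_inverse_exists:
  "\<exists>s. s \<^bold>: (V \<odot> W)\<^sup>\<or> \<rightarrow> W\<^sup>\<or> \<odot> V\<^sup>\<or> \<and> s \<bullet> dual_tensor_arr V W = ide (W\<^sup>\<or> \<odot> V\<^sup>\<or>) \<and> dual_tensor_arr V W \<bullet> s = ide ((V \<odot> W)\<^sup>\<or>)"
proof -
  obtain s where s: "s \<^bold>: (V \<odot> W)\<^sup>\<or> \<rightarrow> W\<^sup>\<or> \<odot> V\<^sup>\<or>"
    and ps: "ev_nested_arr V W \<bullet> (s \<lhd> (V \<odot> W)) = ev_arr (V \<odot> W)"
    using ev_nested_arr_mate_exists[of "ev_arr (V \<odot> W)" "(V \<odot> W)\<^sup>\<or>" V W] by auto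
  have "ev_nested_arr V W \<bullet> ((s \<bullet> dual_tensor_arr V W) \<lhd> (V \<odot> W)) =
      (ev_nested_arr V W \<bullet> (s \<lhd> (V \<odot> W))) \<bullet> (dual_tensor_arr V W \<lhd> (V \<odot> W))"
    using s by (simp add: comp_ten_ide)
  also have "\<dots> = ev_nested_arr V W \<bullet> ((W\<^sup>\<or> \<odot> V\<^sup>\<or>) \<rhd> ide (V \<odot> W))"
    unfolding ps dual_tensor_arr_props(2) by simp
  finally have 1: "s \<bullet> dual_tensor_arr V W = ide (W\<^sup>\<or> \<odot> V\<^sup>\<or>)"
    by (rule ev_nested_arr_mate_unique[rotated 2]) (use s in simp_all)
  have "ev_arr (V \<odot> W) \<bullet> ((dual_tensor_arr V W \<bullet> s) \<lhd> (V \<odot> W)) =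
      (ev_arr (V \<odot> W) \<bullet> (dual_tensor_arr V W \<lhd> (V \<odot> W))) \<bullet> (s \<lhd> (V \<odot> W))"
    using s by (simp add: comp_ten_ide)
  also have "\<dots> = ev_arr (V \<odot> W) \<bullet> (((V \<odot> W)\<^sup>\<or>) \<rhd> ide (V \<odot> W))"
    unfolding ps dual_tensor_arr_props(2) by simp
  finally have 2: "dual_tensor_arr V W \<bullet> s = ide ((V \<odot> W)\<^sup>\<or>)"
    by (rule mate_unique[rotated 2]) (use s in simp_all)
  show ?thesis using s 1 2 by blast
qed

lemma inv_mor_dual_arr:
  assumes f: "f \<^bold>: V \<rightarrow> W" and s: "s \<^bold>: W \<rightarrow> V" and fs: "f \<bullet> s = ide W" "s \<bullet> f = ide V"
  shows "inv_mor C (W\<^sup>\<or>) (V\<^sup>\<or>) (dual_mor C V W (mor f)) = mor (dual_arr s)"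
    and "dual_arr f \<bullet> dual_arr s = ide (V\<^sup>\<or>)"
proof -
  have 1: "dual_arr f \<bullet> dual_arr s = ide (V\<^sup>\<or>)" using dual_arr_comp[OF f s] dual_arr_ide[of V] fs by simp
  have 2: "dual_arr s \<bullet> dual_arr f = ide (W\<^sup>\<or>)" using dual_arr_comp[OF s f] dual_arr_ide[of W] fs by simp
  have m: "mor (dual_arr f) = dual_mor C V W (mor f)" using f by (simp add: dual_arr_def)
  show "inv_mor C (W\<^sup>\<or>) (V\<^sup>\<or>) (dual_mor C V W (mor f)) = mor (dual_arr s)"
  proof (rule inv_mor_eqI)
    show "dual_mor C V W (mor f) \<in> hom C (W\<^sup>\<or>) (V\<^sup>\<or>)"
      using mor_hom[OF dual_arr_props(1)[OF f]] m by simp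
    show "is_inverse C (W\<^sup>\<or>) (V\<^sup>\<or>) (dual_mor C V W (mor f)) (mor (dual_arr s))"
      using mor_hom[OF dual_arr_props(1)[OF s]] arg_cong[OF 1, of mor] arg_cong[OF 2, of mor] m
      by (simp add: is_inverse_def)
  qed
  show "dual_arr f \<bullet> dual_arr s = ide (V\<^sup>\<or>)" by (rule 1)
qed

text \<open>
  For the unit the zigzag identity reduces to one of the equations; the other one follows because
  endomorphisms of the unit commute by the interchange law.
\<close>
lemma unit_duality: "ev_arr \<one> \<bullet> db_arr \<one> = ide \<one>" "db_arr \<one> \<bullet> ev_arr \<one> = ide \<one>"
proof -
  interpret v: dual_pair C \<one> "\<one>\<^sup>\<or>" "ev_arr \<one>" "db_arr \<one>" by (rule dual_pair_dual)
  show 1: "ev_arr \<one> \<bullet> db_arr \<one> = ide \<one>" using v.zigzag_V by simp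
  show "db_arr \<one> \<bullet> ev_arr \<one> = ide \<one>"
    using ten_swap[of "db_arr \<one>" \<one> \<one> "ev_arr \<one>" \<one> \<one>] 1 by simp
qed

lemma piv_arr_natural: "f \<^bold>: V \<rightarrow> W \<Longrightarrow> piv_arr W \<bullet> f = dual_arr (dual_arr f) \<bullet> piv_arr V"
  using piv_natural[of "mor f" V W] mor_hom[of f V W]
  by (intro arrow_eqI) (simp_all add: ddual_mor_def dual_arr_def)

text \<open>
  This says that \<open>j\<close> on \<open>V\<^sup>\<or>\<close> is inverse to the dual of \<open>j\<close> on \<open>V\<close>. Naturality of \<open>j\<close> along \<open>ev V\<close> expresses
  \<open>ev V\<close> through its double dual and \<open>j\<close> on \<open>V\<^sup>\<or> \<odot> V\<close>. Monoidality splits the latter into \<open>j \<otimes> j\<close> and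
  the structure maps of the double dual functor, and these structure maps identify the dual of an
  evaluation with a coevaluation (\<open>c1\<close>) and the dual of a coevaluation with an evaluation (\<open>c2\<close>); so
  the double dual of \<open>ev V\<close> is \<open>ev\<close> of \<open>V\<^sup>\<or>\<^sup>\<or>\<close>. The arrow \<open>?u\<close> accounts for the identification of \<open>\<one>\<^sup>\<or>\<close> with
  \<open>\<one>\<close>, which need not be the identity.
\<close>
lemma ev_arr_piv_arr_piv_arr: "ev_arr (V\<^sup>\<or>\<^sup>\<or>) \<bullet> (piv_arr (V\<^sup>\<or>) \<boxtimes> piv_arr V) = ev_arr V"
proof -
  interpret v: dual_pair C "V\<^sup>\<or>" "V\<^sup>\<or>\<^sup>\<or>" "ev_arr (V\<^sup>\<or>)" "db_arr (V\<^sup>\<or>)" by (rule dual_pair_dual)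
  let ?u = "db_arr \<one>" and ?t = "dual_tensor_arr (V\<^sup>\<or>) V" and ?t2 = "dual_tensor_arr (V\<^sup>\<or>) (V\<^sup>\<or>\<^sup>\<or>)"
  have u: "?u \<^bold>: \<one> \<rightarrow> \<one>" "ev_arr \<one> \<^bold>: \<one> \<rightarrow> \<one>" by simp_all
  obtain s where s: "s \<^bold>: (V\<^sup>\<or> \<odot> V)\<^sup>\<or> \<rightarrow> V\<^sup>\<or> \<odot> V\<^sup>\<or>\<^sup>\<or>" and st: "s \<bullet> ?t = ide (V\<^sup>\<or> \<odot> V\<^sup>\<or>\<^sup>\<or>)"
    "?t \<bullet> s = ide ((V\<^sup>\<or> \<odot> V)\<^sup>\<or>)"
    using dual_tensor_arr_inverse_exists[of "V\<^sup>\<or>" V] by blast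
  have jVV: "piv_arr (V\<^sup>\<or> \<odot> V) = (dual_arr s \<bullet> ?t2) \<bullet> (piv_arr (V\<^sup>\<or>) \<boxtimes> piv_arr V)"
    using inv_mor_dual_arr(1)[of ?t _ _ s] s st piv_tensor[of "V\<^sup>\<or>" V]
    by (intro arrow_eqI) (simp_all add: ddual_tensor_def del: comp_assoc)
  have j1: "piv_arr \<one> = dual_arr (ev_arr \<one>) \<bullet> ?u"
    using inv_mor_dual_arr(1)[of ?u \<one> \<one> "ev_arr \<one>"] u unit_duality piv_unit
    by (intro arrow_eqI) (simp_all add: ddual_unit_def)
  have uk: "dual_arr ?u \<bullet> dual_arr (ev_arr \<one>) = ide \<one>"
    using inv_mor_dual_arr(2)[of ?u \<one> \<one> "ev_arr \<one>"] u unit_duality by simp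
  have "dual_arr (ev_arr V) \<bullet> ?u = ?t \<bullet> db_arr (V\<^sup>\<or>)"
  proof (rule mate_unique[of _ \<one> "V\<^sup>\<or> \<odot> V"])
    have "ev_arr (V\<^sup>\<or> \<odot> V) \<bullet> ((dual_arr (ev_arr V) \<bullet> ?u) \<lhd> (V\<^sup>\<or> \<odot> V)) =
        (ev_arr (V\<^sup>\<or> \<odot> V) \<bullet> (dual_arr (ev_arr V) \<lhd> (V\<^sup>\<or> \<odot> V))) \<bullet> (?u \<lhd> (V\<^sup>\<or> \<odot> V))"
      by (simp add: comp_ten_ide)
    also have "\<dots> = ev_arr \<one> \<bullet> (ev_arr V \<bullet> (?u \<lhd> (V\<^sup>\<or> \<odot> V)))"
      using dual_arr_props(2)[of "ev_arr V" "V\<^sup>\<or> \<odot> V" \<one>] by simp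
    also have "ev_arr V \<bullet> (?u \<lhd> (V\<^sup>\<or> \<odot> V)) = ?u \<bullet> ev_arr V"
      using ten_swap[of ?u \<one> \<one> "ev_arr V" "V\<^sup>\<or> \<odot> V" \<one>] by simp
    also have "ev_arr \<one> \<bullet> ?u \<bullet> ev_arr V = ev_arr V"
      using comp_prefix[OF unit_duality(1), of "ev_arr V"] by simp
    finally have L: "ev_arr (V\<^sup>\<or> \<odot> V) \<bullet> ((dual_arr (ev_arr V) \<bullet> ?u) \<lhd> (V\<^sup>\<or> \<odot> V)) = ev_arr V" .
    have "ev_arr (V\<^sup>\<or> \<odot> V) \<bullet> ((?t \<bullet> db_arr (V\<^sup>\<or>)) \<lhd> (V\<^sup>\<or> \<odot> V)) =
        (ev_arr (V\<^sup>\<or> \<odot> V) \<bullet> (?t \<lhd> (V\<^sup>\<or> \<odot> V))) \<bullet> (db_arr (V\<^sup>\<or>) \<lhd> (V\<^sup>\<or> \<odot> V))"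
      by (simp add: comp_ten_ide)
    also have "\<dots> = ev_nested_arr (V\<^sup>\<or>) V \<bullet> (db_arr (V\<^sup>\<or>) \<lhd> (V\<^sup>\<or> \<odot> V))"
      by (simp add: dual_tensor_arr_props)
    also have "\<dots> = ev_arr V \<bullet> ((V\<^sup>\<or> \<rhd> v.ev_at V) \<bullet> v.db_at (V\<^sup>\<or> \<odot> V))"
      by (simp add: ev_nested_arr_def v.ev_at_def v.db_at_def)
    also have "\<dots> = ev_arr V" by (simp add: v.ev_at_db_at)
    finally show "ev_arr (V\<^sup>\<or> \<odot> V) \<bullet> ((dual_arr (ev_arr V) \<bullet> ?u) \<lhd> (V\<^sup>\<or> \<odot> V)) =
        ev_arr (V\<^sup>\<or> \<odot> V) \<bullet> ((?t \<bullet> db_arr (V\<^sup>\<or>)) \<lhd> (V\<^sup>\<or> \<odot> V))"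
      using L by simp
  qed simp_all
  then have "s \<bullet> (dual_arr (ev_arr V) \<bullet> ?u) = s \<bullet> ?t \<bullet> db_arr (V\<^sup>\<or>)" by simp
  also have "\<dots> = db_arr (V\<^sup>\<or>)" using comp_prefix[OF st(1), of "db_arr (V\<^sup>\<or>)"] s by simp
  finally have c1: "s \<bullet> dual_arr (ev_arr V) \<bullet> ?u = db_arr (V\<^sup>\<or>)" .
  have c2: "dual_arr (db_arr (V\<^sup>\<or>)) \<bullet> ?t2 = ?u \<bullet> ev_arr (V\<^sup>\<or>\<^sup>\<or>)"
  proof (rule mate_unique[of _ "V\<^sup>\<or>\<^sup>\<or>\<^sup>\<or> \<odot> V\<^sup>\<or>\<^sup>\<or>" \<one>])
    let ?P = "V\<^sup>\<or> \<odot> V\<^sup>\<or>\<^sup>\<or>" and ?Q = "V\<^sup>\<or>\<^sup>\<or>\<^sup>\<or> \<odot> V\<^sup>\<or>\<^sup>\<or>"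
    have "ev_arr \<one> \<bullet> ((dual_arr (db_arr (V\<^sup>\<or>)) \<bullet> ?t2) \<lhd> \<one>) =
        (ev_arr \<one> \<bullet> (dual_arr (db_arr (V\<^sup>\<or>)) \<lhd> \<one>)) \<bullet> ?t2"
      by simp
    also have "\<dots> = ev_arr ?P \<bullet> ((?P\<^sup>\<or> \<rhd> db_arr (V\<^sup>\<or>)) \<bullet> (?t2 \<lhd> \<one>))"
      using dual_arr_props(2)[of "db_arr (V\<^sup>\<or>)" \<one> ?P] by simp
    also have "(?P\<^sup>\<or> \<rhd> db_arr (V\<^sup>\<or>)) \<bullet> (?t2 \<lhd> \<one>) = (?t2 \<lhd> ?P) \<bullet> (?Q \<rhd> db_arr (V\<^sup>\<or>))"
      by (rule ten_swap[symmetric]) simp_all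
    also have "ev_arr ?P \<bullet> \<dots> = (ev_arr ?P \<bullet> (?t2 \<lhd> ?P)) \<bullet> (?Q \<rhd> db_arr (V\<^sup>\<or>))"
      by simp
    also have "ev_arr ?P \<bullet> (?t2 \<lhd> ?P) = ev_nested_arr (V\<^sup>\<or>) (V\<^sup>\<or>\<^sup>\<or>)" by (rule dual_tensor_arr_props)
    also have "ev_nested_arr (V\<^sup>\<or>) (V\<^sup>\<or>\<^sup>\<or>) \<bullet> (?Q \<rhd> db_arr (V\<^sup>\<or>)) =
        ev_arr (V\<^sup>\<or>\<^sup>\<or>) \<bullet> (V\<^sup>\<or>\<^sup>\<or>\<^sup>\<or> \<rhd> v.ev_at (V\<^sup>\<or>\<^sup>\<or>)) \<bullet>
        (asc (V\<^sup>\<or>\<^sup>\<or>\<^sup>\<or>) (V\<^sup>\<or>\<^sup>\<or>) ?P \<bullet> ((V\<^sup>\<or>\<^sup>\<or>\<^sup>\<or> \<rhd> ide (V\<^sup>\<or>\<^sup>\<or>)) \<boxtimes> db_arr (V\<^sup>\<or>)))"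
      by (simp add: ev_nested_arr_def v.ev_at_def)
    also have "asc (V\<^sup>\<or>\<^sup>\<or>\<^sup>\<or>) (V\<^sup>\<or>\<^sup>\<or>) ?P \<bullet> ((V\<^sup>\<or>\<^sup>\<or>\<^sup>\<or> \<rhd> ide (V\<^sup>\<or>\<^sup>\<or>)) \<boxtimes> db_arr (V\<^sup>\<or>)) =
        V\<^sup>\<or>\<^sup>\<or>\<^sup>\<or> \<rhd> (V\<^sup>\<or>\<^sup>\<or> \<rhd> db_arr (V\<^sup>\<or>))"
      by (subst asc_nat) simp_all
    also have "(V\<^sup>\<or>\<^sup>\<or>\<^sup>\<or> \<rhd> v.ev_at (V\<^sup>\<or>\<^sup>\<or>)) \<bullet> (V\<^sup>\<or>\<^sup>\<or>\<^sup>\<or> \<rhd> (V\<^sup>\<or>\<^sup>\<or> \<rhd> db_arr (V\<^sup>\<or>))) =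
        ide (V\<^sup>\<or>\<^sup>\<or>\<^sup>\<or> \<odot> V\<^sup>\<or>\<^sup>\<or>)"
      using v.ev_at_ten_db_at[of \<one>] by (simp add: ten_comp_ten v.db_at_unit)
    finally have L: "ev_arr \<one> \<bullet> ((dual_arr (db_arr (V\<^sup>\<or>)) \<bullet> ?t2) \<lhd> \<one>) = ev_arr (V\<^sup>\<or>\<^sup>\<or>)"
      by simp
    show "ev_arr \<one> \<bullet> ((dual_arr (db_arr (V\<^sup>\<or>)) \<bullet> ?t2) \<lhd> \<one>) = ev_arr \<one> \<bullet> ((?u \<bullet> ev_arr (V\<^sup>\<or>\<^sup>\<or>)) \<lhd> \<one>)"
      unfolding L using comp_prefix[OF unit_duality(1), of "ev_arr (V\<^sup>\<or>\<^sup>\<or>)"] by simp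
  qed simp_all
  let ?J = "piv_arr (V\<^sup>\<or>) \<boxtimes> piv_arr V"
  have "?u \<bullet> ev_arr V = (dual_arr ?u \<bullet> dual_arr (ev_arr \<one>)) \<bullet> ?u \<bullet> ev_arr V" by (simp add: uk)
  also have "\<dots> = dual_arr ?u \<bullet> (piv_arr \<one> \<bullet> ev_arr V)" by (simp add: j1)
  also have "piv_arr \<one> \<bullet> ev_arr V = dual_arr (dual_arr (ev_arr V)) \<bullet> piv_arr (V\<^sup>\<or> \<odot> V)" by (rule piv_arr_natural) simp
  also have "dual_arr ?u \<bullet> dual_arr (dual_arr (ev_arr V)) \<bullet> piv_arr (V\<^sup>\<or> \<odot> V) =
      ((dual_arr ?u \<bullet> dual_arr (dual_arr (ev_arr V))) \<bullet> dual_arr s) \<bullet> ?t2 \<bullet> ?J"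
    unfolding jVV using s by simp
  also have "dual_arr ?u \<bullet> dual_arr (dual_arr (ev_arr V)) = dual_arr (dual_arr (ev_arr V) \<bullet> ?u)"
    by (rule dual_arr_comp[symmetric]) simp_all
  also have "dual_arr (dual_arr (ev_arr V) \<bullet> ?u) \<bullet> dual_arr s = dual_arr (s \<bullet> dual_arr (ev_arr V) \<bullet> ?u)"
    using s by (intro dual_arr_comp[symmetric]) simp_all
  also have "dual_arr (s \<bullet> dual_arr (ev_arr V) \<bullet> ?u) \<bullet> ?t2 \<bullet> ?J = (dual_arr (db_arr (V\<^sup>\<or>)) \<bullet> ?t2) \<bullet> ?J"
    unfolding c1 by simp
  also have "\<dots> = ?u \<bullet> ev_arr (V\<^sup>\<or>\<^sup>\<or>) \<bullet> ?J" unfolding c2 by simp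
  finally have "ev_arr \<one> \<bullet> ?u \<bullet> ev_arr V = ev_arr \<one> \<bullet> ?u \<bullet> ev_arr (V\<^sup>\<or>\<^sup>\<or>) \<bullet> ?J" by simp
  then show ?thesis
    using comp_prefix[OF unit_duality(1), of "ev_arr V"]
      comp_prefix[OF unit_duality(1), of "ev_arr (V\<^sup>\<or>\<^sup>\<or>) \<bullet> ?J"] by simp
qed

end

section \<open>Reproducing families and duality\<close>

context semisimple_monoidal_category
begin

lemma Arrow_typed: "x \<in> hom C X Y \<longleftrightarrow> Arrow X x Y \<^bold>: X \<rightarrow> Y"
  by (simp add: arr_def)

lemma pow_arr_linear:
  assumes "\<And>j. j \<in> A \<Longrightarrow> x j \<in> hom C X Y"
  shows "mor (pow_arr V n (Arrow X (\<Sum>j\<in>A. scl C (c j) (x j)) Y)) =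
    (\<Sum>j\<in>A. scl C (c j) (mor (pow_arr V n (Arrow X (x j) Y))))"
proof (induction n)
  case (Suc n)
  have h: "mor (pow_arr V n (Arrow X (x j) Y)) \<in> hom C (pow_ob V n X) (pow_ob V n Y)" if "j \<in> A" for j
    using assms[OF that] by (intro mor_hom) (simp add: Arrow_typed)
  have "idm C V \<otimes> (\<Sum>j\<in>A. scl C (c j) (mor (pow_arr V n (Arrow X (x j) Y)))) =
      (\<Sum>j\<in>A. scl C (c j) (idm C V \<otimes> mor (pow_arr V n (Arrow X (x j) Y))))"
    by (subst tns_sum_right[OF idm_hom scl_hom[OF h]])
      (auto intro!: sum.cong tns_scl_right[OF idm_hom h])
  then show ?case using Suc.IH by simp
qed simp

end

context dual_pair
begin

text \<open>
  The nested duality turns functionals on \<open>D\<^sup>n\<close> into elements of \<open>V\<^sup>n\<close>, \<open>y \<mapsto> pow_arr V n y \<bullet> db_pow n \<one>\<close>, and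
  back; this lemma and the next one say that both are inverse to each other.
\<close>
lemma ev_pow_pow_arr_pow_arr_db_pow:
  assumes y: "y \<^bold>: pow_ob D n \<one> \<rightarrow> \<one>"
  shows "ev_pow n \<one> \<bullet> pow_arr D n (pow_arr V n y \<bullet> db_pow n \<one>) = y"
proof -
  have "ev_pow n \<one> \<bullet> pow_arr D n (pow_arr V n y \<bullet> db_pow n \<one>) = (ev_pow n \<one> \<bullet> pow_arr D n (pow_arr V n y)) \<bullet> pow_arr D n (db_pow n \<one>)"
    using y by (simp add: pow_arr_comp)
  also have "ev_pow n \<one> \<bullet> pow_arr D n (pow_arr V n y) = y \<bullet> ev_pow n (pow_ob D n \<one>)"
    by (rule ev_pow_natural[OF y])
  also have "(y \<bullet> ev_pow n (pow_ob D n \<one>)) \<bullet> pow_arr D n (db_pow n \<one>) = y \<bullet> (ev_pow n (pow_ob D n \<one>) \<bullet> pow_arr D n (db_pow n \<one>))"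
    using y by simp
  finally show ?thesis unfolding ev_pow_pow_arr_db_pow using y by simp
qed

lemma pow_arr_ev_pow_pow_arr_db_pow:
  assumes x: "x \<^bold>: \<one> \<rightarrow> pow_ob V n \<one>"
  shows "pow_arr V n (ev_pow n \<one> \<bullet> pow_arr D n x) \<bullet> db_pow n \<one> = x"
proof -
  have "pow_arr V n (ev_pow n \<one> \<bullet> pow_arr D n x) \<bullet> db_pow n \<one> = pow_arr V n (ev_pow n \<one>) \<bullet> (pow_arr V n (pow_arr D n x) \<bullet> db_pow n \<one>)"
    using x by (simp add: pow_arr_comp)
  also have "pow_arr V n (pow_arr D n x) \<bullet> db_pow n \<one> = db_pow n (pow_ob V n \<one>) \<bullet> x"
    by (rule db_pow_natural[OF x, symmetric])
  also have "pow_arr V n (ev_pow n \<one>) \<bullet> db_pow n (pow_ob V n \<one>) \<bullet> x = x"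
    using comp_prefix[OF ev_pow_db_pow[of n \<one>], of x] x by simp
  finally show ?thesis .
qed

text \<open>
  An element \<open>x\<close> of \<open>V\<^sup>n\<close> corresponds to a functional \<open>y\<close> on \<open>D\<^sup>n\<close>. Expanding \<open>y\<close> in the functionals \<open>b' j\<close>, with
  coefficients \<open>y \<bullet> a' j\<close>, and translating back expands \<open>x\<close> in the corresponding elements \<open>a j\<close>. The
  coefficients are \<open>b j \<bullet> x\<close> because \<open>x\<close> and \<open>a' j\<close> may be inserted in either order.
\<close>
lemma reproducing_transfer:
  assumes R: "reproducing (pow_ob D n \<one>) r (\<lambda>j. mor (a' j)) (\<lambda>j. mor (b' j))"
    and R': "coreproducing (pow_ob D n \<one>) r (\<lambda>j. mor (a' j)) (\<lambda>j. mor (b' j))"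
    and a': "\<And>j. j < r \<Longrightarrow> a' j \<^bold>: \<one> \<rightarrow> pow_ob D n \<one>" and b': "\<And>j. j < r \<Longrightarrow> b' j \<^bold>: pow_ob D n \<one> \<rightarrow> \<one>"
  shows "reproducing (pow_ob V n \<one>) r (\<lambda>j. mor (pow_arr V n (b' j) \<bullet> db_pow n \<one>))
    (\<lambda>j. mor (ev_pow n \<one> \<bullet> extend D n (a' j) (pow_ob V n \<one>)))"
proof -
  let ?P = "pow_ob V n \<one>" and ?P' = "pow_ob D n \<one>"
  define a where "a j = pow_arr V n (b' j) \<bullet> db_pow n \<one>" for j
  define b where "b j = ev_pow n \<one> \<bullet> extend D n (a' j) ?P" for j
  have a: "a j \<^bold>: \<one> \<rightarrow> ?P" and b: "b j \<^bold>: ?P \<rightarrow> \<one>" if "j < r" for j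
    using b'[OF that] extend_typed[OF a'[OF that], of ?P] by (simp_all add: a_def b_def)
  have "reproducing ?P r (\<lambda>j. mor (a j)) (\<lambda>j. mor (b j))"
    unfolding reproducing_def
  proof (intro conjI allI impI ballI)
    fix x assume x: "x \<in> hom C \<one> ?P"
    let ?x = "Arrow \<one> x ?P"
    have tx: "?x \<^bold>: \<one> \<rightarrow> ?P" using x Arrow_typed by blast
    define y where "y = ev_pow n \<one> \<bullet> pow_arr D n ?x"
    have y: "y \<^bold>: ?P' \<rightarrow> \<one>" using tx by (simp add: y_def)
    have bx: "b j \<bullet> ?x = y \<bullet> a' j" if j: "j < r" for j
    proof -
      have "b j \<bullet> ?x = ev_pow n \<one> \<bullet> (extend D n (a' j) ?P \<bullet> ?x)"
        using extend_typed[OF a'[OF j], of ?P] tx by (simp add: b_def)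
      also have "extend D n (a' j) ?P \<bullet> ?x = pow_arr D n ?x \<bullet> a' j"
        using extend_natural[OF a'[OF j] tx] extend_unit[OF a'[OF j]] by simp
      finally show ?thesis using tx a'[OF j] by (simp add: y_def)
    qed
    have "\<exists>c. j < r \<longrightarrow> mor (y \<bullet> a' j) = scl C c (idm C \<one>)" for j
    proof (cases "j < r")
      case True
      have "y \<bullet> a' j \<^bold>: \<one> \<rightarrow> \<one>" using y a'[OF True] by simp
      from unit_scalar[OF mor_hom[OF this]] show ?thesis by blast
    qed simp
    then obtain c where c: "\<And>j. j < r \<Longrightarrow> mor (y \<bullet> a' j) = scl C (c j) (idm C \<one>)" by metis
    have hb': "mor (b' j) \<in> hom C ?P' \<one>" if "j < r" for j using mor_hom[OF b'[OF that]] .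
    have "mor y = (\<Sum>j<r. (mor y \<cdot> mor (a' j)) \<cdot> mor (b' j))"
      using R' mor_hom[OF y] unfolding coreproducing_def by blast
    also have "\<dots> = (\<Sum>j<r. scl C (c j) (mor (b' j)))"
    proof (rule sum.cong[OF refl])
      fix j assume "j \<in> {..<r}"
      then have j: "j < r" by simp
      show "(mor y \<cdot> mor (a' j)) \<cdot> mor (b' j) = scl C (c j) (mor (b' j))"
        using c[OF j] cmp_scl_left[OF idm_hom hb'[OF j]] idm_left[OF hb'[OF j]] by simp
    qed
    finally have y_eq: "y = Arrow ?P' (\<Sum>j<r. scl C (c j) (mor (b' j))) \<one>"
      using y by (intro arrow_eqI) simp_all
    have b'_eq: "Arrow ?P' (mor (b' j)) \<one> = b' j" if "j < r" for j
      using b'[OF that] by (intro arrow_eqI) simp_all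
    have wy: "mor (pow_arr V n y) = (\<Sum>j<r. scl C (c j) (mor (pow_arr V n (b' j))))"
    proof -
      have "mor (pow_arr V n y) = (\<Sum>j<r. scl C (c j) (mor (pow_arr V n (Arrow ?P' (mor (b' j)) \<one>))))"
        unfolding y_eq by (rule pow_arr_linear) (simp add: hb')
      then show ?thesis by (simp add: b'_eq cong: sum.cong_simp)
    qed
    have w: "mor (pow_arr V n (b' j)) \<in> hom C (pow_ob V n ?P') ?P" if "j < r" for j
      using b'[OF that] by (intro mor_hom) simp
    have d: "mor (db_pow n \<one>) \<in> hom C \<one> (pow_ob V n ?P')" by (rule mor_hom) (rule db_pow_typed)
    have "pow_arr V n y \<bullet> db_pow n \<one> = ?x" unfolding y_def by (rule pow_arr_ev_pow_pow_arr_db_pow[OF tx])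
    then have "x = mor (pow_arr V n y) \<cdot> mor (db_pow n \<one>)" by (metis arrow.sel(2) mor_simps(1))
    also have "\<dots> = (\<Sum>j<r. scl C (c j) (mor (pow_arr V n (b' j))) \<cdot> mor (db_pow n \<one>))"
      unfolding wy by (rule cmp_sum_left[OF d]) (rule scl_hom[OF w], simp)
    also have "\<dots> = (\<Sum>j<r. mor (a j) \<cdot> (mor (b j) \<cdot> x))"
    proof (rule sum.cong[OF refl])
      fix j assume "j \<in> {..<r}"
      then have j: "j < r" by simp
      have "mor (b j) \<cdot> x = mor (b j \<bullet> ?x)" by simp
      also have "\<dots> = scl C (c j) (idm C \<one>)" unfolding bx[OF j] by (rule c[OF j])
      finally have "mor (a j) \<cdot> (mor (b j) \<cdot> x) = scl C (c j) (mor (a j))"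
        using cmp_scl_right[OF mor_hom[OF a[OF j]] idm_hom] idm_right[OF mor_hom[OF a[OF j]]] by simp
      then show "scl C (c j) (mor (pow_arr V n (b' j))) \<cdot> mor (db_pow n \<one>) = mor (a j) \<cdot> (mor (b j) \<cdot> x)"
        using cmp_scl_left[OF w[OF j] d] by (simp add: a_def)
    qed
    finally show "x = (\<Sum>j<r. mor (a j) \<cdot> (mor (b j) \<cdot> x))" .
  qed (use a b mor_hom in \<open>blast+\<close>)
  then show ?thesis unfolding a_def b_def .
qed

end

section \<open>Indicators and Frobenius-Schur endomorphisms\<close>

context semisimple_pivotal_category
begin

definition ptr_left_arr :: "'o \<Rightarrow> ('o, 'm) arrow \<Rightarrow> ('o, 'm) arrow" where
  "ptr_left_arr V f = ev_arr V \<bullet> (V\<^sup>\<or> \<rhd> (f \<bullet> piv_inv_arr V)) \<bullet> db_arr (V\<^sup>\<or>)"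

definition ptr_right_arr :: "'o \<Rightarrow> ('o, 'm) arrow \<Rightarrow> ('o, 'm) arrow" where
  "ptr_right_arr V f = ev_arr (V\<^sup>\<or>) \<bullet> ((piv_arr V \<bullet> f) \<lhd> V\<^sup>\<or>) \<bullet> db_arr V"

lemma mor_ptr_left_arr: "f \<^bold>: V \<rightarrow> V \<Longrightarrow> mor (ptr_left_arr V f) = ptr_left C V (mor f)"
proof -
  assume f: "f \<^bold>: V \<rightarrow> V"
  have "ptr_left_arr V f = (ev_arr V \<bullet> (V\<^sup>\<or> \<rhd> (f \<bullet> piv_inv_arr V))) \<bullet> db_arr (V\<^sup>\<or>)"
    using f by (simp add: ptr_left_arr_def)
  then show ?thesis by (simp add: ptr_left_def del: comp_assoc)
qed

lemma mor_ptr_right_arr: "f \<^bold>: V \<rightarrow> V \<Longrightarrow> mor (ptr_right_arr V f) = ptr_right C V (mor f)"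
proof -
  assume f: "f \<^bold>: V \<rightarrow> V"
  have "ptr_right_arr V f = (ev_arr (V\<^sup>\<or>) \<bullet> ((piv_arr V \<bullet> f) \<lhd> V\<^sup>\<or>)) \<bullet> db_arr V"
    using f by (simp add: ptr_right_arr_def)
  then show ?thesis by (simp add: ptr_right_def del: comp_assoc)
qed

text \<open>
  The strand carrying \<open>dual_arr F\<close> is pulled through the coevaluation by \<open>db_mate\<close>. The pivotal structure
  on the two sides matches by \<open>ev_arr_piv_arr_piv_arr\<close>.
\<close>
lemma ptr_left_dual:
  assumes F: "F \<^bold>: V \<rightarrow> V"
  shows "ptr_left_arr (V\<^sup>\<or>) (dual_arr F) = ptr_right_arr V F"
proof -
  let ?D = "V\<^sup>\<or>" and ?T = "V\<^sup>\<or>\<^sup>\<or>\<^sup>\<or>"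
  have j: "ev_arr V \<bullet> (piv_inv_arr ?D \<lhd> V) = ev_arr (V\<^sup>\<or>\<^sup>\<or>) \<bullet> (?T \<rhd> piv_arr V)"
  proof -
    have "ev_arr V \<bullet> (piv_inv_arr ?D \<lhd> V) = ev_arr (V\<^sup>\<or>\<^sup>\<or>) \<bullet> ((piv_arr ?D \<boxtimes> piv_arr V) \<bullet> (piv_inv_arr ?D \<lhd> V))"
      by (subst ev_arr_piv_arr_piv_arr[symmetric]) simp
    also have "(piv_arr ?D \<boxtimes> piv_arr V) \<bullet> (piv_inv_arr ?D \<lhd> V) = ?T \<rhd> piv_arr V"
      by (simp add: ten_comp_ten)
    finally show ?thesis .
  qed
  have "ev_arr V \<bullet> ((dual_arr F \<bullet> piv_inv_arr ?D) \<lhd> V) = (ev_arr V \<bullet> (dual_arr F \<lhd> V)) \<bullet> (piv_inv_arr ?D \<lhd> V)"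
    using F by (simp add: comp_ten_ide)
  also have "\<dots> = ev_arr V \<bullet> ((?D \<rhd> F) \<bullet> (piv_inv_arr ?D \<lhd> V))"
    using F dual_arr_props(2)[OF F] by simp
  also have "(?D \<rhd> F) \<bullet> (piv_inv_arr ?D \<lhd> V) = (piv_inv_arr ?D \<lhd> V) \<bullet> (?T \<rhd> F)"
    using F by (intro ten_swap[symmetric]) auto
  also have "ev_arr V \<bullet> (piv_inv_arr ?D \<lhd> V) \<bullet> (?T \<rhd> F) = (ev_arr V \<bullet> (piv_inv_arr ?D \<lhd> V)) \<bullet> (?T \<rhd> F)"
    using F by simp
  also have "\<dots> = ev_arr (V\<^sup>\<or>\<^sup>\<or>) \<bullet> (?T \<rhd> (piv_arr V \<bullet> F))"
    unfolding j using F by (simp add: ide_ten_comp)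
  finally have "(V\<^sup>\<or>\<^sup>\<or> \<rhd> (dual_arr F \<bullet> piv_inv_arr ?D)) \<bullet> db_arr (V\<^sup>\<or>\<^sup>\<or>) = ((piv_arr V \<bullet> F) \<lhd> ?D) \<bullet> db_arr V"
    by (intro db_mate) (use F in simp_all)
  then show ?thesis using F by (simp add: ptr_left_arr_def ptr_right_arr_def)
qed

definition A_arr :: "'o \<Rightarrow> 'o \<Rightarrow> ('o, 'm) arrow \<Rightarrow> ('o, 'm) arrow" where
  "A_arr V W f = (ev_arr V \<lhd> W) \<bullet> asc_inv (V\<^sup>\<or>) V W \<bullet> (V\<^sup>\<or> \<rhd> f)"

lemma A_arr_typed: "f \<^bold>: \<one> \<rightarrow> V \<odot> W \<Longrightarrow> A_arr V W f \<^bold>: V\<^sup>\<or> \<rightarrow> W"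
  by (simp add: A_arr_def)

lemma A_arr_eq_ev_at: "f \<^bold>: \<one> \<rightarrow> V \<odot> W \<Longrightarrow>
    A_arr V W f = dual_pair.ev_at C V (V\<^sup>\<or>) (ev_arr V) W \<bullet> (V\<^sup>\<or> \<rhd> f)"
  by (simp add: A_arr_def dual_pair.ev_at_def[OF dual_pair_dual])

lemma mor_A_arr: "f \<^bold>: \<one> \<rightarrow> V \<odot> W \<Longrightarrow> mor (A_arr V W f) = A_map C V W (mor f)"
proof -
  assume f: "f \<^bold>: \<one> \<rightarrow> V \<odot> W"
  have "A_arr V W f = ((ev_arr V \<lhd> W) \<bullet> asc_inv (V\<^sup>\<or>) V W) \<bullet> (V\<^sup>\<or> \<rhd> f)"
    using f by (simp add: A_arr_def)
  then show ?thesis by (simp add: A_map_def del: comp_assoc)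
qed

lemma A_arr_inject:
  assumes y: "y \<^bold>: \<one> \<rightarrow> V \<odot> W" and y': "y' \<^bold>: \<one> \<rightarrow> V \<odot> W" and eq: "A_arr V W y = A_arr V W y'"
  shows "y = y'"
proof -
  interpret v: dual_pair C V "V\<^sup>\<or>" "ev_arr V" "db_arr V" by (rule dual_pair_dual)
  have *: "(V \<rhd> A_arr V W z) \<bullet> db_arr V = z" if z: "z \<^bold>: \<one> \<rightarrow> V \<odot> W" for z
  proof -
    have "(V \<rhd> A_arr V W z) \<bullet> db_arr V = (V \<rhd> v.ev_at W) \<bullet> ((V \<rhd> (V\<^sup>\<or> \<rhd> z)) \<bullet> v.db_at \<one>)"
      unfolding A_arr_eq_ev_at[OF z] using z by (simp add: ide_ten_comp v.db_at_unit)
    also have "(V \<rhd> (V\<^sup>\<or> \<rhd> z)) \<bullet> v.db_at \<one> = v.db_at (V \<odot> W) \<bullet> z"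
      by (rule v.db_at_natural[OF z, symmetric])
    also have "(V \<rhd> v.ev_at W) \<bullet> v.db_at (V \<odot> W) \<bullet> z = z"
      using comp_prefix[OF v.ev_at_db_at, where h = z] z by simp
    finally show ?thesis .
  qed
  show ?thesis using *[OF y] *[OF y'] eq by metis
qed

text \<open>
  Since \<open>A\<close> is injective, this computes its inverse on the values of \<open>T_map\<close>: the morphism \<open>dual_arr h\<close> is
  removed in favour of \<open>h\<close> by sliding it around the duality of \<open>V\<^sup>\<or>\<close>.
\<close>
lemma A_arr_ten_db_arr:
  assumes h: "h \<^bold>: V\<^sup>\<or> \<rightarrow> W"
  shows "A_arr W V ((h \<boxtimes> piv_inv_arr V) \<bullet> db_arr (V\<^sup>\<or>)) = piv_inv_arr V \<bullet> dual_arr h"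
proof -
  let ?D = "V\<^sup>\<or>" and ?E = "V\<^sup>\<or>\<^sup>\<or>" and ?W = "W\<^sup>\<or>"
  interpret v: dual_pair C ?D ?E "ev_arr ?D" "db_arr ?D" by (rule dual_pair_dual)
  have "A_arr W V ((h \<boxtimes> piv_inv_arr V) \<bullet> db_arr ?D) =
      (ev_arr W \<lhd> V) \<bullet> (asc_inv ?W W V \<bullet> (?W \<rhd> (h \<boxtimes> piv_inv_arr V))) \<bullet> (?W \<rhd> db_arr ?D)"
    using h by (simp add: A_arr_def ide_ten_comp)
  also have "asc_inv ?W W V \<bullet> (?W \<rhd> (h \<boxtimes> piv_inv_arr V)) = ((?W \<rhd> h) \<boxtimes> piv_inv_arr V) \<bullet> asc_inv ?W ?D ?E"
    using h by (subst asc_inv_nat) simp_all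
  also have "(ev_arr W \<lhd> V) \<bullet> (((?W \<rhd> h) \<boxtimes> piv_inv_arr V) \<bullet> asc_inv ?W ?D ?E) \<bullet> (?W \<rhd> db_arr ?D) =
      ((ev_arr W \<lhd> V) \<bullet> ((?W \<rhd> h) \<boxtimes> piv_inv_arr V)) \<bullet> asc_inv ?W ?D ?E \<bullet> (?W \<rhd> db_arr ?D)"
    using h by simp
  also have "(ev_arr W \<lhd> V) \<bullet> ((?W \<rhd> h) \<boxtimes> piv_inv_arr V) = (ev_arr ?D \<bullet> (dual_arr h \<lhd> ?D)) \<boxtimes> piv_inv_arr V"
    using h dual_arr_props(2)[OF h] by (simp add: ten_comp_ten)
  also have "\<dots> = piv_inv_arr V \<bullet> (ev_arr ?D \<lhd> ?E) \<bullet> ((dual_arr h \<lhd> ?D) \<lhd> ?E)"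
    using h ten_split(2)[of "ev_arr ?D \<bullet> (dual_arr h \<lhd> ?D)" "?W \<odot> ?D" \<one> "piv_inv_arr V" ?E V]
    by (simp add: comp_ten_ide)
  also have "(piv_inv_arr V \<bullet> (ev_arr ?D \<lhd> ?E) \<bullet> ((dual_arr h \<lhd> ?D) \<lhd> ?E)) \<bullet> asc_inv ?W ?D ?E \<bullet> (?W \<rhd> db_arr ?D) =
      piv_inv_arr V \<bullet> (ev_arr ?D \<lhd> ?E) \<bullet> (((dual_arr h \<lhd> ?D) \<lhd> ?E) \<bullet> asc_inv ?W ?D ?E) \<bullet> (?W \<rhd> db_arr ?D)"
    using h by simp
  also have "((dual_arr h \<lhd> ?D) \<lhd> ?E) \<bullet> asc_inv ?W ?D ?E = asc_inv ?E ?D ?E \<bullet> (dual_arr h \<boxtimes> (?D \<rhd> ide ?E))"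
    using h by (subst asc_inv_nat') simp_all
  also have "piv_inv_arr V \<bullet> (ev_arr ?D \<lhd> ?E) \<bullet> (asc_inv ?E ?D ?E \<bullet> (dual_arr h \<boxtimes> (?D \<rhd> ide ?E))) \<bullet> (?W \<rhd> db_arr ?D) =
      piv_inv_arr V \<bullet> (ev_arr ?D \<lhd> ?E) \<bullet> asc_inv ?E ?D ?E \<bullet> ((dual_arr h \<lhd> (?D \<odot> ?E)) \<bullet> (?W \<rhd> db_arr ?D))"
    using h by simp
  also have "(dual_arr h \<lhd> (?D \<odot> ?E)) \<bullet> (?W \<rhd> db_arr ?D) = (?E \<rhd> db_arr ?D) \<bullet> dual_arr h"
    using h ten_swap[of "dual_arr h" ?W ?E "db_arr ?D" \<one> "?D \<odot> ?E"] by simp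
  also have "piv_inv_arr V \<bullet> (ev_arr ?D \<lhd> ?E) \<bullet> asc_inv ?E ?D ?E \<bullet> (?E \<rhd> db_arr ?D) \<bullet> dual_arr h =
      piv_inv_arr V \<bullet> ((ev_arr ?D \<lhd> ?E) \<bullet> asc_inv ?E ?D ?E \<bullet> (?E \<rhd> db_arr ?D)) \<bullet> dual_arr h"
    using h by simp
  finally show ?thesis unfolding v.zigzag_D using h by simp
qed

lemma E_map_eq:
  assumes f: "f \<^bold>: \<one> \<rightarrow> V \<odot> W"
  shows "E_map C V W (mor f) = mor ((A_arr V W f \<boxtimes> piv_inv_arr V) \<bullet> db_arr (V\<^sup>\<or>))"
proof -
  let ?x = "(A_arr V W f \<boxtimes> piv_inv_arr V) \<bullet> db_arr (V\<^sup>\<or>)"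
  note t = A_arr_typed[OF f]
  have x: "?x \<^bold>: \<one> \<rightarrow> W \<odot> V" using t by simp
  have inj: "inj_on (A_map C W V) (hom C \<one> (W \<odot> V))"
  proof (rule inj_onI)
    fix y y' assume y: "y \<in> hom C \<one> (W \<odot> V)" "y' \<in> hom C \<one> (W \<odot> V)" "A_map C W V y = A_map C W V y'"
    let ?y = "Arrow \<one> y (W \<odot> V)" and ?y' = "Arrow \<one> y' (W \<odot> V)"
    have ty: "?y \<^bold>: \<one> \<rightarrow> W \<odot> V" "?y' \<^bold>: \<one> \<rightarrow> W \<odot> V" using y Arrow_typed by blast+
    have "A_arr W V ?y = A_arr W V ?y'"
      using A_arr_typed[OF ty(1)] A_arr_typed[OF ty(2)] mor_A_arr[OF ty(1)] mor_A_arr[OF ty(2)] y(3)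
      by (intro arrow_eqI) simp_all
    then have "?y = ?y'" by (rule A_arr_inject[OF ty])
    then show "y = y'" by simp
  qed
  have "A_map C W V (mor ?x) = mor (A_arr W V ?x)" using mor_A_arr[OF x] by simp
  also have "\<dots> = mor (piv_inv_arr V \<bullet> dual_arr (A_arr V W f))" using A_arr_ten_db_arr[of "A_arr V W f" V W] t by simp
  also have "\<dots> = T_map C V W (A_map C V W (mor f))"
    using t mor_A_arr[OF f] by (simp add: T_map_def dual_arr_def)
  finally show ?thesis
    unfolding E_map_def by (intro the_inv_into_f_eq inj mor_hom x)
qed

definition E_arr :: "'o \<Rightarrow> nat \<Rightarrow> ('o, 'm) arrow \<Rightarrow> ('o, 'm) arrow" where
  "E_arr V m f = strength V m \<one> V \<bullet> (A_arr V (pow_ob V m \<one>) f \<boxtimes> piv_inv_arr V) \<bullet> db_arr (V\<^sup>\<or>)"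

lemma E_arr_typed: "f \<^bold>: \<one> \<rightarrow> pow_ob V (Suc m) \<one> \<Longrightarrow> E_arr V m f \<^bold>: \<one> \<rightarrow> pow_ob V (Suc m) \<one>"
  using A_arr_typed[of f V "pow_ob V m \<one>"] pow_ob_shift[of V m \<one>] by (simp add: E_arr_def)

lemma E_pow_eq:
  assumes f: "f \<^bold>: \<one> \<rightarrow> pow_ob V (Suc m) \<one>"
  shows "E_pow C (Suc m) V (mor f) = mor (E_arr V m f)"
  using E_map_eq[of f V "pow_ob V m \<one>"] f
  by (simp add: E_pow_def E_arr_def tpow_eq_pow_ob mor_strength)

text \<open>
  With \<open>c\<close> denoting \<open>g\<close> rebracketed to \<open>V\<^sup>m \<odot> V\<close>, evaluating \<open>V\<^sup>\<or>\<close> against the outgoing strand of \<open>fs_summand\<close>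
  bends that strand of \<open>f\<close>: it gives \<open>c \<bullet> (A f \<otimes> V)\<close>. Closing up with \<open>j\<^sup>-\<^sup>1\<close> and the coevaluation gives
  the left pivotal trace on one side and \<open>c \<bullet> (A f \<otimes> j\<^sup>-\<^sup>1) \<bullet> db\<close> on the other.
\<close>
lemma comp_E_arr:
  assumes f: "f \<^bold>: \<one> \<rightarrow> pow_ob V (Suc m) \<one>" and g: "g \<^bold>: pow_ob V (Suc m) \<one> \<rightarrow> \<one>"
  shows "g \<bullet> E_arr V m f = ptr_left_arr V (fs_summand V (Suc m) f g)"
proof -
  interpret v: dual_pair C V "V\<^sup>\<or>" "ev_arr V" "db_arr V" by (rule dual_pair_dual)
  let ?W = "pow_ob V m \<one>" and ?D = "V\<^sup>\<or>" and ?F = "fs_summand V (Suc m) f g"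
  have f': "f \<^bold>: \<one> \<rightarrow> V \<odot> ?W" and g': "g \<^bold>: V \<odot> ?W \<rightarrow> \<one>" using f g by simp_all
  note A = A_arr_typed[OF f']
  have pV: "pow_ob V m V = V \<odot> ?W" using pow_ob_shift[of V m \<one>] by simp
  define c where "c = g \<bullet> strength V m \<one> V"
  have c: "c \<^bold>: ?W \<odot> V \<rightarrow> \<one>" using g' by (simp add: c_def pV)
  have F: "?F = (V \<rhd> c) \<bullet> asc V ?W V \<bullet> (f \<lhd> V)"
    using f' g' by (simp add: fs_summand_def extend_def c_def ide_ten_comp pV)
  have "ev_arr V \<bullet> (?D \<rhd> ?F) = (v.ev_at \<one> \<bullet> (?D \<rhd> (V \<rhd> c))) \<bullet>
      (?D \<rhd> asc V ?W V) \<bullet> (?D \<rhd> (f \<lhd> V))"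
    unfolding F using f' c by (simp add: ide_ten_comp v.ev_at_unit)
  also have "v.ev_at \<one> \<bullet> (?D \<rhd> (V \<rhd> c)) = c \<bullet> v.ev_at (?W \<odot> V)"
    by (rule v.ev_at_natural[OF c])
  also have "(c \<bullet> v.ev_at (?W \<odot> V)) \<bullet> (?D \<rhd> asc V ?W V) \<bullet> (?D \<rhd> (f \<lhd> V)) =
      c \<bullet> v.ev_at (?W \<odot> V) \<bullet> (?D \<rhd> asc V ?W V) \<bullet> ((?D \<rhd> (f \<lhd> V)) \<bullet> asc ?D \<one> V)"
    using f' c by simp
  also have "(?D \<rhd> (f \<lhd> V)) \<bullet> asc ?D \<one> V = asc ?D (V \<odot> ?W) V \<bullet> ((?D \<rhd> f) \<lhd> V)"
    using f' by (subst asc_nat') simp_all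
  also have "c \<bullet> v.ev_at (?W \<odot> V) \<bullet> (?D \<rhd> asc V ?W V) \<bullet> asc ?D (V \<odot> ?W) V \<bullet> ((?D \<rhd> f) \<lhd> V) =
      c \<bullet> (A_arr V ?W f \<lhd> V)"
    unfolding A_arr_eq_ev_at[OF f'] using f' c by (simp add: comp_ten_ide v.ev_at_ten)
  finally have eF: "ev_arr V \<bullet> (?D \<rhd> ?F) = c \<bullet> (A_arr V ?W f \<lhd> V)" .
  note tF = fs_summand_typed[OF f g]
  have "ptr_left_arr V ?F = (ev_arr V \<bullet> (?D \<rhd> ?F)) \<bullet> (?D \<rhd> piv_inv_arr V) \<bullet> db_arr ?D"
    using tF by (simp add: ptr_left_arr_def ide_ten_comp)
  also have "\<dots> = c \<bullet> ((A_arr V ?W f \<lhd> V) \<bullet> (?D \<rhd> piv_inv_arr V)) \<bullet> db_arr ?D"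
    unfolding eF using A c by simp
  also have "(A_arr V ?W f \<lhd> V) \<bullet> (?D \<rhd> piv_inv_arr V) = A_arr V ?W f \<boxtimes> piv_inv_arr V"
    using A by (simp add: ten_comp_ten)
  also have "c \<bullet> \<dots> \<bullet> db_arr ?D = g \<bullet> E_arr V m f"
    using A g' by (simp add: c_def E_arr_def pV)
  finally show ?thesis by simp
qed

text \<open>
  The same expression on ambient morphisms, where sums can be formed.
\<close>
definition fs_summand_mor :: "'o \<Rightarrow> nat \<Rightarrow> 'm \<Rightarrow> 'm \<Rightarrow> 'm" where
  "fs_summand_mor V n f g = mor (fs_summand V n (Arrow \<one> f (pow_ob V n \<one>)) (Arrow (pow_ob V n \<one>) g \<one>))"

lemma fs_summand_mor_hom: "f \<in> hom C \<one> (pow_ob V n \<one>) \<Longrightarrow> g \<in> hom C (pow_ob V n \<one>) \<one> \<Longrightarrow> fs_summand_mor V n f g \<in> hom C V V"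
  unfolding fs_summand_mor_def by (intro mor_hom fs_summand_typed) (simp_all only: Arrow_typed)

lemma indicator_eq_sum:
  assumes R: "reproducing (pow_ob V (Suc m) \<one>) r f g"
  shows "scl C (fs_indicator C (Suc m) V) (idm C \<one>) = (\<Sum>j<r. ptr_left C V (fs_summand_mor V (Suc m) (f j) (g j)))"
proof -
  let ?n = "Suc m" let ?P = "pow_ob V ?n \<one>" and ?W = "pow_ob V m \<one>" and ?D = "V\<^sup>\<or>"
  have ar: "Arrow \<one> x ?P \<^bold>: \<one> \<rightarrow> ?P" if "x \<in> hom C \<one> ?P" for x using that Arrow_typed by blast
  have E: "E_pow C ?n V x = mor (E_arr V m (Arrow \<one> x ?P))" if "x \<in> hom C \<one> ?P" for x
    using E_pow_eq[OF ar[OF that]] by simp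
  have hE: "E_pow C ?n V x \<in> hom C \<one> ?P" if "x \<in> hom C \<one> ?P" for x
    using mor_hom[OF E_arr_typed[OF ar[OF that]]] E[OF that] by simp
  \<comment> \<open>linearity of \<open>E_pow\<close> in its argument, from the explicit formula\<close>
  let ?Q = "mor ((ev_arr V \<lhd> ?W) \<bullet> asc_inv ?D V ?W)" and ?S = "mor (strength V m \<one> V)"
  have Q: "?Q \<in> hom C (?D \<odot> V \<odot> ?W) ?W" by (rule mor_hom) simp
  have S: "?S \<in> hom C (?W \<odot> V) ?P" by (rule mor_hom) (use pow_ob_shift[of V m \<one>] in simp)
  have piv_inv_arr: "piv_inv C V \<in> hom C (?D\<^sup>\<or>) V" using mor_hom[of "piv_inv_arr V"] by simp
  have db: "db C ?D \<in> hom C \<one> (?D \<odot> ?D\<^sup>\<or>)" using mor_hom[of "db_arr ?D"] by simp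
  have E': "E_pow C ?n V x = ?S \<cdot> (((?Q \<cdot> (idm C ?D \<otimes> x)) \<otimes> piv_inv C V) \<cdot> db C ?D)"
    if x: "x \<in> hom C \<one> ?P" for x
  proof -
    have "A_arr V ?W (Arrow \<one> x ?P) = ((ev_arr V \<lhd> ?W) \<bullet> asc_inv ?D V ?W) \<bullet> (?D \<rhd> Arrow \<one> x ?P)"
      using ar[OF x] by (simp add: A_arr_def)
    then show ?thesis unfolding E[OF x] E_arr_def by (simp del: comp_assoc)
  qed
  have h1: "idm C ?D \<otimes> x \<in> hom C ?D (?D \<odot> V \<odot> ?W)" if "x \<in> hom C \<one> ?P" for x
    using tns_hom[OF idm_hom[of ?D] that] by simp
  have h2: "(?Q \<cdot> (idm C ?D \<otimes> x)) \<otimes> piv_inv C V \<in> hom C (?D \<odot> ?D\<^sup>\<or>) (?W \<odot> V)"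
    if "x \<in> hom C \<one> ?P" for x
    by (rule tns_hom[OF cmp_hom[OF Q h1[OF that]] piv_inv_arr])
  have add: "E_pow C ?n V (x + y) = E_pow C ?n V x + E_pow C ?n V y"
    if x: "x \<in> hom C \<one> ?P" and y: "y \<in> hom C \<one> ?P" for x y
    unfolding E'[OF x] E'[OF y] E'[OF add_hom[OF x y]] tns_add_right[OF idm_hom x y]
      cmp_add_right[OF Q h1[OF x] h1[OF y]]
      tns_add_left[OF cmp_hom[OF Q h1[OF x]] cmp_hom[OF Q h1[OF y]] piv_inv_arr]
      cmp_add_left[OF h2[OF x] h2[OF y] db]
      cmp_add_right[OF S cmp_hom[OF h2[OF x] db] cmp_hom[OF h2[OF y] db]] ..
  have scale: "E_pow C ?n V (scl C c x) = scl C c (E_pow C ?n V x)" if x: "x \<in> hom C \<one> ?P" for c x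
    unfolding E'[OF x] E'[OF scl_hom[OF x]] tns_scl_right[OF idm_hom x]
      cmp_scl_right[OF Q h1[OF x]] tns_scl_left[OF cmp_hom[OF Q h1[OF x]] piv_inv_arr]
      cmp_scl_left[OF h2[OF x] db] cmp_scl_right[OF S cmp_hom[OF h2[OF x] db]] ..
  have "scl C (fs_indicator C ?n V) (idm C \<one>) = (\<Sum>j<r. g j \<cdot> E_pow C ?n V (f j))"
    unfolding fs_indicator_def tpow_eq_pow_ob
    by (rule trace_on_reproducing[OF R], erule hE, erule (1) add, erule scale)
  also have "\<dots> = (\<Sum>j<r. ptr_left C V (fs_summand_mor V ?n (f j) (g j)))"
  proof (rule sum.cong[OF refl])
    fix j assume "j \<in> {..<r}"
    then have fg: "f j \<in> hom C \<one> ?P" "g j \<in> hom C ?P \<one>" using R by (auto simp: reproducing_def)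
    let ?f = "Arrow \<one> (f j) ?P" and ?g = "Arrow ?P (g j) \<one>"
    have t: "?f \<^bold>: \<one> \<rightarrow> ?P" "?g \<^bold>: ?P \<rightarrow> \<one>" using fg Arrow_typed by blast+
    have "g j \<cdot> E_pow C ?n V (f j) = mor (?g \<bullet> E_arr V m ?f)" using E[OF fg(1)] by simp
    also have "\<dots> = mor (ptr_left_arr V (fs_summand V ?n ?f ?g))" unfolding comp_E_arr[OF t] ..
    also have "\<dots> = ptr_left C V (fs_summand_mor V ?n (f j) (g j))"
      unfolding mor_ptr_left_arr[OF fs_summand_typed[OF t]] fs_summand_mor_def ..
    finally show "g j \<cdot> E_pow C ?n V (f j) = ptr_left C V (fs_summand_mor V ?n (f j) (g j))" .
  qed
  finally show ?thesis .
qed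

lemma fs_summand_mor_eq: "fs_summand_mor V n f g = (idm C V \<otimes> g) \<cdot> (mor (strength V n \<one> V) \<cdot> (f \<otimes> idm C V))"
  by (simp add: fs_summand_mor_def fs_summand_def extend_def)

lemma fs_summand_mor_linear:
  fixes V n defines "P \<equiv> pow_ob V n \<one>"
  assumes f: "\<And>j. j \<in> A \<Longrightarrow> f j \<in> hom C \<one> P" and g: "\<And>j. j \<in> A \<Longrightarrow> g j \<in> hom C P \<one>"
  shows "g' \<in> hom C P \<one> \<Longrightarrow> fs_summand_mor V n (\<Sum>j\<in>A. f j) g' = (\<Sum>j\<in>A. fs_summand_mor V n (f j) g')"
    and "f' \<in> hom C \<one> P \<Longrightarrow> fs_summand_mor V n f' (\<Sum>j\<in>A. g j) = (\<Sum>j\<in>A. fs_summand_mor V n f' (g j))"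
proof -
  let ?S = "mor (strength V n \<one> V)"
  have S: "?S \<in> hom C (P \<odot> V) (V \<odot> P)" unfolding P_def
    by (rule mor_hom) (use pow_ob_shift[of V n \<one>] in simp)
  have hf: "x \<otimes> idm C V \<in> hom C V (P \<odot> V)" if "x \<in> hom C \<one> P" for x
    using tns_hom[OF that idm_hom[of V]] by simp
  have hg: "idm C V \<otimes> x \<in> hom C (V \<odot> P) V" if "x \<in> hom C P \<one>" for x
    using tns_hom[OF idm_hom[of V] that] by simp
  show "fs_summand_mor V n (\<Sum>j\<in>A. f j) g' = (\<Sum>j\<in>A. fs_summand_mor V n (f j) g')" if g': "g' \<in> hom C P \<one>"
  proof -
    have "fs_summand_mor V n (\<Sum>j\<in>A. f j) g' = (idm C V \<otimes> g') \<cdot> (?S \<cdot> (\<Sum>j\<in>A. f j \<otimes> idm C V))"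
      unfolding fs_summand_mor_eq using tns_sum_left[where A = A and f = f, OF idm_hom f] by simp
    also have "?S \<cdot> (\<Sum>j\<in>A. f j \<otimes> idm C V) = (\<Sum>j\<in>A. ?S \<cdot> (f j \<otimes> idm C V))"
      by (rule cmp_sum_right[OF S]) (auto intro: hf f)
    also have "(idm C V \<otimes> g') \<cdot> \<dots> = (\<Sum>j\<in>A. fs_summand_mor V n (f j) g')"
      unfolding fs_summand_mor_eq by (rule cmp_sum_right[OF hg[OF g']]) (auto intro!: cmp_hom[OF S] hf f)
    finally show ?thesis .
  qed
  show "fs_summand_mor V n f' (\<Sum>j\<in>A. g j) = (\<Sum>j\<in>A. fs_summand_mor V n f' (g j))" if f': "f' \<in> hom C \<one> P"
  proof -
    have "fs_summand_mor V n f' (\<Sum>j\<in>A. g j) = (\<Sum>j\<in>A. idm C V \<otimes> g j) \<cdot> (?S \<cdot> (f' \<otimes> idm C V))"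
      unfolding fs_summand_mor_eq using tns_sum_right[where A = A and f = g, OF idm_hom g] by simp
    also have "\<dots> = (\<Sum>j\<in>A. fs_summand_mor V n f' (g j))"
      unfolding fs_summand_mor_eq by (rule cmp_sum_left[OF cmp_hom[OF S hf[OF f']]]) (auto intro: hg g)
    finally show ?thesis .
  qed
qed

lemma fs_summand_mor_balanced:
  assumes f: "f \<in> hom C \<one> (pow_ob V n \<one>)" and g: "g \<in> hom C (pow_ob V n \<one>) \<one>" and x: "x \<in> hom C \<one> \<one>"
  shows "fs_summand_mor V n (f \<cdot> x) g = fs_summand_mor V n f (x \<cdot> g)"
proof -
  let ?P = "pow_ob V n \<one>" and ?S = "mor (strength V n \<one> V)"
  obtain c where c: "x = scl C c (idm C \<one>)" using unit_scalar[OF x] by blast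
  have S: "?S \<in> hom C (?P \<odot> V) (V \<odot> ?P)"
    by (rule mor_hom) (use pow_ob_shift[of V n \<one>] in simp)
  have hf: "f \<otimes> idm C V \<in> hom C V (?P \<odot> V)" using tns_hom[OF f idm_hom[of V]] by simp
  have hg: "idm C V \<otimes> g \<in> hom C (V \<odot> ?P) V" using tns_hom[OF idm_hom[of V] g] by simp
  have 1: "f \<cdot> x = scl C c f" "x \<cdot> g = scl C c g"
    unfolding c using cmp_scl_right[OF f idm_hom] cmp_scl_left[OF idm_hom g] idm_right[OF f] idm_left[OF g]
    by simp_all
  show ?thesis
    unfolding 1 fs_summand_mor_eq tns_scl_left[OF f idm_hom] tns_scl_right[OF idm_hom g] cmp_scl_right[OF S hf]
      cmp_scl_right[OF hg cmp_hom[OF S hf]] cmp_scl_left[OF hg cmp_hom[OF S hf]] ..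
qed

text \<open>
  Expand \<open>f' j\<close> in the \<open>f l\<close>. The coefficients are endomorphisms of \<open>\<one>\<close>, which pass to the other argument,
  where they recombine the \<open>g' j\<close> to \<open>g l\<close>.
\<close>
lemma fs_summand_sum_independent:
  assumes R: "reproducing (pow_ob V n \<one>) r f g" and R': "coreproducing (pow_ob V n \<one>) s f' g'"
  shows "(\<Sum>j<s. fs_summand_mor V n (f' j) (g' j)) = (\<Sum>l<r. fs_summand_mor V n (f l) (g l))"
proof -
  let ?P = "pow_ob V n \<one>"
  have fg: "f l \<in> hom C \<one> ?P" "g l \<in> hom C ?P \<one>" if "l < r" for l
    using R that by (auto simp: reproducing_def)
  have fg': "f' l \<in> hom C \<one> ?P" "g' l \<in> hom C ?P \<one>" if "l < s" for l
    using R' that by (auto simp: coreproducing_def)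
  have gf: "g l \<cdot> f' j \<in> hom C \<one> \<one>" if "l < r" "j < s" for l j
    by (rule cmp_hom[OF fg(2)[OF that(1)] fg'(1)[OF that(2)]])
  have "(\<Sum>j<s. fs_summand_mor V n (f' j) (g' j)) = (\<Sum>j<s. \<Sum>l<r. fs_summand_mor V n (f l) ((g l \<cdot> f' j) \<cdot> g' j))"
  proof (rule sum.cong[OF refl])
    fix j assume "j \<in> {..<s}"
    then have j: "j < s" by simp
    have "f' j = (\<Sum>l<r. f l \<cdot> (g l \<cdot> f' j))"
      using R fg'(1)[OF j] by (simp add: reproducing_def)
    then have "fs_summand_mor V n (f' j) (g' j) = fs_summand_mor V n (\<Sum>l<r. f l \<cdot> (g l \<cdot> f' j)) (g' j)" by simp
    also have "\<dots> = (\<Sum>l<r. fs_summand_mor V n (f l \<cdot> (g l \<cdot> f' j)) (g' j))"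
      by (rule fs_summand_mor_linear(1)[where g = "\<lambda>_. g' j"])
        (use j in \<open>auto intro!: cmp_hom[OF fg(1) gf] fg'\<close>)
    also have "\<dots> = (\<Sum>l<r. fs_summand_mor V n (f l) ((g l \<cdot> f' j) \<cdot> g' j))"
      by (rule sum.cong) (use j in \<open>auto intro!: fs_summand_mor_balanced fg fg' gf\<close>)
    finally show "fs_summand_mor V n (f' j) (g' j) = (\<Sum>l<r. fs_summand_mor V n (f l) ((g l \<cdot> f' j) \<cdot> g' j))" .
  qed
  also have "\<dots> = (\<Sum>l<r. \<Sum>j<s. fs_summand_mor V n (f l) ((g l \<cdot> f' j) \<cdot> g' j))" by (rule sum.swap)
  also have "\<dots> = (\<Sum>l<r. fs_summand_mor V n (f l) (g l))"
  proof (rule sum.cong[OF refl])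
    fix l assume "l \<in> {..<r}"
    then have l: "l < r" by simp
    have "(\<Sum>j<s. fs_summand_mor V n (f l) ((g l \<cdot> f' j) \<cdot> g' j)) = fs_summand_mor V n (f l) (\<Sum>j<s. (g l \<cdot> f' j) \<cdot> g' j)"
      by (rule fs_summand_mor_linear(2)[where f = "\<lambda>_. f l", symmetric])
        (use l in \<open>auto intro!: cmp_hom[OF gf fg'(2)] fg\<close>)
    also have "(\<Sum>j<s. (g l \<cdot> f' j) \<cdot> g' j) = g l"
      using R' fg(2)[OF l] by (simp add: coreproducing_def)
    finally show "(\<Sum>j<s. fs_summand_mor V n (f l) ((g l \<cdot> f' j) \<cdot> g' j)) = fs_summand_mor V n (f l) (g l)" .
  qed
  finally show ?thesis .
qed

text \<open>
  The exchange is the sum over the copies of \<open>\<one>\<close> in \<open>T\<close>; each summand of the composite factors through a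
  single copy and has the form treated in \<open>straighten\<close>.
\<close>
lemma fs_composite_eq:
  assumes X: "is_right_dual C (tpow C V m) X e d"
    and T: "is_trivial_component C (tpow C V (Suc m)) T \<iota> \<pi>"
    and S: "is_direct_sum C r (\<lambda>_. \<one>) T a b"
  shows "fs_composite C (Suc m) V X e d T \<iota> \<pi> = (\<Sum>j<r. fs_summand_mor V (Suc m) (\<iota> \<cdot> a j) (b j \<cdot> \<pi>))"
proof -
  let ?W = "pow_ob V m \<one>" let ?P = "V \<odot> ?W"
  let ?e = "Arrow (?W \<odot> X) e \<one>" and ?d = "Arrow \<one> d (X \<odot> ?W)"
  interpret x: dual_pair C X ?W ?e ?d
    using X unfolding is_right_dual_iff_left dual_pair_Arrow_iff tpow_eq_pow_ob .
  note D = is_direct_sumD[OF S]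
  have h: "\<iota> \<in> hom C T ?P" "\<pi> \<in> hom C ?P T"
    using trivial_component_hom(1,2)[OF T] by (simp_all add: tpow_eq_pow_ob)
  let ?\<iota> = "Arrow T \<iota> ?P" and ?\<pi> = "Arrow ?P \<pi> T"
  let ?a = "\<lambda>j. Arrow \<one> (a j) T" and ?b = "\<lambda>j. Arrow T (b j) \<one>"
  have t: "arr ?\<iota>" "arr ?\<pi>" using h Arrow_typed by blast+
  have tab: "arr (?a j)" "arr (?b j)" if "j < r" for j using D(1,2)[OF that] Arrow_typed by blast+
  have pV: "pow_ob V m V = ?P" using pow_ob_shift[of V m \<one>] by simp
  let ?A = "((V \<rhd> ?e) \<bullet> asc V ?W X) \<bullet> (?\<iota> \<lhd> X)"
  let ?B = "X \<rhd> ?\<pi>" and ?Q = "X \<rhd> strength V m \<one> V" and ?R = "asc X ?W V \<bullet> (?d \<lhd> V)"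
  let ?s = "\<lambda>j. (?a j \<lhd> X) \<bullet> (X \<rhd> ?b j)"
  have A: "mor ?A \<in> hom C (T \<odot> X) V" by (rule mor_hom) (use t in simp)
  have B: "mor ?B \<in> hom C (X \<odot> ?P) (X \<odot> T)" by (rule mor_hom) (use t in simp)
  have Q: "mor ?Q \<in> hom C (X \<odot> (?W \<odot> V)) (X \<odot> ?P)" by (rule mor_hom) (simp add: pV)
  have R: "mor ?R \<in> hom C V (X \<odot> (?W \<odot> V))" by (rule mor_hom) simp
  have s: "mor (?s j) \<in> hom C (X \<odot> T) (T \<odot> X)" if "j < r" for j
    by (rule mor_hom) (use tab[OF that] in simp)
  have "fs_composite C (Suc m) V X e d T \<iota> \<pi> =
      ((((mor ?A \<cdot> (\<Sum>j<r. mor (?s j))) \<cdot> mor ?B) \<cdot> mor ?Q) \<cdot> mor ?R)"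
    unfolding fs_composite_def trivial_swap_eq[OF S] swap_along_def
    by (simp add: tpow_eq_pow_ob mor_strength del: comp_assoc)
  also have "mor ?A \<cdot> (\<Sum>j<r. mor (?s j)) = (\<Sum>j<r. mor ?A \<cdot> mor (?s j))"
    by (rule cmp_sum_right[OF A]) (rule s, simp)
  also have "\<dots> \<cdot> mor ?B = (\<Sum>j<r. (mor ?A \<cdot> mor (?s j)) \<cdot> mor ?B)"
    by (rule cmp_sum_left[OF B]) (rule cmp_hom[OF A s], simp)
  also have "\<dots> \<cdot> mor ?Q = (\<Sum>j<r. ((mor ?A \<cdot> mor (?s j)) \<cdot> mor ?B) \<cdot> mor ?Q)"
    by (rule cmp_sum_left[OF Q]) (rule cmp_hom[OF cmp_hom[OF A s] B], simp)
  also have "\<dots> \<cdot> mor ?R = (\<Sum>j<r. (((mor ?A \<cdot> mor (?s j)) \<cdot> mor ?B) \<cdot> mor ?Q) \<cdot> mor ?R)"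
    by (rule cmp_sum_left[OF R]) (rule cmp_hom[OF cmp_hom[OF cmp_hom[OF A s] B] Q], simp)
  also have "\<dots> = (\<Sum>j<r. fs_summand_mor V (Suc m) (\<iota> \<cdot> a j) (b j \<cdot> \<pi>))"
  proof (rule sum.cong[OF refl])
    fix j assume "j \<in> {..<r}"
    then have j: "j < r" by simp
    note tj = tab[OF j]
    let ?f = "?\<iota> \<bullet> ?a j" and ?g = "?b j \<bullet> ?\<pi>"
    have "(((?A \<bullet> ?s j) \<bullet> ?B) \<bullet> ?Q) \<bullet> ?R =
        ((V \<rhd> ?e) \<bullet> asc V ?W X) \<bullet> (?f \<lhd> X) \<bullet> (X \<rhd> (?g \<bullet> strength V m \<one> V)) \<bullet> ?R"
      using t tj by (simp add: ide_ten_comp comp_ten_ide pV)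
    also have "\<dots> = (V \<rhd> (?g \<bullet> strength V m \<one> V)) \<bullet> asc V ?W V \<bullet> (?f \<lhd> V)"
      by (rule x.straighten) (use t tj in \<open>simp_all add: pV\<close>)
    also have "\<dots> = fs_summand V (Suc m) ?f ?g"
      using t tj by (simp add: fs_summand_def extend_def ide_ten_comp pV)
    finally have "mor ((((?A \<bullet> ?s j) \<bullet> ?B) \<bullet> ?Q) \<bullet> ?R) = mor (fs_summand V (Suc m) ?f ?g)" by simp
    moreover have "?f = Arrow \<one> (\<iota> \<cdot> a j) (pow_ob V (Suc m) \<one>)" "?g = Arrow (pow_ob V (Suc m) \<one>) (b j \<cdot> \<pi>) \<one>"
      by (simp_all add: compose_def)
    ultimately show "(((mor ?A \<cdot> mor (?s j)) \<cdot> mor ?B) \<cdot> mor ?Q) \<cdot> mor ?R = fs_summand_mor V (Suc m) (\<iota> \<cdot> a j) (b j \<cdot> \<pi>)"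
      unfolding fs_summand_mor_def mor_simps(1) by simp
  qed
  finally show ?thesis .
qed

lemma fs_endo_eq:
  assumes R: "reproducing (pow_ob V (Suc m) \<one>) r f g"
  shows "fs_endo C (Suc m) V = (\<Sum>j<r. fs_summand_mor V (Suc m) (f j) (g j))"
proof -
  let ?n = "Suc m"
  have eq: "fs_composite C ?n V X e d T \<iota> \<pi> = (\<Sum>j<r. fs_summand_mor V ?n (f j) (g j))"
    if X: "is_right_dual C (tpow C V m) X e d" and T: "is_trivial_component C (tpow C V ?n) T \<iota> \<pi>"
    for X e d T \<iota> \<pi>
  proof -
    obtain s a b where S: "is_direct_sum C s (\<lambda>_. \<one>) T a b"
      using trivial_component_hom(5)[OF T] by (auto simp: is_trivial_def is_multiple_of_def)
    have "coreproducing (pow_ob V ?n \<one>) s (\<lambda>j. \<iota> \<cdot> a j) (\<lambda>j. b j \<cdot> \<pi>)"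
      using trivial_component_reproducing(2)[OF T S] unfolding tpow_eq_pow_ob .
    from fs_summand_sum_independent[OF R this] show ?thesis unfolding fs_composite_eq[OF X T S] .
  qed
  obtain X e d where X: "is_right_dual C (tpow C V m) X e d" using right_dual_exists by blast
  obtain T \<iota> \<pi> where T: "is_trivial_component C (tpow C V ?n) T \<iota> \<pi>" using trivial_component_exists by blast
  show ?thesis
    unfolding fs_endo_def diff_Suc_1
  proof (rule the_equality)
    show "\<exists>X e d T \<iota> \<pi>. is_right_dual C (tpow C V m) X e d \<and> is_trivial_component C (tpow C V ?n) T \<iota> \<pi> \<and>
        (\<Sum>j<r. fs_summand_mor V ?n (f j) (g j)) = fs_composite C ?n V X e d T \<iota> \<pi>"
      using X T eq[OF X T] by metis
  qed (auto simp: eq)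
qed

lemma ptr_left_sum:
  assumes "\<And>j. j \<in> A \<Longrightarrow> F j \<in> hom C V V"
  shows "ptr_left C V (\<Sum>j\<in>A. F j) = (\<Sum>j\<in>A. ptr_left C V (F j))"
proof -
  let ?D = "V\<^sup>\<or>"
  have piv_inv_arr: "piv_inv C V \<in> hom C (?D\<^sup>\<or>) V" using mor_hom[of "piv_inv_arr V"] by simp
  have db: "db C ?D \<in> hom C \<one> (?D \<odot> ?D\<^sup>\<or>)" using mor_hom[of "db_arr ?D"] by simp
  have ev: "ev C V \<in> hom C (?D \<odot> V) \<one>" using mor_hom[of "ev_arr V"] by simp
  have h: "idm C ?D \<otimes> (F j \<cdot> piv_inv C V) \<in> hom C (?D \<odot> ?D\<^sup>\<or>) (?D \<odot> V)" if "j \<in> A" for j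
    by (intro tns_hom idm_hom cmp_hom[OF assms piv_inv_arr] that)
  have "(\<Sum>j\<in>A. F j) \<cdot> piv_inv C V = (\<Sum>j\<in>A. F j \<cdot> piv_inv C V)"
    by (rule cmp_sum_left[OF piv_inv_arr assms])
  moreover have "idm C ?D \<otimes> (\<Sum>j\<in>A. F j \<cdot> piv_inv C V) = (\<Sum>j\<in>A. idm C ?D \<otimes> (F j \<cdot> piv_inv C V))"
    by (rule tns_sum_right[OF idm_hom]) (rule cmp_hom[OF assms piv_inv_arr])
  moreover have "ev C V \<cdot> (\<Sum>j\<in>A. idm C ?D \<otimes> (F j \<cdot> piv_inv C V)) =
      (\<Sum>j\<in>A. ev C V \<cdot> (idm C ?D \<otimes> (F j \<cdot> piv_inv C V)))"
    by (rule cmp_sum_right[OF ev h])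
  moreover have "(\<Sum>j\<in>A. ev C V \<cdot> (idm C ?D \<otimes> (F j \<cdot> piv_inv C V))) \<cdot> db C ?D =
      (\<Sum>j\<in>A. (ev C V \<cdot> (idm C ?D \<otimes> (F j \<cdot> piv_inv C V))) \<cdot> db C ?D)"
    by (rule cmp_sum_left[OF db]) (rule cmp_hom[OF ev h])
  ultimately show ?thesis by (simp add: ptr_left_def)
qed

lemma indicator_eq_trace:
  "scl C (fs_indicator C (Suc m) V) (idm C \<one>) = ptr_left C V (fs_endo C (Suc m) V)"
proof -
  obtain r f g where R: "reproducing (pow_ob V (Suc m) \<one>) r f g" using reproducing_exists by blast
  then have "fs_summand_mor V (Suc m) (f j) (g j) \<in> hom C V V" if "j < r" for j
    using that by (intro fs_summand_mor_hom) (auto simp: reproducing_def)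
  then show ?thesis unfolding indicator_eq_sum[OF R] fs_endo_eq[OF R] by (subst ptr_left_sum) auto
qed

text \<open>
  The two indicators are sums of left pivotal traces of \<open>fs_summand\<close> over the family \<open>a', b'\<close> of \<open>(V\<^sup>\<or>)\<^sup>n\<close>
  and the corresponding family \<open>a, b\<close> of \<open>V\<^sup>n\<close>. They agree term by term.
\<close>
lemma indicator_dual:
  assumes "spherical C"
  shows "fs_indicator C (Suc m) V = fs_indicator C (Suc m) (V\<^sup>\<or>)"
proof -
  define n where "n = Suc m"
  let ?D = "V\<^sup>\<or>" and ?P = "pow_ob V n \<one>" and ?P' = "pow_ob (V\<^sup>\<or>) n \<one>"
  interpret v: dual_pair C V ?D "ev_arr V" "db_arr V" by (rule dual_pair_dual)
  obtain r f' g' where R': "reproducing ?P' r f' g'" "coreproducing ?P' r f' g'"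
    using reproducing_exists by blast
  define a' where "a' j = Arrow \<one> (f' j) (pow_ob ?D n \<one>)" for j
  define b' where "b' j = Arrow (pow_ob ?D n \<one>) (g' j) \<one>" for j
  have a': "a' j \<^bold>: \<one> \<rightarrow> pow_ob ?D n \<one>" and b': "b' j \<^bold>: pow_ob ?D n \<one> \<rightarrow> \<one>" if "j < r" for j
    using R'(1) that unfolding reproducing_def a'_def b'_def Arrow_typed by blast+
  define a where "a j = pow_arr V n (b' j) \<bullet> v.db_pow n \<one>" for j
  define b where "b j = v.ev_pow n \<one> \<bullet> extend ?D n (a' j) (pow_ob V n \<one>)" for j
  have a: "a j \<^bold>: \<one> \<rightarrow> pow_ob V n \<one>" and b: "b j \<^bold>: pow_ob V n \<one> \<rightarrow> \<one>" if "j < r" for j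
    using b'[OF that] extend_typed[OF a'[OF that], of "pow_ob V n \<one>"] by (simp_all add: a_def b_def)
  have b'_eq: "b' j = v.ev_pow n \<one> \<bullet> pow_arr ?D n (a j)" if "j < r" for j
    unfolding a_def by (rule v.ev_pow_pow_arr_pow_arr_db_pow[OF b'[OF that], symmetric])
  have R: "reproducing (pow_ob V n \<one>) r (\<lambda>j. mor (a j)) (\<lambda>j. mor (b j))"
    unfolding a_def b_def
    by (rule v.reproducing_transfer) (use R' a' b' in \<open>simp_all add: a'_def b'_def\<close>)
  have "ptr_left C V (fs_summand_mor V n (mor (a j)) (mor (b j))) = ptr_left C ?D (fs_summand_mor ?D n (f' j) (g' j))"
    if j: "j < r" for j
  proof -
    let ?F = "fs_summand V n (a j) (b j)" and ?F' = "fs_summand ?D n (a' j) (b' j)"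
    have F: "?F \<^bold>: V \<rightarrow> V" and F': "?F' \<^bold>: ?D \<rightarrow> ?D"
      using fs_summand_typed[OF a[OF j] b[OF j]] fs_summand_typed[OF a'[OF j] b'[OF j]] by blast+
    have fs_summand_mor: "fs_summand_mor V n (mor (a j)) (mor (b j)) = mor ?F" "fs_summand_mor ?D n (f' j) (g' j) = mor ?F'"
    proof -
      have "Arrow \<one> (mor (a j)) ?P = a j" "Arrow ?P (mor (b j)) \<one> = b j"
        using a[OF j] b[OF j] by (auto intro!: arrow_eqI)
      then show "fs_summand_mor V n (mor (a j)) (mor (b j)) = mor ?F" by (simp add: fs_summand_mor_def)
      show "fs_summand_mor ?D n (f' j) (g' j) = mor ?F'" by (simp add: fs_summand_mor_def a'_def b'_def)
    qed
    have dual: "dual_arr ?F = ?F'"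
      by (rule dual_arr_eqI[OF F F']) (rule v.fs_summand_dual[OF a[OF j] a'[OF j] b_def b'_eq[OF j]])
    have "ptr_left C V (mor ?F) = ptr_right C V (mor ?F)"
      using assms mor_hom[OF F] by (simp add: spherical_def)
    also have "\<dots> = mor (ptr_left_arr ?D (dual_arr ?F))" unfolding ptr_left_dual[OF F] mor_ptr_right_arr[OF F] ..
    also have "\<dots> = ptr_left C ?D (mor ?F')" unfolding dual by (rule mor_ptr_left_arr[OF F'])
    finally show ?thesis unfolding fs_summand_mor .
  qed
  then have "scl C (fs_indicator C n V) (idm C \<one>) = scl C (fs_indicator C n ?D) (idm C \<one>)"
    unfolding n_def
    unfolding indicator_eq_sum[OF R[unfolded n_def]] indicator_eq_sum[OF R'(1)[unfolded n_def]] by simp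
  then show ?thesis using unit_idm_nonzero by (simp add: n_def)
qed

end

theorem theorem7p6:
  fixes C :: "('o, 'm::ab_group_add, 'k::field) pivcat"
    and n :: nat and V :: 'o
  assumes "semisimple_pivotal_category C"
    and "1 \<le> n"
  shows "scl C (fs_indicator C n V) (idm C (unit_ob C)) = ptr_left C V (fs_endo C n V) \<and>
    (spherical C \<longrightarrow> fs_indicator C n V = fs_indicator C n (dual C V))"
proof -
  interpret semisimple_pivotal_category C by (rule assms(1))
  obtain m where n: "n = Suc m" using assms(2) by (cases n) auto
  show ?thesis unfolding n using indicator_eq_trace indicator_dual by blast
qed

end
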